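(* For any complex number $t$, $$\prod_{k \geq 1}(1-x^k)^{2t^2+t} = \sum_{\lambda \in DD}\delta_\lambda\, x^{|\lambda|/2} \prod_{h \in \mathcal{H}(\lambda)} \left( 1- \frac{2t+2}{h\,\varepsilon_h}\right),$$ where the sum is over all doubled distinct partitions $\lambda$, $\delta_\lambda$ is $1$ (respectively $-1$) if the Durfee square of $\lambda$ has even (respectively odd) size, the product is over the hook lengths $h$ of all boxes of $\lambda$ (with multiplicity), and $\varepsilon_h=-1$ if $h$ is the hook length of a box strictly above the diagonal of the Ferrers diagram of $\lambda$ and $\varepsilon_h=1$ otherwise.
   Context: A partition $\lambda=(\lambda_1\ge\dots\ge\lambda_\ell>0)$ has weight $|\lambda|=\sum\lambda_i$; set $\lambda_i=0$ for $i>\ell$; the empty partition is allowed. Its boxes are the pairs $(i,j)$ (row $i$, column $j$) with $1\le i\le\ell$, $1\le j\le\lambda_i$. Ferrers diagrams are drawn in French convention (rows stacked upwards), so a box $(i,j)$ is strictly above the (principal) diagonal iff $i>j$. $\lambda^*$ is the conjugate partition. The hook length of $(i,j)$ is $\lambda_i-j+\lambda^*_j-i+1$, and $\mathcal H(\lambda)$ is the multiset of hook lengths of all boxes. The Durfee length $D(\lambda)$ is the side length of the largest square in the diagram, $D(\lambda)=\#\{i:\lambda_i\ge i\}$, and $\delta_\lambda=(-1)^{D(\lambda)}$. A doubled distinct partition is a partition $\mu$ obtained from a partition $\mu^0$ with distinct parts by shifting row $i$ of the Ferrers diagram of $\mu^0$ by $i$ to the right, and adding $\mu^0_i$ boxes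 to the $i$-th column, for $1\le i\le\ell(\mu^0)$. Equivalently, $\mu_i=\mu_i^*+1$ for all $1\le i\le D(\mu)$. $DD$ is the set of doubled distinct partitions; they have even weight (the empty partition belongs to $DD$). $\varepsilon_h$ depends on the box whose hook length is $h$. Here $x$ is a complex number with $|x|<1$; the sum is read as a power series in $x$, grouping the finitely many partitions of each weight. For complex $a$, $(1-u)^a=\exp\left(-a\sum_{m\ge1}u^m/m\right)$. *)

theory Defs
  imports "HOL-Analysis.Analysis"
begin

definition int_partition :: "nat list \<Rightarrow> bool" where
  "int_partition \<nu> \<longleftrightarrow> sorted_wrt (\<ge>) \<nu> \<and> (\<forall>p\<in>set \<nu>. 0 < p)"

definition weight :: "nat list \<Rightarrow> nat" where
  "weight \<nu> = sum_list \<nu>"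

(* Parts are indexed from 1. *)
definition part_at :: "nat list \<Rightarrow> nat \<Rightarrow> nat" where
  "part_at \<nu> i = (if 1 \<le> i \<and> i \<le> length \<nu> then \<nu> ! (i - 1) else 0)"

definition boxes :: "nat list \<Rightarrow> (nat \<times> nat) set" where
  "boxes \<nu> = {(i, j). 1 \<le> i \<and> i \<le> length \<nu> \<and> 1 \<le> j \<and> j \<le> part_at \<nu> i}"

definition conj_part :: "nat list \<Rightarrow> nat \<Rightarrow> nat" where
  "conj_part \<nu> j = card {i. (i, j) \<in> boxes \<nu>}"

definition hook_length :: "nat list \<Rightarrow> nat \<times> nat \<Rightarrow> int" where
  "hook_length \<nu> = (\<lambda>(i, j). int (part_at \<nu> i) - int j + int (conj_part \<nu> j) - int i + 1)"

(* Rows are stacked upwards (French convention), so i > j means strictly above the diagonal. *)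
definition hook_sign :: "nat \<times> nat \<Rightarrow> int" where
  "hook_sign = (\<lambda>(i, j). if i > j then -1 else 1)"

definition durfee :: "nat list \<Rightarrow> nat" where
  "durfee \<nu> = card {i. 1 \<le> i \<and> i \<le> part_at \<nu> i}"

definition durfee_sign :: "nat list \<Rightarrow> int" where
  "durfee_sign \<nu> = (-1) ^ durfee \<nu>"

(* Row i of the distinct partition is shifted by i, so its box (i, j) moves to (i, i + j).
   Because the parts are distinct, column i of the shifted diagram then consists of exactly
   the i - 1 boxes in rows 1, ..., i - 1; the boxes added to that column, one for each box
   (i, j) of row i, therefore lie in the rows i - 1 + j. *)
definition doubled_boxes :: "nat list \<Rightarrow> (nat \<times> nat) set" where
  "doubled_boxes \<mu> =
     (\<lambda>(i, j). (i, i + j)) ` boxes \<mu> \<union> (\<lambda>(i, j). (i - 1 + j, i)) ` boxes \<mu>"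

definition DD :: "nat list set" where
  "DD = {\<nu>. int_partition \<nu> \<and>
          (\<exists>\<mu>. int_partition \<mu> \<and> distinct \<mu> \<and> boxes \<nu> = doubled_boxes \<mu>)}"

(* (1 - u)^a for |u| < 1. *)
definition one_minus_cpow :: "complex \<Rightarrow> complex \<Rightarrow> complex" where
  "one_minus_cpow u a = exp (- a * (\<Sum>m. u ^ Suc m / of_nat (Suc m)))"

lemma finite_int_partitions: "finite {\<nu>. int_partition \<nu> \<and> weight \<nu> = n}"
proof (rule finite_subset)
  show "{\<nu>. int_partition \<nu> \<and> weight \<nu> = n} \<subseteq> {xs. set xs \<subseteq> {0..n} \<and> length xs \<le> n}"
  proof safe
    fix \<nu> x assume "n = weight \<nu>" "x \<in> set \<nu>"
    then show "x \<in> {0..weight \<nu>}"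
      by (simp add: weight_def member_le_sum_list)
  next
    fix \<nu> assume "int_partition \<nu>"
    then have "\<forall>p\<in>set \<nu>. 0 < p" by (simp add: int_partition_def)
    then show "length \<nu> \<le> weight \<nu>"
      unfolding weight_def by (induction \<nu>) auto
  qed
  show "finite {xs. set xs \<subseteq> {0..n} \<and> length xs \<le> n}"
    by (rule finite_lists_length_le) simp
qed

lemma boxes_eq_Sigma: "boxes \<nu> = (SIGMA i:{1..length \<nu>}. {1..part_at \<nu> i})"
  by (auto simp: boxes_def)

lemma finite_boxes: "finite (boxes \<nu>)"
  by (simp add: boxes_eq_Sigma)

lemma card_boxes: "card (boxes \<nu>) = weight \<nu>"
proof -
  have "card (boxes \<nu>) = (\<Sum>i=1..length \<nu>. part_at \<nu> i)"
    by (simp add: boxes_eq_Sigma)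
  also have "\<dots> = (\<Sum>i<length \<nu>. \<nu> ! i)"
    by (rule sum.reindex_bij_witness[of _ Suc "\<lambda>i. i - 1"]) (auto simp: part_at_def)
  also have "\<dots> = weight \<nu>"
    by (simp add: weight_def sum_list_sum_nth atLeast0LessThan)
  finally show ?thesis .
qed

lemma even_weight_DD:
  assumes "\<nu> \<in> DD"
  shows "even (weight \<nu>)"
proof -
  from assms obtain \<mu> where \<mu>: "boxes \<nu> = doubled_boxes \<mu>"
    by (auto simp: DD_def)
  let ?f = "\<lambda>(i::nat, j::nat). (i, i + j)" and ?g = "\<lambda>(i::nat, j::nat). (i - 1 + j, i)"
  have "card (doubled_boxes \<mu>) = card (?f ` boxes \<mu>) + card (?g ` boxes \<mu>)"
    unfolding doubled_boxes_def
    by (rule card_Un_disjoint) (simp_all add: finite_boxes, auto simp: boxes_def)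
  also have "card (?f ` boxes \<mu>) = card (boxes \<mu>)"
    by (rule card_image) (auto simp: inj_on_def)
  also have "card (?g ` boxes \<mu>) = card (boxes \<mu>)"
    by (rule card_image) (auto simp: inj_on_def)
  finally show ?thesis using \<mu> card_boxes[of \<nu>] by presburger
qed

lemma one_minus_cpow_eq_powr:
  assumes "norm u < 1"
  shows "one_minus_cpow u a = (1 - u) powr a"
proof -
  have "(\<lambda>n. (-1) ^ Suc n / of_nat n * (-u) ^ n) sums Ln (1 + (-u))"
    using assms by (intro Ln_series) simp
  then have "(\<lambda>n. - ((-1) ^ Suc n / of_nat n * (-u) ^ n)) sums (- Ln (1 - u))"
    by (intro sums_minus) simp
  moreover have "- ((-1) ^ Suc n / of_nat n * (-u) ^ n) = u ^ n / of_nat n" for n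
    by (cases "even n") auto
  ultimately have "(\<lambda>n. u ^ n / of_nat n) sums (- Ln (1 - u))"
    by (simp only:)
  then have "(\<lambda>n. u ^ Suc n / of_nat (Suc n)) sums (- Ln (1 - u))"
    by (subst sums_Suc_iff) simp
  then have "(\<Sum>n. u ^ Suc n / of_nat (Suc n)) = - Ln (1 - u)"
    by (rule sums_unique[symmetric])
  moreover have "1 - u \<noteq> 0" using assms by auto
  ultimately show ?thesis
    by (simp add: one_minus_cpow_def powr_def)
qed

end

theory Submission
  imports Defs "HOL-Complex_Analysis.Complex_Analysis" "HOL-Library.Sublist"
    "Jordan_Normal_Form.Determinant"
begin

text \<open>
  Put $z = 2t + 2$ and $d = 2t$. A doubled distinct partition is given by a strict partition
  $\mu$, and splitting off the first row and the first column shows that its hook product is a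
  minor of a Cauchy-like matrix: with $X_a = a^2 + za$ and $Y_b = b^2 - zb$ one has
  $X_a - Y_b = (a+b)(a-b+z)$, and for $z$ not an integer the hook product is the determinant,
  over the parts of $\mu$, of $M_{ab} = u_a v_b / (X_a - Y_b)$. Hence the right-hand side is the
  Fredholm determinant of $I - \mathrm{diag}(x^a) M$.

  The rows of $M$ have the generating functions
  $\sum_b M_{ab} v^b = v^{-a} - H(v)^{-1} \sum_{i=0}^{a} h_{a-i} (v^{-i} - v^{i+2})$ with
  $H(v) = \sum_i h_i v^i = (1-v)^{-d}$, and this makes sense for every power series $H$ with
  constant term 1. If $F(H)$ is the resulting determinant and $y = xc$, an intertwining
  relation with tridiagonal matrices gives
  \[ F(H / (1 - cv)) = (1 - cy) (1 - y^2) H(y)^{-1} F(H / (1 - yv)). \]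
  Starting at $c = 1$ and iterating, $F$ changes by the factor $\prod_k (1 - x^k)^{d+1}$ from $d$
  to $d + 1$, which is the theorem for $d \in \mathbb{N}$. Both sides have coefficients that are
  polynomials in $d$, so the theorem holds for all $d$.
\<close>

section \<open>Generating functions of the rows\<close>

text \<open>No infinite determinant and no limit in c occurs: determinants are truncated to size n
  and compared modulo x^(n+1). Truncation spoils the intertwining relation in two places. In the
  last row the error already carries x^(n+1); in the last column the entry of row i (counted from 0)
  only carries x^(i+2), and a grading by powers of x has to supply the rest.

  The factor H(y)^(-1) asks for the evaluation of a power series. For natural d the series 1/H is a
  polynomial in v, so this evaluation is a finite sum once n is large compared with d; hence the
  functional equation is only iterated for d in the natural numbers.

  Interpolation in d is used twice. The Cauchy form of the entries has the denominators a - b + z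
  and is compared with the hook products only for non-integral z, whereas the product formula is
  obtained only for natural d. The rows defined through H make sense for both kinds of d and link
  the two.\<close>

definition hook_num :: "'a::comm_ring_1 fps \<Rightarrow> nat \<Rightarrow> 'a fps" where
  "hook_num H k = Abs_fps (\<lambda>r. if r = 0 then 0
     else fps_nth H (k + r) + (if 2 \<le> r \<and> r \<le> k + 2 then fps_nth H (k + 2 - r) else 0))"

text \<open>\<open>hook_num H k\<close> is H times the row series: the coefficients h_{k+r} are the
  positive part of H v^(-k), and the window 2 <= r <= k + 2 holds the terms h_{k-i} v^(i+2).
  \<open>K\<close> stands for 1/H; the equation \<open>H * K = 1\<close> is assumed where it
  enters.\<close>

definition hook_row :: "'a::comm_ring_1 fps \<Rightarrow> 'a fps \<Rightarrow> nat \<Rightarrow> 'a fps" where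
  "hook_row H K k = hook_num H k * K"

lemma hook_num_nth:
  "fps_nth (hook_num H k) r = (if r = 0 then 0
     else fps_nth H (k + r) + (if 2 \<le> r \<and> r \<le> k + 2 then fps_nth H (k + 2 - r) else 0))"
  by (simp add: hook_num_def)

lemma linear_factor_nth:
  fixes f :: "'a::comm_ring_1 fps"
  shows "fps_nth ((1 - fps_const c * fps_X) * f) n =
    fps_nth f n - c * (if n = 0 then 0 else fps_nth f (n - 1))"
proof -
  have "(1 - fps_const c * fps_X) * f = f - fps_const c * (fps_X * f)"
    by (simp add: algebra_simps)
  then show ?thesis by simp
qed

text \<open>Up to boundary terms the index shift S: k -> k + 1 acts on a row like multiplication by
  1/v. Apart from the factor v, the right side is (1 - y S)(1 - c/S) applied to row k + 1, and
  \<open>rel\<close> turns this into (1 - y S)(1 - y/S) for \<open>Hy\<close>. This operator is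
  symmetric under inversion, so it acts in the same way on v^(-i) and on v^(i+2). The multiple of v
  - v^3 is what is left over at the boundary.\<close>

lemma hook_num_shift:
  fixes Hc Hy :: "'a::comm_ring_1 fps"
  assumes rel: "(1 - fps_const c * fps_X) * Hc = (1 - fps_const y * fps_X) * Hy"
  shows "hook_num Hy (Suc k) * (1 - fps_const y * fps_X) * (fps_X - fps_const y)
      + fps_const (y * fps_nth Hy (k + 2)) * (fps_X - fps_X ^ 3)
    = fps_X * (fps_const (1 + c * y) * hook_num Hc (Suc k) - fps_const y * hook_num Hc (k + 2)
        - fps_const c * hook_num Hc k)"
    (is "?L = ?R")
proof (rule fps_ext)
  fix s
  have r0: "fps_nth Hc 0 = fps_nth Hy 0"
    using arg_cong[OF rel, of "\<lambda>f. fps_nth f 0"] by (simp add: linear_factor_nth)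
  have rS: "fps_nth Hy (Suc i) = fps_nth Hc (Suc i) - c * fps_nth Hc i + y * fps_nth Hy i" for i
    using arg_cong[OF rel, of "\<lambda>f. fps_nth f (Suc i)"] by (simp add: linear_factor_nth algebra_simps)
  have L: "?L = fps_const (1 + y * y) * (fps_X * hook_num Hy (Suc k)) - fps_const y * hook_num Hy (Suc k)
     - fps_const y * (fps_X ^ 2 * hook_num Hy (Suc k)) + fps_const (y * fps_nth Hy (k + 2)) * (fps_X - fps_X ^ 3)"
    by (simp add: algebra_simps power2_eq_square flip: fps_const_mult fps_const_add)
  have R: "?R = fps_const (1 + c * y) * (fps_X * hook_num Hc (Suc k)) - fps_const y * (fps_X * hook_num Hc (k + 2))
        - fps_const c * (fps_X * hook_num Hc k)"
    by (simp add: algebra_simps)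
  \<comment> \<open>For 4 <= s <= k + 3 the windows of all shifted rows are active, from s = k + 6
    on none is; the other values of s are transitional.\<close>
  consider "s = 0" | "s = 1" | "s = 2" | "s = 3" | r where "s = r + 4" "r < k" | "s = k + 4" | "s = k + 5"
    | r where "s = k + 6 + r"
  proof -
    assume *: "s = 0 \<Longrightarrow> thesis" "s = 1 \<Longrightarrow> thesis" "s = 2 \<Longrightarrow> thesis" "s = 3 \<Longrightarrow> thesis"
      "\<And>r. s = r + 4 \<Longrightarrow> r < k \<Longrightarrow> thesis" "s = k + 4 \<Longrightarrow> thesis" "s = k + 5 \<Longrightarrow> thesis"
      "\<And>r. s = k + 6 + r \<Longrightarrow> thesis"
    have "s \<le> 3 \<or> (s - 4 < k \<and> s = (s - 4) + 4) \<or> s = k + 4 \<or> s = k + 5 \<or> s = k + 6 + (s - (k + 6))" by linarith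
    moreover have "s \<le> 3 \<Longrightarrow> s = 0 \<or> s = 1 \<or> s = 2 \<or> s = 3" by linarith
    ultimately show thesis using * by blast
  qed
  then show "fps_nth ?L s = fps_nth ?R s"
  proof cases
    case (5 r)
    then obtain e where e: "k = Suc (r + e)" using less_imp_Suc_add by auto
    show ?thesis unfolding L R using 5 e
      by (simp add: fps_X_power_mult_nth fps_X_power_nth hook_num_nth rS numeral_eq_Suc algebra_simps)
  next
    case 8
    show ?thesis unfolding L R using 8
      by (simp add: fps_X_power_mult_nth fps_X_power_nth hook_num_nth rS numeral_eq_Suc algebra_simps)
  qed (unfold L R, simp_all add: fps_X_power_mult_nth fps_X_power_nth hook_num_nth rS r0 numeral_eq_Suc algebra_simps)
qed

lemma hook_num_0:
  assumes "fps_nth H 0 = 1"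
  shows "hook_num H 0 = H - 1 + fps_X ^ 2"
proof (rule fps_ext)
  fix s :: nat
  consider "s = 0" | "s = 1" | "s = 2" | r where "s = r + 3"
  proof -
    assume *: "s = 0 \<Longrightarrow> thesis" "s = 1 \<Longrightarrow> thesis" "s = 2 \<Longrightarrow> thesis" "\<And>r. s = r + 3 \<Longrightarrow> thesis"
    have "s = 0 \<or> s = 1 \<or> s = 2 \<or> s = (s - 3) + 3" by linarith
    then show thesis using * by blast
  qed
  then show "fps_nth (hook_num H 0) s = fps_nth (H - 1 + fps_X ^ 2) s"
    by cases (auto simp: hook_num_nth assms fps_X_power_nth numeral_2_eq_2)
qed

lemma hook_row_0:
  assumes "H * K = 1" "fps_nth H 0 = 1"
  shows "hook_row H K 0 = 1 - (1 - fps_X ^ 2) * K"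
  unfolding hook_row_def hook_num_0[OF assms(2)]
  using assms(1) by (simp add: algebra_simps)

lemma hook_row_nth_0 [simp]: "fps_nth (hook_row H K k) 0 = 0"
  by (simp add: hook_row_def hook_num_nth)

text \<open>Through this value the coefficient \<open>fps_nth Hy (k + 2)\<close> of the boundary
  term is itself an entry in column 1, so the boundary term has the form of the matrix times a
  rank-one matrix.\<close>

lemma hook_row_nth_1:
  assumes "fps_nth K 0 = 1"
  shows "fps_nth (hook_row H K k) 1 = fps_nth H (k + 1)"
  using assms by (simp add: hook_row_def fps_mult_nth hook_num_nth)

text \<open>Multiplication of the previous identity by \<open>Kc\<close>, with (1 - y v) Kc = (1 - c
  v) Ky, turns the factor on the left into (1 - c v)(v - y), which is a tridiagonal action on the
  columns. The boundary term becomes a multiple of row 0 because (1 - v^2) Kc is 1 minus row 0, and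
  the constant 1 only reaches column 0.\<close>

lemma hook_row_shift:
  fixes Hc Hy K :: "'a::comm_ring_1 fps" and c y :: 'a
  defines "Kc \<equiv> K * (1 - fps_const c * fps_X)" and "Ky \<equiv> K * (1 - fps_const y * fps_X)"
  assumes rel: "(1 - fps_const c * fps_X) * Hc = (1 - fps_const y * fps_X) * Hy"
    and inv: "Hc * Kc = 1" and H0: "fps_nth Hc 0 = 1" and "0 < b"
  shows "(1 + c * y) * fps_nth (hook_row Hy Ky (Suc k)) b - c * fps_nth (hook_row Hy Ky (Suc k)) (b - 1)
      - y * fps_nth (hook_row Hy Ky (Suc k)) (b + 1)
      - y * fps_nth Hy (k + 2) * fps_nth (hook_row Hc Kc 0) b
    = (1 + c * y) * fps_nth (hook_row Hc Kc (Suc k)) b - y * fps_nth (hook_row Hc Kc (k + 2)) b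
      - c * fps_nth (hook_row Hc Kc k) b"
proof -
  let ?m = "hook_row Hy Ky (Suc k)"
  have r0: "(1 - fps_X ^ 2) * Kc = 1 - hook_row Hc Kc 0"
    using hook_row_0[OF inv H0] by simp
  have "fps_const (1 + c * y) * (fps_X * ?m) - fps_const c * (fps_X ^ 2 * ?m) - fps_const y * ?m
      + fps_const (y * fps_nth Hy (k + 2)) * (fps_X * ((1 - fps_X ^ 2) * Kc)) =
    (hook_num Hy (Suc k) * (1 - fps_const y * fps_X) * (fps_X - fps_const y)
      + fps_const (y * fps_nth Hy (k + 2)) * (fps_X - fps_X ^ 3)) * Kc"
    unfolding hook_row_def Ky_def Kc_def
    by (simp add: algebra_simps power2_eq_square power3_eq_cube flip: fps_const_mult fps_const_add)
  also have "\<dots> = fps_X * (fps_const (1 + c * y) * hook_row Hc Kc (Suc k) - fps_const y * hook_row Hc Kc (k + 2)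
        - fps_const c * hook_row Hc Kc k)"
    unfolding hook_num_shift[OF rel] by (simp add: hook_row_def algebra_simps)
  finally have eq: "fps_const (1 + c * y) * (fps_X * ?m) - fps_const c * (fps_X ^ 2 * ?m) - fps_const y * ?m
      + fps_const (y * fps_nth Hy (k + 2)) * (fps_X * (1 - hook_row Hc Kc 0)) =
      fps_X * (fps_const (1 + c * y) * hook_row Hc Kc (Suc k) - fps_const y * hook_row Hc Kc (k + 2)
        - fps_const c * hook_row Hc Kc k)"
    unfolding r0 .
  show ?thesis
    using arg_cong[OF eq, of "\<lambda>f. fps_nth f (Suc b)"] \<open>0 < b\<close>
    by (cases "b = 1") (simp_all add: fps_X_power_mult_nth fps_X_power_mult_right_nth algebra_simps Suc_diff_Suc)
qed

text \<open>Adding the two neighbouring rows amounts to multiplication by v + 1/v, which is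
  symmetric under v -> 1/v; the term with h_{k+2} is the boundary correction. The recurrence
  determines all rows from the rows 0 and -1, and this is how the closed form is recognised.\<close>

lemma hook_num_rec:
  fixes H :: "'a::comm_ring_1 fps"
  shows "fps_X * hook_num H (k + 2) + fps_X * hook_num H k =
     (1 + fps_X ^ 2) * hook_num H (Suc k) - fps_const (fps_nth H (k + 2)) * ((1 - fps_X ^ 2) * fps_X)"
    (is "?L = ?R")
proof (rule fps_ext)
  fix s :: nat
  have R: "?R = hook_num H (Suc k) + fps_X ^ 2 * hook_num H (Suc k)
      - fps_const (fps_nth H (k + 2)) * (fps_X - fps_X ^ 3)"
    by (simp add: algebra_simps power2_eq_square power3_eq_cube)
  consider "s = 0" | "s = 1" | "s = 2" | "s = 3" | r where "s = r + 4" "r < k" | "s = k + 4" | "s = k + 5"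
    | r where "s = k + 6 + r"
  proof -
    assume *: "s = 0 \<Longrightarrow> thesis" "s = 1 \<Longrightarrow> thesis" "s = 2 \<Longrightarrow> thesis" "s = 3 \<Longrightarrow> thesis"
      "\<And>r. s = r + 4 \<Longrightarrow> r < k \<Longrightarrow> thesis" "s = k + 4 \<Longrightarrow> thesis" "s = k + 5 \<Longrightarrow> thesis"
      "\<And>r. s = k + 6 + r \<Longrightarrow> thesis"
    have "s \<le> 3 \<or> (s - 4 < k \<and> s = (s - 4) + 4) \<or> s = k + 4 \<or> s = k + 5 \<or> s = k + 6 + (s - (k + 6))" by linarith
    moreover have "s \<le> 3 \<Longrightarrow> s = 0 \<or> s = 1 \<or> s = 2 \<or> s = 3" by linarith
    ultimately show thesis using * by blast
  qed
  then show "fps_nth ?L s = fps_nth ?R s"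
  proof cases
    case (5 r)
    then obtain e where e: "k = Suc (r + e)" using less_imp_Suc_add by auto
    show ?thesis unfolding R using 5 e
      by (simp add: fps_X_power_mult_nth fps_X_power_mult_right_nth hook_num_nth numeral_eq_Suc algebra_simps)
  next
    case 8
    show ?thesis unfolding R using 8
      by (simp add: fps_X_power_mult_nth fps_X_power_mult_right_nth hook_num_nth numeral_eq_Suc algebra_simps)
  qed (unfold R, simp_all add: fps_X_power_mult_nth fps_X_power_mult_right_nth hook_num_nth numeral_eq_Suc algebra_simps)
qed

lemma hook_row_rec:
  fixes H K :: "'a::comm_ring_1 fps"
  assumes "H * K = 1" "fps_nth H 0 = 1" "0 < b"
  shows "fps_nth (hook_row H K (k + 2)) b = fps_nth (hook_row H K (Suc k)) (b - 1)
     + fps_nth (hook_row H K (Suc k)) (b + 1) - fps_nth (hook_row H K k) b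
     + fps_nth H (k + 2) * fps_nth (hook_row H K 0) b"
proof -
  have "fps_X * hook_row H K (k + 2) + fps_X * hook_row H K k =
      (fps_X * hook_num H (k + 2) + fps_X * hook_num H k) * K"
    by (simp add: hook_row_def algebra_simps)
  also have "\<dots> = hook_row H K (Suc k) + fps_X ^ 2 * hook_row H K (Suc k)
      - fps_const (fps_nth H (k + 2)) * (fps_X * ((1 - fps_X ^ 2) * K))"
    unfolding hook_num_rec by (simp add: hook_row_def algebra_simps)
  also have "(1 - fps_X ^ 2) * K = 1 - hook_row H K 0"
    using hook_row_0[OF assms(1,2)] by simp
  finally have eq: "fps_X * hook_row H K (k + 2) + fps_X * hook_row H K k =
      hook_row H K (Suc k) + fps_X ^ 2 * hook_row H K (Suc k)
      - fps_const (fps_nth H (k + 2)) * (fps_X * (1 - hook_row H K 0))" .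
  show ?thesis
    using arg_cong[OF eq, of "\<lambda>f. fps_nth f (Suc b)"] \<open>0 < b\<close>
    by (cases "b = 1") (simp_all add: fps_X_power_mult_nth fps_X_power_mult_right_nth algebra_simps)
qed

text \<open>Here the unit vector takes the place of the row of index -1.\<close>

lemma hook_row_rec_1:
  fixes H K :: "'a::comm_ring_1 fps"
  assumes "H * K = 1" "fps_nth H 0 = 1" "0 < b"
  shows "fps_nth (hook_row H K 1) b = fps_nth (hook_row H K 0) (b - 1)
     + fps_nth (hook_row H K 0) (b + 1) - (if b = 1 then 1 else 0)
     + fps_nth H 1 * fps_nth (hook_row H K 0) b"
proof -
  have "fps_X * hook_num H 1 = H - 1 - fps_const (fps_nth H 1) * (fps_X - fps_X ^ 3) + fps_X ^ 4" (is "?L = ?R")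
  proof (rule fps_ext)
    fix s :: nat
    consider "s = 0" | "s = 1" | "s = 2" | "s = 3" | "s = 4" | r where "s = r + 5"
    proof -
      assume *: "s = 0 \<Longrightarrow> thesis" "s = 1 \<Longrightarrow> thesis" "s = 2 \<Longrightarrow> thesis" "s = 3 \<Longrightarrow> thesis"
        "s = 4 \<Longrightarrow> thesis" "\<And>r. s = r + 5 \<Longrightarrow> thesis"
      have "s = 0 \<or> s = 1 \<or> s = 2 \<or> s = 3 \<or> s = 4 \<or> s = (s - 5) + 5" by linarith
      then show thesis using * by blast
    qed
    then show "fps_nth ?L s = fps_nth ?R s"
      by cases (simp_all add: fps_X_power_nth hook_num_nth numeral_eq_Suc assms)
  qed
  also have "\<dots> = (1 + fps_X ^ 2) * hook_num H 0 - fps_const (fps_nth H 1) * ((1 - fps_X ^ 2) * fps_X)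
      - fps_X ^ 2 * H"
    unfolding hook_num_0[OF assms(2)]
    by (simp add: algebra_simps power2_eq_square power3_eq_cube power4_eq_xxxx)
  finally have eq: "fps_X * hook_num H 1 = (1 + fps_X ^ 2) * hook_num H 0
      - fps_const (fps_nth H 1) * ((1 - fps_X ^ 2) * fps_X) - fps_X ^ 2 * H" .
  have "fps_X * hook_row H K 1 = (fps_X * hook_num H 1) * K"
    by (simp add: hook_row_def mult.assoc)
  also have "\<dots> = hook_row H K 0 + fps_X ^ 2 * hook_row H K 0
      - fps_const (fps_nth H 1) * (fps_X * ((1 - fps_X ^ 2) * K)) - fps_X ^ 2 * (H * K)"
    unfolding eq hook_row_def by (simp add: algebra_simps)
  also have "(1 - fps_X ^ 2) * K = 1 - hook_row H K 0"
    using hook_row_0[OF assms(1,2)] by simp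
  finally have "fps_nth (fps_X * hook_row H K 1) (Suc b) = fps_nth (hook_row H K 0 + fps_X ^ 2 * hook_row H K 0
      - fps_const (fps_nth H 1) * (fps_X * (1 - hook_row H K 0)) - fps_X ^ 2 * (H * K)) (Suc b)"
    by simp
  then show ?thesis
    using \<open>0 < b\<close> assms(1) by (cases "b = 1") (auto simp: fps_X_power_mult_nth fps_X_power_mult_right_nth fps_X_power_nth algebra_simps)
qed

section \<open>The rows in closed form\<close>

text \<open>The series (1 - v)^a for an arbitrary complex exponent.\<close>

definition binomial_fps :: "complex \<Rightarrow> complex fps" where
  "binomial_fps a = Abs_fps (\<lambda>i. (-1) ^ i * (a gchoose i))"

lemma binomial_fps_nth_0 [simp]: "fps_nth (binomial_fps a) 0 = 1"
  by (simp add: binomial_fps_def)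

lemma binomial_fps_add: "binomial_fps a * binomial_fps b = binomial_fps (a + b)"
proof (rule fps_ext)
  fix n
  have "fps_nth (binomial_fps a * binomial_fps b) n =
      (\<Sum>i=0..n. (-1) ^ n * ((a gchoose i) * (b gchoose (n - i))))"
    unfolding fps_mult_nth binomial_fps_def
    by (rule sum.cong) (auto simp: algebra_simps simp flip: power_add)
  also have "\<dots> = (-1) ^ n * ((a + b) gchoose n)"
    by (simp add: sum_distrib_left[symmetric] gbinomial_Vandermonde[symmetric] atLeast0AtMost)
  finally show "fps_nth (binomial_fps a * binomial_fps b) n = fps_nth (binomial_fps (a + b)) n"
    by (simp add: binomial_fps_def)
qed

lemma binomial_fps_0: "binomial_fps 0 = 1"
  by (rule fps_ext) (auto simp: binomial_fps_def gbinomial_0_left)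

lemma binomial_fps_1: "binomial_fps 1 = 1 - fps_X"
proof (rule fps_ext)
  fix n
  show "fps_nth (binomial_fps 1) n = fps_nth (1 - fps_X) n"
    using binomial_gbinomial[of 1 n, where ?'a = complex]
    by (cases "n \<le> 1") (auto simp: binomial_fps_def le_Suc_eq binomial_eq_0)
qed

lemma binomial_fps_Suc: "fps_nth (binomial_fps a) (Suc n) = fps_nth (binomial_fps a) n * (of_nat n - a) / (of_nat n + 1)"
proof -
  have "of_nat (Suc n) * (a gchoose Suc n) = (a - of_nat n) * (a gchoose n)"
    using gbinomial_mult_1[of a n] by (simp add: algebra_simps)
  then have "fps_nth (binomial_fps a) (Suc n) * (of_nat n + 1) = - ((-1) ^ n * ((a - of_nat n) * (a gchoose n)))"
    by (simp add: binomial_fps_def mult_ac add.commute)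
  also have "\<dots> = fps_nth (binomial_fps a) n * (of_nat n - a)"
    by (simp add: binomial_fps_def algebra_simps)
  finally have "fps_nth (binomial_fps a) (Suc n) * (of_nat n + 1) = fps_nth (binomial_fps a) n * (of_nat n - a)" .
  moreover have "of_nat n + 1 \<noteq> (0::complex)"
    by (metis of_nat_Suc of_nat_neq_0 add.commute)
  ultimately show ?thesis by (simp add: nonzero_eq_divide_eq)
qed

text \<open>In the notation u_k v_b / (X_k - Y_b), u_k is the coefficient of (1 - v)^(-z) and v_b is
  b (2 b - z) times the coefficient of (1 - v)^(z-1). The factor b makes column 0 vanish, in
  agreement with \<open>hook_row\<close>.\<close>

definition hook_entry :: "complex \<Rightarrow> nat \<Rightarrow> nat \<Rightarrow> complex" where
  "hook_entry z k b = fps_nth (binomial_fps (- z)) k * (of_nat b * fps_nth (binomial_fps (z - 1)) b)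
     * (2 * of_nat b - z) / ((of_nat k + of_nat b) * (of_nat k - of_nat b + z))"

text \<open>This is the three-term recurrence for \<open>hook_entry\<close> after division by common
  factors: the five fractions belong to the entries (k+1, b), (k, b-1), (k, b+1), (k-1, b) and to
  h_{k+1} times the entry (0, b).\<close>

lemma hook_entry_identity:
  fixes k b z :: complex
  assumes "k + 1 \<noteq> 0" "b \<noteq> 0" "k + b + 1 \<noteq> 0" "k + b - 1 \<noteq> 0" "k - b + 1 + z \<noteq> 0"
    "k - b - 1 + z \<noteq> 0" "z - b \<noteq> 0" "k - 1 + z \<noteq> 0"
  shows "(k + z) / (k + 1) * (2 * b - z) / ((k + b + 1) * (k - b + 1 + z)) =
      - (b - 1) / (z - b) * (2 * b - 2 - z) / ((k + b - 1) * (k - b + 1 + z))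
      + (b + 1 - z) / b * (2 * b + 2 - z) / ((k + b + 1) * (k - b - 1 + z))
      - k / (k - 1 + z) * (2 * b - z) / ((k + b - 1) * (k - b - 1 + z))
      + (z - 1) * (z - 2) / ((k + 1) * (k - 1 + z)) * (2 * b - z) / (b * (z - b))"
    (is "?T1 = ?T2 + ?T3 - ?T4 + ?T5")
proof -
  \<comment> \<open>Every fraction is multiplied by the common denominator \<open>Q\<close> on its
    own, so that only a polynomial identity remains to be checked.\<close>
  have cancel: "r / s * t / (A * B) * (s * A * B * u) = r * t * u"
    "r / (s * s') * t / (A * B) * (s * s' * A * B * u) = r * t * u"
    if "s \<noteq> 0" "s' \<noteq> 0" "A \<noteq> 0" "B \<noteq> 0" for r s s' t A B u :: complex
    using that by simp_all
  have distr: "(p + q - r + s) * u = p * u + q * u - r * u + s * u" for p q r s u :: complex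
    by (simp add: algebra_simps)
  define A B C D E F P where defs: "A = k + b + 1" "B = k + b - 1" "C = k - b + 1 + z"
    "D = k - b - 1 + z" "E = z - b" "F = k - 1 + z" "P = k + 1"
  have nz: "A \<noteq> 0" "B \<noteq> 0" "C \<noteq> 0" "D \<noteq> 0" "E \<noteq> 0" "F \<noteq> 0" "P \<noteq> 0" "b \<noteq> 0"
    using assms by (simp_all add: defs)
  define Q where "Q = P * b * A * B * C * D * E * F"
  have "?T1 * Q = (k + z) / P * (2 * b - z) / (A * C) * (P * A * C * (b * B * D * E * F))"
    by (simp add: defs Q_def mult_ac)
  also have "\<dots> = (k + z) * (2 * b - z) * (b * B * D * E * F)"
    using nz by (subst cancel) auto
  finally have 1: "?T1 * Q = (k + z) * (2 * b - z) * (b * B * D * E * F)" .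
  have "?T2 * Q = - (b - 1) / E * (2 * b - 2 - z) / (B * C) * (E * B * C * (P * b * A * D * F))"
    by (simp add: defs Q_def mult_ac)
  also have "\<dots> = - (b - 1) * (2 * b - 2 - z) * (P * b * A * D * F)"
    using nz by (subst cancel) auto
  finally have 2: "?T2 * Q = - (b - 1) * (2 * b - 2 - z) * (P * b * A * D * F)" .
  have "?T3 * Q = (b + 1 - z) / b * (2 * b + 2 - z) / (A * D) * (b * A * D * (P * B * C * E * F))"
    by (simp add: defs Q_def mult_ac)
  also have "\<dots> = (b + 1 - z) * (2 * b + 2 - z) * (P * B * C * E * F)"
    using nz by (subst cancel) auto
  finally have 3: "?T3 * Q = (b + 1 - z) * (2 * b + 2 - z) * (P * B * C * E * F)" .
  have "?T4 * Q = k / F * (2 * b - z) / (B * D) * (F * B * D * (P * b * A * C * E))"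
    by (simp add: defs Q_def mult_ac)
  also have "\<dots> = k * (2 * b - z) * (P * b * A * C * E)"
    using nz by (subst cancel) auto
  finally have 4: "?T4 * Q = k * (2 * b - z) * (P * b * A * C * E)" .
  have "?T5 * Q = (z - 1) * (z - 2) / (P * F) * (2 * b - z) / (b * E) * (P * F * b * E * (A * B * C * D))"
    by (simp add: defs Q_def mult_ac)
  also have "\<dots> = (z - 1) * (z - 2) * (2 * b - z) * (A * B * C * D)"
    using nz by (subst cancel) auto
  finally have 5: "?T5 * Q = (z - 1) * (z - 2) * (2 * b - z) * (A * B * C * D)" .
  have "?T1 * Q = (?T2 + ?T3 - ?T4 + ?T5) * Q"
    unfolding distr 1 2 3 4 5 unfolding defs by Groebner_Basis.algebra
  moreover have "Q \<noteq> 0" using nz by (simp add: Q_def)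
  ultimately show ?thesis by (metis mult_right_cancel)
qed

lemma nonint_nonzero:
  assumes "(z::complex) \<notin> \<int>"
  shows "of_nat k + z \<noteq> 0" "z + of_nat k \<noteq> 0" "z - of_nat k \<noteq> 0" "of_nat k - z \<noteq> 0" "of_nat k - of_nat b + z \<noteq> 0"
    "of_int i + z \<noteq> 0"
proof -
  show *: "of_int i + z \<noteq> 0" for i
  proof
    assume "of_int i + z = 0"
    then have "z = of_int (- i)" by (simp add: add_eq_0_iff)
    then show False using assms by (metis Ints_of_int)
  qed
  show "of_nat k + z \<noteq> 0" "z + of_nat k \<noteq> 0" using *[of "int k"] by (simp_all add: add.commute)
  show "z - of_nat k \<noteq> 0" "of_nat k - z \<noteq> 0" using *[of "- int k"] by auto
  show "of_nat k - of_nat b + z \<noteq> 0" using *[of "int k - int b"] by simp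
qed

text \<open>Both sides satisfy the same three-term recurrence in k and agree in row 0, the unit
  vector at column 1 taking the place of row -1. The exponent 2 - z is - d for z = d + 2.\<close>

lemma hook_row_eq_hook_entry:
  assumes z: "z \<notin> \<int>" and b: "0 < b"
  shows "fps_nth (hook_row (binomial_fps (2 - z)) (binomial_fps (z - 2)) k) b = hook_entry z k b"
proof -
  let ?M = "\<lambda>k b. fps_nth (hook_row (binomial_fps (2 - z)) (binomial_fps (z - 2)) k) b"
  let ?g = "fps_nth (binomial_fps (- z))" and ?q = "\<lambda>b. of_nat b * fps_nth (binomial_fps (z - 1)) b"
  let ?h = "fps_nth (binomial_fps (2 - z))"
  note nz = nonint_nonzero[OF z]
  have inv: "binomial_fps (2 - z) * binomial_fps (z - 2) = 1"
    by (simp add: binomial_fps_add binomial_fps_0)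
  have gS: "?g (Suc k) = ?g k * (of_nat k + z) / (of_nat k + 1)" for k
    by (simp add: binomial_fps_Suc)
  have qS: "?q (Suc b) = ?q b * (of_nat b + 1 - z) / of_nat b" if "0 < b" for b
  proof -
    have "of_nat b + 1 \<noteq> (0::complex)" by (metis of_nat_Suc of_nat_neq_0 add.commute)
    then have "?q (Suc b) = fps_nth (binomial_fps (z - 1)) b * (of_nat b - (z - 1))"
      by (simp add: binomial_fps_Suc add.commute)
    then show ?thesis using that by simp
  qed
  \<comment> \<open>Both coefficients are rising factorials divided by k!, one starting at z - 2 and
    the other at z; they differ only by two factors at each end.\<close>
  have h: "?h k * ((z + of_nat k - 1) * (z + of_nat k - 2)) = ?g k * ((z - 1) * (z - 2))" for k
  proof (induction k)
    case (Suc k)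
    have "?h (Suc k) * ((z + of_nat (Suc k) - 1) * (z + of_nat (Suc k) - 2)) =
       (?h k * ((z + of_nat k - 1) * (z + of_nat k - 2))) * (of_nat k + z) / (of_nat k + 1)"
      by (simp add: binomial_fps_Suc algebra_simps)
    also have "\<dots> = ?g (Suc k) * ((z - 1) * (z - 2))"
      unfolding Suc.IH gS by simp
    finally show ?case .
  qed simp
  have M0: "?M 0 b = hook_entry z 0 b" if b: "0 < b" for b
  proof -
    obtain c where c: "b = Suc c" using b gr0_implies_Suc by blast
    have "(1 - fps_X ^ 2) * binomial_fps (z - 2) = (1 + fps_X) * (binomial_fps 1 * binomial_fps (z - 2))"
      unfolding binomial_fps_1 by (simp add: algebra_simps power2_eq_square)
    also have "\<dots> = (1 + fps_X) * binomial_fps (z - 1)"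
      by (simp add: binomial_fps_add)
    finally have "?M 0 b = - (fps_nth (binomial_fps (z - 1)) b + fps_nth (binomial_fps (z - 1)) c)"
      unfolding hook_row_0[OF inv binomial_fps_nth_0] c by (simp add: distrib_right)
    moreover have "fps_nth (binomial_fps (z - 1)) b * of_nat b =
        fps_nth (binomial_fps (z - 1)) c * (of_nat b - z)"
    proof -
      have "1 + of_nat c \<noteq> (0::complex)" by (metis of_nat_Suc of_nat_neq_0)
      then show ?thesis unfolding c binomial_fps_Suc by (simp add: add.commute)
    qed
    ultimately show ?thesis
      using b nz(3,4)[of b] by (simp add: hook_entry_def divide_simps) (simp add: algebra_simps)
  qed
  have rec: "hook_entry z (Suc k) b = hook_entry z k (b - 1) + hook_entry z k (b + 1)
      - (if k = 0 then if b = 1 then 1 else 0 else hook_entry z (k - 1) b) + ?h (Suc k) * hook_entry z 0 b"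
    if b: "0 < b" for k b
  \<comment> \<open>At k = 0, b = 1 the denominator k + b - 1 vanishes, so the general identity does
    not apply; it is also the only place where the unit vector contributes.\<close>
  proof (cases "k = 0 \<and> b = 1")
    case True
    have "?h 1 = z - 2" "?g 1 = z" "?q 1 = 1 - z" "?q 2 = (1 - z) * (2 - z)"
      using binomial_fps_Suc[of "2 - z" 0] binomial_fps_Suc[of "- z" 0] binomial_fps_Suc[of "z - 1" 0]
        qS[of 1] by (simp_all add: numeral_2_eq_2)
    then have "?h 1 = z - 2" "hook_entry z 1 1 = z * (1 - z) * (2 - z) / (2 * z)"
      "hook_entry z 0 2 = (1 - z) * (2 - z) * (4 - z) / (2 * (z - 2))"
      "hook_entry z 0 1 = (1 - z) * (2 - z) / (z - 1)" "hook_entry z 0 0 = 0"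
      unfolding hook_entry_def by simp_all
    moreover have "z \<noteq> 0" "z - 1 \<noteq> 0" "z - 2 \<noteq> 0"
      using nz(3)[of 0] nz(3)[of 1] nz(3)[of 2] by auto
    moreover have "(1 - z) * (2 - z) * (4 - z) / (2 * (z - 2)) = - ((1 - z) * (4 - z) / 2)"
      "(1 - z) * (2 - z) / (z - 1) = z - 2" if "z - 1 \<noteq> 0" "z - 2 \<noteq> 0"
    proof -
      have "(1 - z) * (2 - z) * (4 - z) = - ((1 - z) * (4 - z) / 2) * (2 * (z - 2))"
        "(1 - z) * (2 - z) = (z - 2) * (z - 1)"
        by Groebner_Basis.algebra+
      then show "(1 - z) * (2 - z) * (4 - z) / (2 * (z - 2)) = - ((1 - z) * (4 - z) / 2)"
        "(1 - z) * (2 - z) / (z - 1) = z - 2" using that by (metis nonzero_mult_div_cancel_right mult_eq_0_iff zero_neq_numeral)+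
    qed
    ultimately have "?h 1 = z - 2" "hook_entry z 1 1 = (1 - z) * (2 - z) / 2"
      "hook_entry z 0 2 = - ((1 - z) * (4 - z) / 2)" "hook_entry z 0 1 = z - 2" "hook_entry z 0 0 = 0"
      by simp_all
    moreover have "(1 - z) * (2 - z) = - ((1 - z) * (4 - z)) - 2 + 2 * ((z - 2) * (z - 2))"
      by (simp add: algebra_simps)
    then have "(1 - z) * (2 - z) / 2 = - ((1 - z) * (4 - z) / 2) - 1 + (z - 2) * (z - 2)"
      by (simp only: add_divide_distrib diff_divide_distrib) simp
    ultimately show ?thesis
      using True by (simp add: numeral_2_eq_2[symmetric] del: mult_minus_left mult_minus_right)
  next
    case False
    have gk: "?g (k - 1) = ?g k * (of_nat k / (of_nat k - 1 + z))" if "k \<noteq> 0"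
      using gS[of "k - 1"] that nz(1)[of "k - 1"] by (simp add: of_nat_diff)
    have qb: "?q (b - 1) = ?q b * (- (of_nat b - 1) / (z - of_nat b))"
    proof (cases "b = 1")
      case False
      then have "0 < b - 1" using b by simp
      then show ?thesis using qS[of "b - 1"] b nz(3,4)[of b]
        by (simp add: of_nat_diff divide_simps) (auto simp: algebra_simps)
    qed simp
    have h': "?h (Suc k) = ?g k * ((z - 1) * (z - 2) / ((of_nat k + 1) * (of_nat k - 1 + z)))"
    proof -
      have "?h (Suc k) * ((z + of_nat (Suc k) - 1) * (z + of_nat (Suc k) - 2)) = ?g k * (of_nat k + z) / (of_nat k + 1) * ((z - 1) * (z - 2))"
        using h[of "Suc k"] unfolding gS .
      moreover have "z + of_nat (Suc k) - 1 = of_nat k + z" "z + of_nat (Suc k) - 2 = of_nat k - 1 + z"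
        by simp_all
      ultimately have "?h (Suc k) * ((of_nat k + z) * (of_nat k - 1 + z)) =
           ?g k * (of_nat k + z) / (of_nat k + 1) * ((z - 1) * (z - 2))"
        by (simp only:)
      then have "?h (Suc k) * (of_nat k - 1 + z) * (of_nat k + z) =
          ?g k / (of_nat k + 1) * ((z - 1) * (z - 2)) * (of_nat k + z)"
        by (simp add: mult_ac)
      then have "?h (Suc k) * (of_nat k - 1 + z) = ?g k / (of_nat k + 1) * ((z - 1) * (z - 2))"
        using nz(1)[of k] by (metis mult_right_cancel)
      moreover have "of_nat k - 1 + z \<noteq> 0" using nz(5)[of k 1] by simp
      ultimately have "?h (Suc k) = ?g k / (of_nat k + 1) * ((z - 1) * (z - 2)) / (of_nat k - 1 + z)"
        by (metis nonzero_eq_divide_eq)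
      then show ?thesis by simp
    qed
    have e0: "hook_entry z (Suc k) b = ?g k * ?q b * ((of_nat k + z) / (of_nat k + 1) * (2 * of_nat b - z)
         / ((of_nat k + of_nat b + 1) * (of_nat k - of_nat b + 1 + z)))"
    proof -
      have "of_nat (Suc k) + of_nat b = (of_nat k + of_nat b + 1 :: complex)"
        "of_nat (Suc k) - of_nat b + z = of_nat k - of_nat b + 1 + z"
        by simp_all
      then have "hook_entry z (Suc k) b = ?g k * (of_nat k + z) / (of_nat k + 1) * ?q b * (2 * of_nat b - z)
         / ((of_nat k + of_nat b + 1) * (of_nat k - of_nat b + 1 + z))"
        unfolding hook_entry_def gS by (simp only:)
      then show ?thesis by simp
    qed
    have e1: "hook_entry z k (b - 1) = ?g k * ?q b * (- (of_nat b - 1) / (z - of_nat b) * (2 * of_nat b - 2 - z)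
         / ((of_nat k + of_nat b - 1) * (of_nat k - of_nat b + 1 + z)))"
    proof -
      have "of_nat k + of_nat (b - 1) = (of_nat k + of_nat b - 1 :: complex)"
        "of_nat k - of_nat (b - 1) + z = of_nat k - of_nat b + 1 + z"
        "2 * of_nat (b - 1) - z = 2 * of_nat b - 2 - z"
        using b by (simp_all add: of_nat_diff algebra_simps)
      then have "hook_entry z k (b - 1) = ?g k * (?q b * (- (of_nat b - 1) / (z - of_nat b))) * (2 * of_nat b - 2 - z)
         / ((of_nat k + of_nat b - 1) * (of_nat k - of_nat b + 1 + z))"
        unfolding hook_entry_def qb by (simp only:)
      then show ?thesis by simp
    qed
    have e2: "hook_entry z k (b + 1) = ?g k * ?q b * ((of_nat b + 1 - z) / of_nat b * (2 * of_nat b + 2 - z)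
         / ((of_nat k + of_nat b + 1) * (of_nat k - of_nat b - 1 + z)))"
    proof -
      have "of_nat k + of_nat (Suc b) = (of_nat k + of_nat b + 1 :: complex)"
        "of_nat k - of_nat (Suc b) + z = of_nat k - of_nat b - 1 + z"
        "2 * of_nat (Suc b) - z = 2 * of_nat b + 2 - z"
        by simp_all
      then have "hook_entry z k (Suc b) = ?g k * (?q b * (of_nat b + 1 - z) / of_nat b) * (2 * of_nat b + 2 - z)
         / ((of_nat k + of_nat b + 1) * (of_nat k - of_nat b - 1 + z))"
        unfolding hook_entry_def qS[OF b] by (simp only:)
      then show ?thesis by simp
    qed
    have e3: "(if k = 0 then if b = 1 then 1 else 0 else hook_entry z (k - 1) b) =
         ?g k * ?q b * (of_nat k / (of_nat k - 1 + z) * (2 * of_nat b - z)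
         / ((of_nat k + of_nat b - 1) * (of_nat k - of_nat b - 1 + z)))"
    proof (cases "k = 0")
      case False
      then have "of_nat (k - 1) + of_nat b = (of_nat k + of_nat b - 1 :: complex)"
        "of_nat (k - 1) - of_nat b + z = of_nat k - of_nat b - 1 + z"
        by (simp_all add: of_nat_diff)
      then have "hook_entry z (k - 1) b = ?g k * (of_nat k / (of_nat k - 1 + z)) * ?q b * (2 * of_nat b - z)
         / ((of_nat k + of_nat b - 1) * (of_nat k - of_nat b - 1 + z))"
        unfolding hook_entry_def gk[OF False] by (simp only:)
      then show ?thesis using False by simp
    qed (use False in simp)
    have e4: "hook_entry z 0 b = ?q b * ((2 * of_nat b - z) / (of_nat b * (z - of_nat b)))"
      unfolding hook_entry_def by simp
    have "of_nat k + of_nat b - 1 = (of_nat (k + b - 1) :: complex)" using b by (simp add: of_nat_diff)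
    moreover have "k + b - 1 \<noteq> 0" using False b by auto
    ultimately have "of_nat k + of_nat b - 1 \<noteq> (0::complex)" by (metis of_nat_eq_0_iff)
    moreover have "of_nat k + 1 \<noteq> (0::complex)" "of_nat k + of_nat b + 1 \<noteq> (0::complex)"
      using of_nat_neq_0[of k, where ?'a = complex] of_nat_neq_0[of "k + b", where ?'a = complex]
      by (simp_all add: add_ac)
    moreover have "of_nat k - of_nat b + 1 + z \<noteq> 0" "of_nat k - of_nat b - 1 + z \<noteq> 0" "of_nat k - 1 + z \<noteq> 0"
    proof -
      have "of_nat k - of_nat b + 1 + z = of_nat (Suc k) - of_nat b + z"
        "of_nat k - of_nat b - 1 + z = of_nat k - of_nat (Suc b) + z" "of_nat k - 1 + z = of_nat k - of_nat 1 + z"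
        by simp_all
      then show "of_nat k - of_nat b + 1 + z \<noteq> 0" "of_nat k - of_nat b - 1 + z \<noteq> 0" "of_nat k - 1 + z \<noteq> 0"
        using nz(5) by metis+
    qed
    ultimately have id: "(of_nat k + z) / (of_nat k + 1) * (2 * of_nat b - z)
          / ((of_nat k + of_nat b + 1) * (of_nat k - of_nat b + 1 + z)) =
      - (of_nat b - 1) / (z - of_nat b) * (2 * of_nat b - 2 - z) / ((of_nat k + of_nat b - 1) * (of_nat k - of_nat b + 1 + z))
      + (of_nat b + 1 - z) / of_nat b * (2 * of_nat b + 2 - z) / ((of_nat k + of_nat b + 1) * (of_nat k - of_nat b - 1 + z))
      - of_nat k / (of_nat k - 1 + z) * (2 * of_nat b - z) / ((of_nat k + of_nat b - 1) * (of_nat k - of_nat b - 1 + z))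
      + (z - 1) * (z - 2) / ((of_nat k + 1) * (of_nat k - 1 + z)) * (2 * of_nat b - z) / (of_nat b * (z - of_nat b))"
      using b nz(3)[of b] by (intro hook_entry_identity) simp_all
    have distr: "g * q * (p + r - s + u * v / w) = g * q * p + g * q * r - g * q * s + g * u * (q * (v / w))"
      for g q p r s u v w :: complex
      by (simp add: algebra_simps)
    show ?thesis
      unfolding e0 e1 e2 e3 e4 h' id by (rule distr)
  qed
  show ?thesis using b
  proof (induction k arbitrary: b rule: less_induct)
    case (less k)
    have ent0: "hook_entry z k 0 = 0" for k by (simp add: hook_entry_def)
    have M_eq: "?M j (b - 1) = hook_entry z j (b - 1)" if "j < k" for j
      using less.IH[OF that, of "b - 1"] less.prems by (cases "b = 1") (auto simp: ent0)
    consider "k = 0" | "k = 1" | j where "k = j + 2"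
    proof -
      assume *: "k = 0 \<Longrightarrow> thesis" "k = 1 \<Longrightarrow> thesis" "\<And>j. k = j + 2 \<Longrightarrow> thesis"
      have "k = 0 \<or> k = 1 \<or> k = (k - 2) + 2" by linarith
      then show thesis using * by blast
    qed
    then show ?case
    proof cases
      case 2
      then show ?thesis using rec[OF less.prems, of 0] hook_row_rec_1[OF inv binomial_fps_nth_0 less.prems]
          less.IH[of 0] M_eq[of 0] less.prems by simp
    next
      case (3 j)
      then show ?thesis using rec[OF less.prems, of "Suc j"]
          hook_row_rec[OF inv binomial_fps_nth_0 less.prems, of j]
          less.IH[of 0] less.IH[of j] less.IH[of "Suc j"] M_eq[of "Suc j"] less.prems by simp
    qed (use M0 less.prems in auto)
  qed
qed

section \<open>The functional equation of the determinant\<close>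

lemma prod_diff_dvd:
  fixes f g :: "'b \<Rightarrow> 'a::comm_ring_1"
  assumes "\<And>i. i \<in> I \<Longrightarrow> q dvd f i - g i"
  shows "q dvd prod f I - prod g I"
  using assms
proof (induction I rule: infinite_finite_induct)
  case (insert i I)
  have "prod f (insert i I) - prod g (insert i I) = (f i - g i) * prod f I + g i * (prod f I - prod g I)"
    using insert.hyps by (simp add: algebra_simps)
  moreover have "q dvd f i - g i" "q dvd prod f I - prod g I"
    using insert by auto
  ultimately show ?case by (metis dvd_add dvd_mult dvd_mult2)
qed auto

lemma permutes_lessThan_less: "p permutes {0..<n} \<Longrightarrow> i < n \<Longrightarrow> p i < (n::nat)"
  using permutes_in_image[of p "{0..<n}" i] by auto

lemma det_diff_dvd:
  fixes A B :: "'a::comm_ring_1 mat"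
  assumes A: "A \<in> carrier_mat n n" and B: "B \<in> carrier_mat n n"
    and dvd: "\<And>i j. i < n \<Longrightarrow> j < n \<Longrightarrow> q dvd A $$ (i, j) - B $$ (i, j)"
  shows "q dvd Determinant.det A - Determinant.det B"
proof -
  have "Determinant.det A - Determinant.det B = (\<Sum>p\<in>{p. p permutes {0..<n}}.
      signof p * ((\<Prod>i = 0..<n. A $$ (i, p i)) - (\<Prod>i = 0..<n. B $$ (i, p i))))"
    unfolding det_def'[OF A] det_def'[OF B] by (simp add: sum_subtractf right_diff_distrib)
  also have "q dvd \<dots>"
  proof (rule dvd_sum)
    fix p assume "p \<in> {p. p permutes {0..<n}}"
    then have "p i < n" if "i < n" for i
      using that permutes_in_image[of p "{0..<n}" i] by auto
    then show "q dvd signof p * ((\<Prod>i = 0..<n. A $$ (i, p i)) - (\<Prod>i = 0..<n. B $$ (i, p i)))"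
      by (intro dvd_mult prod_diff_dvd dvd) auto
  qed
  finally show ?thesis .
qed

lemma det_scale:
  fixes f :: "nat \<Rightarrow> nat \<Rightarrow> 'a::comm_ring_1"
  shows "Determinant.det (Matrix.mat n n (\<lambda>(i, j). r i * f i j * c j)) =
    (\<Prod>i = 0..<n. r i) * (\<Prod>i = 0..<n. c i) * Determinant.det (Matrix.mat n n (\<lambda>(i, j). f i j))"
proof -
  have "Determinant.det (Matrix.mat n n (\<lambda>(i, j). r i * f i j * c j)) =
      (\<Sum>p\<in>{p. p permutes {0..<n}}. signof p * (\<Prod>i = 0..<n. r i * f i (p i) * c (p i)))"
    unfolding det_def'[OF mat_carrier]
    by (intro sum.cong refl arg_cong2[where f = times] prod.cong) (auto simp: permutes_lessThan_less)
  also have "\<dots> = (\<Sum>p\<in>{p. p permutes {0..<n}}. (\<Prod>i = 0..<n. r i) * (\<Prod>i = 0..<n. c i) *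
      (signof p * (\<Prod>i = 0..<n. f i (p i))))"
  proof (rule sum.cong, goal_cases)
    case (2 p)
    then have "(\<Prod>i = 0..<n. c (p i)) = (\<Prod>i = 0..<n. c i)"
      using prod.permute[of p "{0..<n}" c] by (simp add: o_def)
    then show ?case by (simp add: prod.distrib mult_ac)
  qed simp
  also have "\<dots> = (\<Prod>i = 0..<n. r i) * (\<Prod>i = 0..<n. c i) *
      Determinant.det (Matrix.mat n n (\<lambda>(i, j). f i j))"
    unfolding sum_distrib_left[symmetric] det_def'[OF mat_carrier]
    by (intro arg_cong2[where f = times] refl sum.cong prod.cong) (auto simp: permutes_lessThan_less)
  finally show ?thesis .
qed

text \<open>Conjugating by the diagonal matrix of the powers of x weakens the congruence required of
  the entries far from the first row.\<close>

lemma det_diff_dvd_graded: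
  fixes P Q :: "'a::idom mat"
  assumes P: "P \<in> carrier_mat n n" and Q: "Q \<in> carrier_mat n n" and "x \<noteq> 0"
    and gr: "\<And>i j. i < n \<Longrightarrow> j < n \<Longrightarrow> x ^ i dvd x ^ j * P $$ (i, j)"
    and diff: "\<And>i j. i < n \<Longrightarrow> j < n \<Longrightarrow> x ^ (i + N) dvd x ^ j * (Q $$ (i, j) - P $$ (i, j))"
  shows "x ^ N dvd Determinant.det Q - Determinant.det P"
proof -
  obtain p where p: "\<And>i j. i < n \<Longrightarrow> j < n \<Longrightarrow> x ^ j * P $$ (i, j) = x ^ i * p i j"
    using gr unfolding dvd_def by metis
  obtain r where r: "\<And>i j. i < n \<Longrightarrow> j < n \<Longrightarrow> x ^ j * (Q $$ (i, j) - P $$ (i, j)) = x ^ (i + N) * r i j"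
    using diff unfolding dvd_def by metis
  define q where "q = (\<lambda>i j. p i j + x ^ N * r i j)"
  have q: "x ^ j * Q $$ (i, j) = x ^ i * q i j" if "i < n" "j < n" for i j
    using p[OF that] r[OF that] by (simp add: q_def algebra_simps power_add)
  have *: "Determinant.det R = Determinant.det (Matrix.mat n n (\<lambda>(i, j). f i j))"
    if R: "R \<in> carrier_mat n n" and f: "\<And>i j. i < n \<Longrightarrow> j < n \<Longrightarrow> x ^ j * R $$ (i, j) = x ^ i * f i j" for R f
  proof -
    let ?X = "\<Prod>i = 0..<n. x ^ i"
    have "Matrix.mat n n (\<lambda>(i, j). 1 * R $$ (i, j) * x ^ j) = Matrix.mat n n (\<lambda>(i, j). x ^ i * f i j * 1)"
      using f by (intro eq_matI) (auto simp: mult_ac)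
    then have "?X * Determinant.det (Matrix.mat n n (\<lambda>(i, j). R $$ (i, j))) =
        ?X * Determinant.det (Matrix.mat n n (\<lambda>(i, j). f i j))"
      using det_scale[of n "\<lambda>_. 1" "\<lambda>i j. R $$ (i, j)" "\<lambda>j. x ^ j"]
        det_scale[of n "\<lambda>i. x ^ i" f "\<lambda>_. 1"] by simp
    moreover have "Matrix.mat n n (\<lambda>(i, j). R $$ (i, j)) = R"
      using R by (intro eq_matI) auto
    moreover have "?X \<noteq> 0" using \<open>x \<noteq> 0\<close> by simp
    ultimately show ?thesis by simp
  qed
  have "x ^ N dvd Determinant.det (Matrix.mat n n (\<lambda>(i, j). q i j))
      - Determinant.det (Matrix.mat n n (\<lambda>(i, j). p i j))"
    by (rule det_diff_dvd[OF mat_carrier mat_carrier]) (simp add: q_def)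
  then show ?thesis using *[OF P p] *[OF Q q] by simp
qed

text \<open>Matrix indices start at 0 and parts at 1, hence the successors. Row 0 of
  \<open>M\<close> lies outside the matrix but enters through the boundary terms.\<close>

definition hook_mat :: "'a \<Rightarrow> (nat \<Rightarrow> nat \<Rightarrow> 'a::comm_ring_1) \<Rightarrow> nat \<Rightarrow> 'a mat" where
  "hook_mat x M n = Matrix.mat n n (\<lambda>(i, j). (if i = j then 1 else 0) - x ^ Suc i * M (Suc i) (Suc j))"

lemma hook_mat_carrier [simp]: "hook_mat x M n \<in> carrier_mat n n"
  by (simp add: hook_mat_def)

lemma prod_list_eq_1: "(\<And>x. x \<in> set xs \<Longrightarrow> x = 1) \<Longrightarrow> prod_list xs = (1::'a::comm_monoid_mult)"
  by (induction xs) auto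

text \<open>Let A and B be the matrices of \<open>My\<close> and \<open>Mc\<close>. With T = U L
  tridiagonal and Z equal to L minus a rank-one matrix in the first row, \<open>shift\<close> says
  that A U Z = T B up to truncation. U and L are unitriangular, so only det Z remains. The same T
  appears on both sides because of y = x c: from x^(i+1) y = c x^(i+2) and x^(i+1) c = y x^i it
  follows that weighting the rows by powers of x exchanges c and y. Hence the identity part of A and
  B is intertwined as well.\<close>

lemma det_hook_mat_shift:
  fixes x c y :: "'a::idom"
  assumes x: "x \<noteq> 0" and y: "y = x * c" and My0: "\<And>k. My k 0 = 0"
    and shift: "\<And>k b. 0 < b \<Longrightarrow> (1 + c * y) * My (Suc k) b - c * My (Suc k) (b - 1)
      - y * My (Suc k) (b + 1) - y * My (Suc k) 1 * Mc 0 b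
      = (1 + c * y) * Mc (Suc k) b - y * Mc (k + 2) b - c * Mc k b"
  shows "x ^ Suc n dvd Determinant.det (hook_mat x My n) * (1 - (\<Sum>b = 1..n. Mc 0 b * y ^ b))
     - Determinant.det (hook_mat x Mc n)"
proof (cases n)
  case 0
  then show ?thesis by (simp add: hook_mat_def)
next
  case n: (Suc m)
  let ?\<delta> = "\<lambda>i j::nat. if i = j then 1 else (0::'a)"
  let ?A = "hook_mat x My n" and ?B = "hook_mat x Mc n"
  define a where "a = (\<lambda>i j. ?\<delta> i j - x ^ Suc i * My (Suc i) (Suc j))"
  define b where "b = (\<lambda>i j. ?\<delta> i j - x ^ Suc i * Mc (Suc i) (Suc j))"
  define U where "U = Matrix.mat n n (\<lambda>(i, j). ?\<delta> i j - c * ?\<delta> (Suc i) j)"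
  define L where "L = Matrix.mat n n (\<lambda>(i, j). ?\<delta> i j - y * ?\<delta> i (Suc j))"
  define Z where "Z = Matrix.mat n n (\<lambda>(i, j). ?\<delta> i j - y * ?\<delta> i (Suc j) - y * ?\<delta> i 0 * Mc 0 (Suc j))"
  \<comment> \<open>This is the inverse of \<open>L\<close>. The product Z G differs from the
    identity only in the first row, from which det Z can be read off.\<close>
  define G where "G = Matrix.mat n n (\<lambda>(i, j). if j \<le> i then y ^ (i - j) else 0)"
  have carr: "U \<in> carrier_mat n n" "L \<in> carrier_mat n n" "Z \<in> carrier_mat n n" "G \<in> carrier_mat n n"
    by (simp_all add: U_def L_def Z_def G_def)
  have ent: "(P * Q) $$ (i, j) = (\<Sum>l = 0..<n. P $$ (i, l) * Q $$ (l, j))"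
    if "P \<in> carrier_mat n n" "Q \<in> carrier_mat n n" "i < n" "j < n" for P Q :: "'a mat" and i j
    using that by (auto simp: scalar_prod_def intro!: sum.cong)
  have det_U: "Determinant.det U = 1"
    unfolding U_def by (subst det_upper_triangular[of _ n]) (auto intro!: prod_list_eq_1 upper_triangularI simp: diag_mat_def)
  have det_L: "Determinant.det L = 1"
    unfolding L_def by (subst det_lower_triangular[of n]) (auto intro!: prod_list_eq_1 simp: diag_mat_def)
  have det_G: "Determinant.det G = 1"
    unfolding G_def by (subst det_lower_triangular[of n]) (auto intro!: prod_list_eq_1 simp: diag_mat_def)
  define \<kappa> where "\<kappa> = 1 - (\<Sum>b = 1..n. Mc 0 b * y ^ b)"
  have ZG: "Z * G = Matrix.mat n n (\<lambda>(i, j). ?\<delta> i j - ?\<delta> i 0 * (\<Sum>l = 0..<n. y * Mc 0 (Suc l) * G $$ (l, j)))"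
  proof (rule eq_matI)
    fix i j assume "i < dim_row (Matrix.mat n n (\<lambda>(i, j). ?\<delta> i j - ?\<delta> i 0 * (\<Sum>l = 0..<n. y * Mc 0 (Suc l) * G $$ (l, j))))"
      "j < dim_col (Matrix.mat n n (\<lambda>(i, j). ?\<delta> i j - ?\<delta> i 0 * (\<Sum>l = 0..<n. y * Mc 0 (Suc l) * G $$ (l, j))))"
    then have ij: "i < n" "j < n" by auto
    have "(Z * G) $$ (i, j) = (\<Sum>l = 0..<n. (?\<delta> i l - y * ?\<delta> i (Suc l) - y * ?\<delta> i 0 * Mc 0 (Suc l)) * G $$ (l, j))"
      unfolding ent[OF carr(3,4) ij] using ij by (intro sum.cong) (auto simp: Z_def)
    also have "\<dots> = (\<Sum>l = 0..<n. ?\<delta> i l * G $$ (l, j)) - y * (\<Sum>l = 0..<n. ?\<delta> i (Suc l) * G $$ (l, j))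
        - ?\<delta> i 0 * (\<Sum>l = 0..<n. y * Mc 0 (Suc l) * G $$ (l, j))"
      unfolding sum_distrib_left sum_subtractf[symmetric] by (intro sum.cong) (auto simp: algebra_simps)
    also have "(\<Sum>l = 0..<n. ?\<delta> i l * G $$ (l, j)) = G $$ (i, j)"
      using ij by (simp add: if_distribR if_distrib[of "\<lambda>u. u * _"] cong: if_cong)
    also have "(\<Sum>l = 0..<n. ?\<delta> i (Suc l) * G $$ (l, j)) = (if i = 0 then 0 else G $$ (i - 1, j))"
      using ij by (cases i) (simp_all add: if_distrib[of "\<lambda>u. u * _"] cong: if_cong)
    also have "G $$ (i, j) - y * (if i = 0 then 0 else G $$ (i - 1, j)) = ?\<delta> i j"
      using ij by (cases i) (auto simp: G_def Suc_diff_le)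
    finally show "(Z * G) $$ (i, j) = Matrix.mat n n (\<lambda>(i, j). ?\<delta> i j - ?\<delta> i 0 * (\<Sum>l = 0..<n. y * Mc 0 (Suc l) * G $$ (l, j))) $$ (i, j)"
      using ij by simp
  qed (simp_all add: Z_def G_def)
  have "Determinant.det (Z * G) = prod_list (diag_mat (Z * G))"
    unfolding ZG by (rule det_upper_triangular[of _ n]) (auto intro!: upper_triangularI)
  also have "\<dots> = (\<Prod>i = 0..<n. (Z * G) $$ (i, i))"
    unfolding prod_list_diag_prod by (simp add: Z_def)
  also have "\<dots> = (Z * G) $$ (0, 0) * (\<Prod>i = Suc 0..<n. (Z * G) $$ (i, i))"
    by (rule prod.atLeast_Suc_lessThan) (simp add: n)
  also have "(\<Prod>i = Suc 0..<n. (Z * G) $$ (i, i)) = 1"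
    unfolding ZG by (intro prod.neutral) auto
  also have "(Z * G) $$ (0, 0) = 1 - (\<Sum>l = 0..<n. y * Mc 0 (Suc l) * y ^ l)"
    unfolding ZG using n by (auto simp: G_def intro!: sum.cong)
  also have "(\<Sum>l = 0..<n. y * Mc 0 (Suc l) * y ^ l) = (\<Sum>b = 1..n. Mc 0 b * y ^ b)"
    by (rule sum.reindex_bij_witness[of _ "\<lambda>b. b - 1" Suc]) (auto simp: mult_ac)
  finally have det_Z: "Determinant.det Z = \<kappa>"
    using det_mult[OF carr(3,4)] det_G by (simp add: \<kappa>_def)
  \<comment> \<open>The last diagonal entry lacks c y, since in U L this summand comes from the row
    below.\<close>
  define T where "T = Matrix.mat n n (\<lambda>(i, j). (if Suc i < n then 1 + c * y else 1) * ?\<delta> i j - y * ?\<delta> i (Suc j) - c * ?\<delta> (Suc i) j)"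
  have UX: "(U * P) $$ (i, j) = P $$ (i, j) - (if Suc i < n then c * P $$ (Suc i, j) else 0)"
    if P: "P \<in> carrier_mat n n" and ij: "i < n" "j < n" for P i j
  proof -
    have "(U * P) $$ (i, j) = (\<Sum>l = 0..<n. ?\<delta> i l * P $$ (l, j)) - c * (\<Sum>l = 0..<n. ?\<delta> (Suc i) l * P $$ (l, j))"
      unfolding ent[OF carr(1) P ij] sum_distrib_left sum_subtractf[symmetric]
      using ij by (intro sum.cong) (auto simp: U_def algebra_simps)
    then show ?thesis
      using ij by (simp add: if_distrib[of "\<lambda>u. u * _"] cong: if_cong)
  qed
  have UL: "U * L = T"
  proof (rule eq_matI)
    fix i j assume "i < dim_row T" "j < dim_col T"
    then have ij: "i < n" "j < n" by (auto simp: T_def)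
    show "(U * L) $$ (i, j) = T $$ (i, j)"
      unfolding UX[OF carr(2) ij] using ij by (auto simp: T_def L_def algebra_simps)
  qed (auto simp: T_def U_def L_def)
  have UZ: "U * Z = Matrix.mat n n (\<lambda>(i, j). T $$ (i, j) - y * ?\<delta> i 0 * Mc 0 (Suc j))" (is "_ = ?R")
  proof (rule eq_matI)
    fix i j assume "i < dim_row ?R" "j < dim_col ?R"
    then have ij: "i < n" "j < n" by auto
    show "(U * Z) $$ (i, j) = ?R $$ (i, j)"
      unfolding UX[OF carr(3) ij] using ij by (auto simp: T_def Z_def algebra_simps)
  qed (auto simp: U_def Z_def)
  \<comment> \<open>The relation without truncation. The identity part of \<open>a i 0\<close>
    supplies the multiple of row 0 of \<open>Mc\<close> that is needed at i = 0 for want of a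
    preceding row; the other part of \<open>a i 0\<close> supplies the boundary term of
    \<open>shift\<close>.\<close>
  have full: "(1 + c * y) * a i j - y * a i (Suc j) - (if j = 0 then 0 else c * a i (j - 1)) - y * a i 0 * Mc 0 (Suc j)
      = (1 + c * y) * b i j - (if i = 0 then 0 else y * b (i - 1) j) - c * b (Suc i) j" for i j
  proof -
    have s: "(1 + c * y) * My (Suc i) (Suc j) - c * My (Suc i) j - y * My (Suc i) (Suc (Suc j))
        - y * My (Suc i) 1 * Mc 0 (Suc j)
      = (1 + c * y) * Mc (Suc i) (Suc j) - y * Mc (Suc (Suc i)) (Suc j) - c * Mc i (Suc j)"
      using shift[of "Suc j" i] by simp
    have "x ^ Suc i * ((1 + c * y) * My (Suc i) (Suc j) - c * My (Suc i) j
      - y * My (Suc i) (Suc (Suc j)) - y * My (Suc i) 1 * Mc 0 (Suc j)) =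
      (1 + c * y) * x ^ Suc i * Mc (Suc i) (Suc j) - c * x ^ Suc (Suc i) * Mc (Suc (Suc i)) (Suc j)
        - y * x ^ i * Mc i (Suc j)"
      unfolding s by (simp add: y algebra_simps)
    then show ?thesis
      using My0[of "Suc i"] unfolding a_def b_def
      by (cases i; cases j) (auto simp: algebra_simps)
  qed
  have TB: "(T * ?B) $$ (i, j) = (if Suc i < n then 1 + c * y else 1) * b i j
      - (if i = 0 then 0 else y * b (i - 1) j) - (if Suc i < n then c * b (Suc i) j else 0)"
    if ij: "i < n" "j < n" for i j
  proof -
    have "(T * ?B) $$ (i, j) = (if Suc i < n then 1 + c * y else 1) * (\<Sum>l = 0..<n. ?\<delta> i l * b l j)
       - y * (\<Sum>l = 0..<n. ?\<delta> i (Suc l) * b l j) - c * (\<Sum>l = 0..<n. ?\<delta> (Suc i) l * b l j)"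
      unfolding sum_distrib_left sum_subtractf[symmetric]
      by (subst ent, simp add: T_def, simp, rule ij, rule ij, rule sum.cong)
        (use ij in \<open>auto simp: T_def hook_mat_def b_def algebra_simps\<close>)
    also have "(\<Sum>l = 0..<n. ?\<delta> i (Suc l) * b l j) = (if i = 0 then 0 else b (i - 1) j)"
      using ij by (cases i) (simp_all add: if_distrib[of "\<lambda>u. u * _"] cong: if_cong)
    finally show ?thesis using ij by (simp add: if_distrib[of "\<lambda>u. u * _"] cong: if_cong)
  qed
  have AUZ: "(?A * (U * Z)) $$ (i, j) = (if Suc j < n then 1 + c * y else 1) * a i j
      - (if Suc j < n then y * a i (Suc j) else 0) - (if j = 0 then 0 else c * a i (j - 1)) - y * a i 0 * Mc 0 (Suc j)"
    if ij: "i < n" "j < n" for i j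
  proof -
    have "(?A * (U * Z)) $$ (i, j) = (if Suc j < n then 1 + c * y else 1) * (\<Sum>l = 0..<n. ?\<delta> j l * a i l)
       - y * (\<Sum>l = 0..<n. ?\<delta> (Suc j) l * a i l) - c * (\<Sum>l = 0..<n. ?\<delta> j (Suc l) * a i l)
       - y * Mc 0 (Suc j) * (\<Sum>l = 0..<n. ?\<delta> 0 l * a i l)"
      unfolding sum_distrib_left sum_subtractf[symmetric] UZ
      by (subst ent, simp, simp, rule ij, rule ij, rule sum.cong)
        (use ij in \<open>auto simp: T_def hook_mat_def a_def algebra_simps\<close>)
    also have "(\<Sum>l = 0..<n. ?\<delta> j (Suc l) * a i l) = (if j = 0 then 0 else a i (j - 1))"
      using ij by (cases j) (simp_all add: if_distrib[of "\<lambda>u. u * _"] cong: if_cong)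
    finally show ?thesis using ij by (simp add: if_distrib[of "\<lambda>u. u * _"] cong: if_cong)
  qed
  \<comment> \<open>The truncation errors. As y = x c, the error \<open>E2\<close> in the last row
    is divisible by x^(n+1), but the error \<open>E1\<close> in the last column is only seen to be
    divisible by x^(i+2).\<close>
  define E1 where "E1 = (\<lambda>i j. if j = m then x ^ Suc i * (c * y * My (Suc i) n - y * My (Suc i) (Suc n)) else 0)"
  define E2 where "E2 = (\<lambda>i j. if i = m then c * x ^ Suc n * Mc (Suc n) (Suc j) - c * y * x ^ n * Mc n (Suc j) else 0)"
  have E1: "E1 i j = (if j = m then y * a i n - c * y * (a i m - ?\<delta> i m) else 0)" if "i < n" for i j
    using that n by (simp add: E1_def a_def right_diff_distrib)
  have E2: "E2 i j = (if i = m then c * y * (b m j - ?\<delta> m j) - c * b n j else 0)" if "j < n" for i j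
    using that n by (simp add: E2_def b_def right_diff_distrib)
  have diff: "(?A * (U * Z)) $$ (i, j) = (T * ?B) $$ (i, j) + E1 i j + E2 i j" if ij: "i < n" "j < n" for i j
  proof -
    let ?l = "(1 + c * y) * a i j - y * a i (Suc j) - (if j = 0 then 0 else c * a i (j - 1)) - y * a i 0 * Mc 0 (Suc j)"
    let ?r = "(1 + c * y) * b i j - (if i = 0 then 0 else y * b (i - 1) j) - c * b (Suc i) j"
    have iff: "Suc i < n \<longleftrightarrow> i \<noteq> m" "Suc j < n \<longleftrightarrow> j \<noteq> m" using ij n by auto
    have "(?A * (U * Z)) $$ (i, j) = ?l + (if j = m then y * a i n - c * y * a i m else 0)"
      unfolding AUZ[OF ij] iff using n by (cases "j = m") (simp_all add: distrib_right)
    moreover have "(T * ?B) $$ (i, j) = ?r + (if i = m then c * b n j - c * y * b m j else 0)"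
      unfolding TB[OF ij] iff using n by (cases "i = m") (simp_all add: distrib_right)
    ultimately show ?thesis
      unfolding E1[OF ij(1)] E2[OF ij(2)] full
      by (cases "i = m"; cases "j = m") (simp_all add: right_diff_distrib)
  qed
  define Q where "Q = Matrix.mat n n (\<lambda>(i, j). (T * ?B) $$ (i, j) + E1 i j)"
  have carrT: "T \<in> carrier_mat n n" "T * ?B \<in> carrier_mat n n" "U * Z \<in> carrier_mat n n" "?A * (U * Z) \<in> carrier_mat n n"
  proof -
    show T: "T \<in> carrier_mat n n" by (simp add: T_def)
    show "T * ?B \<in> carrier_mat n n" by (rule mult_carrier_mat[OF T hook_mat_carrier])
    show UZ: "U * Z \<in> carrier_mat n n" by (rule mult_carrier_mat[OF carr(1,3)])
    show "?A * (U * Z) \<in> carrier_mat n n" by (rule mult_carrier_mat[OF hook_mat_carrier UZ])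
  qed
  have "x ^ Suc n dvd Determinant.det (?A * (U * Z)) - Determinant.det Q"
  proof (rule det_diff_dvd[OF carrT(4)])
    fix i j assume ij: "i < n" "j < n"
    have "x ^ Suc n dvd E2 i j"
      by (auto simp: E2_def y intro!: dvd_diff)
    then show "x ^ Suc n dvd (?A * (U * Z)) $$ (i, j) - Q $$ (i, j)"
      using diff[OF ij] ij by (simp add: Q_def)
  qed (simp add: Q_def)
  \<comment> \<open>Here the grading is used: the last column has the weight x^m with m = n - 1, and
    x^m x^(i+2) = x^(i+n+1).\<close>
  moreover have "x ^ Suc n dvd Determinant.det Q - Determinant.det (T * ?B)"
  proof (rule det_diff_dvd_graded[OF carrT(2) _ x])
    fix i j assume ij: "i < n" "j < n"
    \<comment> \<open>Below the diagonal \<open>T\<close> has only the entries - y, and y brings the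
      missing factor x.\<close>
    have T: "x ^ i dvd x ^ l * T $$ (i, l)" if "l < n" for l
      using ij that by (auto simp: T_def y intro!: dvd_mult2 le_imp_power_dvd)
    have B: "x ^ l dvd x ^ j * ?B $$ (l, j)" if "l < n" for l
      using ij that by (auto simp: hook_mat_def right_diff_distrib intro!: dvd_diff dvd_mult dvd_mult2)
    show "x ^ i dvd x ^ j * (T * ?B) $$ (i, j)"
      unfolding ent[OF carrT(1) hook_mat_carrier ij] sum_distrib_left
    proof (rule dvd_sum)
      fix l assume "l \<in> {0..<n}"
      then have l: "l < n" by simp
      obtain s where s: "x ^ j * ?B $$ (l, j) = x ^ l * s" using B[OF l] by auto
      have "x ^ j * (T $$ (i, l) * ?B $$ (l, j)) = T $$ (i, l) * (x ^ j * ?B $$ (l, j))"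
        by (simp only: mult_ac)
      also have "\<dots> = x ^ l * T $$ (i, l) * s"
        unfolding s by (simp only: mult_ac)
      finally have "x ^ j * (T $$ (i, l) * ?B $$ (l, j)) = x ^ l * T $$ (i, l) * s" .
      then show "x ^ i dvd x ^ j * (T $$ (i, l) * ?B $$ (l, j))"
        using dvd_mult2[OF T[OF l]] by (simp only:)
    qed
    have "x ^ (i + Suc n) dvd x ^ j * E1 i j"
    proof (cases "j = m")
      case True
      have "x ^ j * E1 i j = x ^ (i + Suc n) * (c * c * My (Suc i) n - c * My (Suc i) (Suc n))"
        using True n by (simp add: E1_def y power_add algebra_simps)
      then show ?thesis by simp
    qed (simp add: E1_def)
    then show "x ^ (i + Suc n) dvd x ^ j * (Q $$ (i, j) - (T * ?B) $$ (i, j))"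
      using ij by (simp add: Q_def)
  qed (simp add: Q_def)
  ultimately have *: "x ^ Suc n dvd Determinant.det (?A * (U * Z)) - Determinant.det (T * ?B)"
    using dvd_add[of "x ^ Suc n" "Determinant.det (?A * (U * Z)) - Determinant.det Q"
        "Determinant.det Q - Determinant.det (T * ?B)"] by (simp only: diff_add_cancel add_diff_eq)
  have 1: "Determinant.det (?A * (U * Z)) = Determinant.det ?A * \<kappa>"
    unfolding det_mult[OF hook_mat_carrier carrT(3)] det_mult[OF carr(1,3)] det_U det_Z by (simp only: mult_1)
  have "Determinant.det T = 1"
    unfolding UL[symmetric] det_mult[OF carr(1,2)] det_U det_L by (simp only: mult_1)
  then have 2: "Determinant.det (T * ?B) = Determinant.det ?B"
    unfolding det_mult[OF carrT(1) hook_mat_carrier] by (simp only: mult_1)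
  show ?thesis
    using * unfolding 1 2 \<kappa>_def .
qed

section \<open>Iteration of the functional equation\<close>

definition geometric_fps :: "'a::comm_ring_1 \<Rightarrow> 'a fps" where
  "geometric_fps c = Abs_fps (\<lambda>i. c ^ i)"

lemma geometric_fps_mult: "(1 - fps_const c * fps_X) * geometric_fps c = 1"
proof (rule fps_ext)
  fix n
  show "fps_nth ((1 - fps_const c * fps_X) * geometric_fps c) n = fps_nth 1 n"
    unfolding linear_factor_nth by (cases n) (simp_all add: geometric_fps_def)
qed

lemma geometric_fps_0 [simp]: "geometric_fps 0 = 1"
  by (rule fps_ext) (simp add: geometric_fps_def power_0_left)

lemma geometric_fps_nth_0 [simp]: "fps_nth (geometric_fps c) 0 = 1"
  by (simp add: geometric_fps_def)

text \<open>The series (1 - v)^(-d) / (1 - c v). With a natural exponent d its inverse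
  \<open>hook_K\<close> is a polynomial in v.\<close>

definition hook_H :: "nat \<Rightarrow> 'a::comm_ring_1 \<Rightarrow> 'a fps" where
  "hook_H d c = geometric_fps 1 ^ d * geometric_fps c"

definition hook_K :: "nat \<Rightarrow> 'a::comm_ring_1 \<Rightarrow> 'a fps" where
  "hook_K d c = (1 - fps_X) ^ d * (1 - fps_const c * fps_X)"

lemma hook_H_K: "hook_H d c * hook_K d c = 1"
proof -
  have "hook_H d c * hook_K d c = ((1 - fps_const 1 * fps_X) * geometric_fps 1) ^ d
      * ((1 - fps_const c * fps_X) * geometric_fps c)"
    by (simp add: hook_H_def hook_K_def power_mult_distrib mult_ac)
  then show ?thesis unfolding geometric_fps_mult by simp
qed

lemma hook_H_nth_0 [simp]: "fps_nth (hook_H d c) 0 = 1"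
  by (simp add: hook_H_def fps_nth_power_0)

lemma hook_K_nth_0 [simp]: "fps_nth (hook_K d c) 0 = 1"
  by (simp add: hook_K_def fps_nth_power_0)

text \<open>Two power series rings are nested: the outer variable is the v of the rows, the inner
  one is x, which is the \<open>fps_X\<close> written here. The parameter c lies in the inner ring,
  so it may be a power of x.\<close>

definition hook_det :: "nat \<Rightarrow> complex fps \<Rightarrow> nat \<Rightarrow> complex fps" where
  "hook_det d c n = Determinant.det (hook_mat fps_X (\<lambda>k. fps_nth (hook_row (hook_H d c) (hook_K d c) k)) n)"

text \<open>Row 0 is 1 minus the polynomial (1 - v^2)(1 - v)^d (1 - c v), whose degree is at most d
  + 3; for n >= d + 3 the truncated sum is therefore a full evaluation at y.\<close>

lemma hook_row_0_sum:
  fixes c y :: "'a::comm_ring_1"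
  assumes "d + 3 \<le> n"
  shows "1 - (\<Sum>b = 1..n. fps_nth (hook_row (hook_H d c) (hook_K d c) 0) b * y ^ b) =
    (1 - y ^ 2) * ((1 - y) ^ d * (1 - c * y))"
proof -
  define q where "q = [:1, 0, -1:] * ([:1, -1:] ^ d * [:1, -c:])"
  have lin: "fps_of_poly [:1, a:] = 1 + fps_const a * fps_X" for a :: 'a
    by (simp add: fps_of_poly_pCons algebra_simps)
  have quad: "fps_of_poly [:1, 0, -1 :: 'a:] = 1 - fps_X ^ 2"
    by (simp add: fps_of_poly_pCons power2_eq_square algebra_simps)
  have "fps_of_poly q = (1 - fps_X ^ 2) * hook_K d c"
    unfolding q_def hook_K_def fps_of_poly_mult fps_of_poly_power lin quad by simp
  then have row: "hook_row (hook_H d c) (hook_K d c) 0 = 1 - fps_of_poly q"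
    using hook_row_0[OF hook_H_K hook_H_nth_0, of d c] by simp
  have "degree ([:1, -1:] ^ d :: 'a poly) \<le> d"
    using degree_power_le[of "[:1, -1:] :: 'a poly" d] by (auto intro: order.trans simp: degree_pCons_eq_if split: if_splits)
  then have "degree q \<le> n"
    unfolding q_def using assms degree_mult_le[of "[:1, 0, -1:]" "[:1, -1:] ^ d * [:1, -c:]"]
      degree_mult_le[of "[:1, -1:] ^ d" "[:1, -c:]"]
    by (auto simp: degree_pCons_eq_if split: if_splits)
  then have "poly q y = (\<Sum>b = 0..n. coeff q b * y ^ b)"
    unfolding poly_altdef by (intro sum.mono_neutral_left) (auto simp: coeff_eq_0)
  also have "\<dots> = coeff q 0 + (\<Sum>b = 1..n. coeff q b * y ^ b)"
    by (simp add: sum.atLeast_Suc_atMost)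
  also have "coeff q 0 = 1"
    by (simp add: q_def coeff_mult coeff_0_power)
  finally have "poly q y = 1 + (\<Sum>b = 1..n. coeff q b * y ^ b)" .
  moreover have "(\<Sum>b = 1..n. fps_nth (hook_row (hook_H d c) (hook_K d c) 0) b * y ^ b) =
      - (\<Sum>b = 1..n. coeff q b * y ^ b)"
    unfolding row sum_negf[symmetric] by (intro sum.cong) auto
  moreover have "poly q y = (1 - y ^ 2) * ((1 - y) ^ d * (1 - c * y))"
    by (simp add: q_def power2_eq_square algebra_simps)
  ultimately show ?thesis by simp
qed

lemma hook_det_step:
  assumes "d + 3 \<le> n" and y: "y = fps_X * c"
  shows "fps_X ^ Suc n dvd hook_det d y n * ((1 - y ^ 2) * ((1 - y) ^ d * (1 - c * y))) - hook_det d c n"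
  unfolding hook_row_0_sum[OF assms(1), symmetric] hook_det_def
proof (rule det_hook_mat_shift[OF fps_X_neq_zero y])
  fix k b :: nat assume b: "0 < b"
  have K: "hook_K d e = (1 - fps_X) ^ d * (1 - fps_const e * fps_X)" for e :: "complex fps"
    by (simp add: hook_K_def)
  have rel: "(1 - fps_const c * fps_X) * hook_H d c = (1 - fps_const y * fps_X) * hook_H d y"
    unfolding hook_H_def mult.left_commute[of "1 - _"] geometric_fps_mult ..
  have inv: "hook_H d c * ((1 - fps_X) ^ d * (1 - fps_const c * fps_X)) = 1"
    unfolding K[symmetric] by (rule hook_H_K)
  have "fps_nth (hook_row (hook_H d y) (hook_K d y) (Suc k)) 1 = fps_nth (hook_H d y) (k + 2)"
    using hook_row_nth_1[of "hook_K d y" "hook_H d y" "Suc k"] by simp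
  then show "(1 + c * y) * fps_nth (hook_row (hook_H d y) (hook_K d y) (Suc k)) b -
       c * fps_nth (hook_row (hook_H d y) (hook_K d y) (Suc k)) (b - 1) -
       y * fps_nth (hook_row (hook_H d y) (hook_K d y) (Suc k)) (b + 1) -
       y * fps_nth (hook_row (hook_H d y) (hook_K d y) (Suc k)) 1 *
         fps_nth (hook_row (hook_H d c) (hook_K d c) 0) b =
       (1 + c * y) * fps_nth (hook_row (hook_H d c) (hook_K d c) (Suc k)) b -
       y * fps_nth (hook_row (hook_H d c) (hook_K d c) (k + 2)) b -
       c * fps_nth (hook_row (hook_H d c) (hook_K d c) k) b"
    using hook_row_shift[OF rel inv hook_H_nth_0 b, of k] unfolding K[symmetric] by simp
qed simp

section \<open>Dependence of the determinant on c, and the induction on d\<close>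

lemma hook_row_diff_dvd:
  fixes H H' K K' :: "'a::comm_ring_1 fps"
  assumes H: "\<And>i. q dvd fps_nth H i - fps_nth H' i" and K: "\<And>i. q dvd fps_nth K i - fps_nth K' i"
  shows "q dvd fps_nth (hook_row H K k) b - fps_nth (hook_row H' K' k) b"
proof -
  have num: "q dvd fps_nth (hook_num H k) r - fps_nth (hook_num H' k) r" for r
  proof -
    have "fps_nth (hook_num H k) r - fps_nth (hook_num H' k) r = (if r = 0 then 0 else
        (fps_nth H (k + r) - fps_nth H' (k + r)) +
        (if 2 \<le> r \<and> r \<le> k + 2 then fps_nth H (k + 2 - r) - fps_nth H' (k + 2 - r) else 0))"
      by (simp add: hook_num_nth)
    then show ?thesis using H by (auto intro!: dvd_add)
  qed
  have "q dvd (\<Sum>i = 0..b. fps_nth (hook_num H k) i * fps_nth K (b - i) - fps_nth (hook_num H' k) i * fps_nth K' (b - i))"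
  proof (rule dvd_sum)
    fix i
    have "fps_nth (hook_num H k) i * fps_nth K (b - i) - fps_nth (hook_num H' k) i * fps_nth K' (b - i)
      = (fps_nth (hook_num H k) i - fps_nth (hook_num H' k) i) * fps_nth K (b - i)
      + fps_nth (hook_num H' k) i * (fps_nth K (b - i) - fps_nth K' (b - i))"
      by (simp add: algebra_simps)
    then show "q dvd fps_nth (hook_num H k) i * fps_nth K (b - i) - fps_nth (hook_num H' k) i * fps_nth K' (b - i)"
      using num K by (simp add: dvd_add)
  qed
  then show ?thesis by (simp add: hook_row_def fps_mult_nth sum_subtractf)
qed

lemma mult_diff_dvd:
  fixes a b c d :: "'a::comm_ring_1"
  assumes "q dvd a - b" "q dvd c - d"
  shows "q dvd a * c - b * d"
proof -
  have "a * c - b * d = (a - b) * c + b * (c - d)" by (simp add: algebra_simps)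
  then show ?thesis using assms by (simp add: dvd_add)
qed

lemma power_diff_dvd:
  fixes a b :: "'a::comm_ring_1"
  assumes "q dvd a - b"
  shows "q dvd a ^ n - b ^ n"
  by (induction n) (auto intro: mult_diff_dvd assms)

text \<open>Used at c = x^N, this replaces a limit N -> infinity: the determinant differs from the
  one at c = 0 only in order N and higher.\<close>

lemma hook_det_0_dvd:
  "c dvd hook_det d c n - hook_det d 0 n"
  unfolding hook_det_def
proof (rule det_diff_dvd[OF hook_mat_carrier hook_mat_carrier])
  fix i j assume ij: "i < n" "j < n"
  have geo: "c dvd fps_nth (geometric_fps c) i - fps_nth 1 i" for i
    by (cases i) (simp_all add: geometric_fps_def)
  have "c dvd fps_nth (hook_H d c) i - fps_nth (hook_H d 0) i" for i
    unfolding hook_H_def fps_mult_nth sum_subtractf[symmetric] geometric_fps_0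
    by (intro dvd_sum mult_diff_dvd geo) simp
  moreover have "c dvd fps_nth (1 - fps_const c * fps_X) i - fps_nth (1 - fps_const 0 * fps_X) i" for i
    by simp
  then have "c dvd fps_nth (hook_K d c) i - fps_nth (hook_K d 0) i" for i
    unfolding hook_K_def fps_mult_nth sum_subtractf[symmetric]
    by (intro dvd_sum mult_diff_dvd) auto
  ultimately have "c dvd fps_nth (hook_row (hook_H d c) (hook_K d c) (Suc i)) (Suc j)
     - fps_nth (hook_row (hook_H d 0) (hook_K d 0) (Suc i)) (Suc j)"
    by (rule hook_row_diff_dvd)
  then have "c dvd - (fps_X ^ Suc i * (fps_nth (hook_row (hook_H d c) (hook_K d c) (Suc i)) (Suc j)
     - fps_nth (hook_row (hook_H d 0) (hook_K d 0) (Suc i)) (Suc j)))"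
    by simp
  then show "c dvd hook_mat fps_X (\<lambda>k. fps_nth (hook_row (hook_H d c) (hook_K d c) k)) n $$ (i, j) -
      hook_mat fps_X (\<lambda>k. fps_nth (hook_row (hook_H d 0) (hook_K d 0) k)) n $$ (i, j)"
    using ij by (simp add: hook_mat_def algebra_simps)
qed

text \<open>At c = 1 the factor 1/(1 - c v) is one more factor 1/(1 - v); this is where d passes to
  d + 1.\<close>

lemma hook_det_1: "hook_det d 1 n = hook_det (Suc d) 0 n"
  by (simp add: hook_det_def hook_H_def hook_K_def mult_ac)

text \<open>For H = 1 row k is the unit vector at k + 2, so the matrix is unitriangular. This starts
  the induction on d.\<close>

lemma hook_det_0_0: "hook_det 0 0 n = 1"
proof -
  have row: "fps_nth (hook_row (1 :: complex fps fps) 1 k) b = (if b = k + 2 then 1 else 0)" for k b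
    by (auto simp: hook_row_def hook_num_nth)
  show ?thesis
    unfolding hook_det_def hook_mat_def
    by (subst det_upper_triangular[of _ n])
      (auto intro!: prod_list_eq_1 upper_triangularI simp: diag_mat_def hook_H_def hook_K_def row)
qed

lemma diff_dvd_trans: "q dvd a - b \<Longrightarrow> q dvd b - c \<Longrightarrow> q dvd a - (c::'a::comm_ring_1)"
  using dvd_add[of q "a - b" "b - c"] by simp

text \<open>The k-th step leads from c = x^(k-1) to y = x^k and contributes (1 - x^(2k)) (1 -
  x^(2k-1)) (1 - x^k)^d. The first two factors run through the even and the odd exponents and
  interleave to the product up to 2 N.\<close>

lemma hook_det_1_iterate:
  assumes "d + 3 \<le> n"
  shows "fps_X ^ Suc n dvd hook_det d 1 n - hook_det d (fps_X ^ N) n *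
    ((\<Prod>k = 1..2 * N. 1 - fps_X ^ k) * (\<Prod>k = 1..N. 1 - fps_X ^ k) ^ d)"
proof (induction N)
  case (Suc N)
  let ?f = "\<lambda>N. (\<Prod>k = 1..2 * N. 1 - fps_X ^ k) * (\<Prod>k = 1..N. 1 - fps_X ^ k) ^ d :: complex fps"
  let ?y = "fps_X ^ Suc N :: complex fps"
  have y2: "?y ^ 2 = fps_X ^ Suc (Suc (2 * N))" "fps_X ^ N * ?y = fps_X ^ Suc (2 * N)"
    by (simp_all only: power_mult[symmetric] power_add[symmetric]) (rule arg_cong[of _ _ "\<lambda>n. _ ^ n"], simp)+
  have f: "?f (Suc N) = (1 - ?y ^ 2) * ((1 - ?y) ^ d * (1 - fps_X ^ N * ?y)) * ?f N"
    unfolding y2 by (simp add: power_mult_distrib mult_ac)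
  have "fps_X ^ Suc n dvd hook_det d (fps_X ^ N) n - hook_det d ?y n * ((1 - ?y ^ 2) * ((1 - ?y) ^ d * (1 - fps_X ^ N * ?y)))"
    using hook_det_step[OF assms, of ?y "fps_X ^ N"] by (subst dvd_diff_commute) simp
  then have "fps_X ^ Suc n dvd hook_det d (fps_X ^ N) n * ?f N - hook_det d ?y n * ?f (Suc N)"
    using mult_diff_dvd[of "fps_X ^ Suc n" _ _ "?f N" "?f N"] unfolding f mult.assoc[symmetric] by simp
  with Suc.IH show ?case by (rule diff_dvd_trans)
qed simp

text \<open>\<open>E\<close> represents the Euler product through its truncations. The step from d
  to d + 1 multiplies by \<open>E ^ Suc d\<close>, and the exponents 1 + ... + d add up to d (d + 1)
  / 2. After n + 1 iterations the finite products and the value at c = 0 are all correct modulo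
  x^(n+1).\<close>

lemma hook_det_nat:
  assumes E: "\<And>N. fps_X ^ Suc N dvd E - (\<Prod>k = 1..N. 1 - fps_X ^ k)" and "d + 2 \<le> n"
  shows "fps_X ^ Suc n dvd hook_det d 0 n - E ^ (d * Suc d div 2)"
  using assms(2)
proof (induction d)
  case (Suc d)
  have EN: "fps_X ^ Suc n dvd (\<Prod>k = 1..N. 1 - fps_X ^ k) - E" if "n \<le> N" for N
    using dvd_trans[OF le_imp_power_dvd E[of N], of "Suc n"] that by (subst dvd_diff_commute) simp
  have "fps_X ^ Suc n dvd hook_det d (fps_X ^ Suc n) n - hook_det d 0 n"
    by (rule hook_det_0_dvd)
  then have "fps_X ^ Suc n dvd hook_det d (fps_X ^ Suc n) n - E ^ (d * Suc d div 2)"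
    using Suc by (auto elim: diff_dvd_trans)
  then have "fps_X ^ Suc n dvd hook_det d (fps_X ^ Suc n) n *
      ((\<Prod>k = 1..2 * Suc n. 1 - fps_X ^ k) * (\<Prod>k = 1..Suc n. 1 - fps_X ^ k) ^ d)
      - E ^ (d * Suc d div 2) * (E * E ^ d)"
    by (intro mult_diff_dvd power_diff_dvd EN) auto
  moreover have "fps_X ^ Suc n dvd hook_det (Suc d) 0 n - hook_det d (fps_X ^ Suc n) n *
    ((\<Prod>k = 1..2 * Suc n. 1 - fps_X ^ k) * (\<Prod>k = 1..Suc n. 1 - fps_X ^ k) ^ d)"
    using hook_det_1_iterate[of d n "Suc n"] Suc.prems unfolding hook_det_1 by simp
  ultimately have *: "fps_X ^ Suc n dvd hook_det (Suc d) 0 n - E ^ (d * Suc d div 2) * (E * E ^ d)"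
    by (rule diff_dvd_trans[rotated])
  have "Suc d * Suc (Suc d) = d * Suc d + 2 * Suc d" by simp
  then have "Suc d * Suc (Suc d) div 2 = d * Suc d div 2 + Suc d" by simp
  then show ?case using * by (simp only: power_add power_Suc)
qed (simp add: hook_det_0_0)

text \<open>At c = 0 the rows do not involve x; this embedding into the nested ring allows them to
  be computed over the complex numbers.\<close>

definition fps_lift :: "complex fps \<Rightarrow> complex fps fps" where
  "fps_lift f = Abs_fps (\<lambda>i. fps_const (fps_nth f i))"

lemma fps_lift_mult: "fps_lift (f * g) = fps_lift f * fps_lift g"
proof -
  have "fps_const (\<Sum>i\<in>A. f i) = (\<Sum>i\<in>A. fps_const (f i))" if "finite A" for f :: "nat \<Rightarrow> complex" and A
    using that by (induction A rule: finite_induct) (simp_all flip: fps_const_add)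
  then show ?thesis
    by (intro fps_ext) (simp add: fps_lift_def fps_mult_nth fps_const_mult[symmetric] del: fps_const_mult)
qed

lemma fps_lift_1: "fps_lift 1 = 1"
  by (rule fps_ext) (simp add: fps_lift_def)

lemma fps_lift_power: "fps_lift (f ^ n) = fps_lift f ^ n"
  by (induction n) (simp_all add: fps_lift_1 fps_lift_mult)

lemma hook_row_lift: "fps_nth (hook_row (fps_lift H) (fps_lift K) k) = (\<lambda>b. fps_const (fps_nth (hook_row H K k) b))"
proof (rule ext)
  fix b
  have "hook_num (fps_lift H) k = fps_lift (hook_num H k)"
    by (rule fps_ext) (simp add: hook_num_nth fps_lift_def)
  then have "hook_row (fps_lift H) (fps_lift K) k = fps_lift (hook_row H K k)"
    by (simp add: hook_row_def fps_lift_mult)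
  then show "fps_nth (hook_row (fps_lift H) (fps_lift K) k) b = fps_const (fps_nth (hook_row H K k) b)"
    by (simp add: fps_lift_def)
qed

lemma binomial_fps_nat: "binomial_fps (of_nat d) = (1 - fps_X) ^ d"
proof (induction d)
  case (Suc d)
  have "binomial_fps (of_nat (Suc d)) = binomial_fps 1 * binomial_fps (of_nat d)"
    by (simp add: binomial_fps_add)
  then show ?case using Suc by (simp add: binomial_fps_1)
qed (simp add: binomial_fps_0)

lemma binomial_fps_neg_nat: "binomial_fps (- of_nat d) = geometric_fps 1 ^ d"
proof -
  have "binomial_fps (- of_nat d) * ((1 - fps_X) ^ d * geometric_fps 1 ^ d) = geometric_fps 1 ^ d"
    unfolding mult.assoc[symmetric] binomial_fps_nat[symmetric] binomial_fps_add by (simp add: binomial_fps_0)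
  moreover have "(1 - fps_X) ^ d * geometric_fps 1 ^ d = (1 :: complex fps)"
    using geometric_fps_mult[of "1 :: complex"] by (simp flip: power_mult_distrib)
  ultimately show ?thesis by simp
qed

lemma hook_det_eq:
  "hook_det d 0 n = Determinant.det (hook_mat fps_X
     (\<lambda>k b. fps_const (fps_nth (hook_row (binomial_fps (- of_nat d)) (binomial_fps (of_nat d)) k) b)) n)"
proof -
  have "fps_lift (geometric_fps 1) = geometric_fps 1" "fps_lift (1 - fps_X) = 1 - fps_X"
    by (rule fps_ext, simp add: fps_lift_def geometric_fps_def fps_X_def)+
  then have "hook_H d 0 = fps_lift (binomial_fps (- of_nat d))" "hook_K d 0 = fps_lift (binomial_fps (of_nat d))"
    by (simp_all add: hook_H_def hook_K_def binomial_fps_nat binomial_fps_neg_nat fps_lift_power)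
  then show ?thesis unfolding hook_det_def by (simp add: hook_row_lift)
qed

section \<open>Principal minors\<close>

definition list_mat :: "(nat \<Rightarrow> nat \<Rightarrow> 'a) \<Rightarrow> nat list \<Rightarrow> 'a mat" where
  "list_mat f \<mu> = Matrix.mat (length \<mu>) (length \<mu>) (\<lambda>(i, j). f (\<mu> ! i) (\<mu> ! j))"

lemma list_mat_carrier [simp]: "list_mat f \<mu> \<in> carrier_mat (length \<mu>) (length \<mu>)"
  by (simp add: list_mat_def)

text \<open>The identity matrix is added only to the rows of Q, so that the rows can be expanded one by one.\<close>

lemma det_add_one_minors_aux:
  fixes f :: "nat \<Rightarrow> nat \<Rightarrow> 'a::comm_ring_1"
  defines "A \<equiv> \<lambda>P Q. Matrix.mat (length (P @ Q)) (length (P @ Q))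
    (\<lambda>(i, j). f ((P @ Q) ! i) ((P @ Q) ! j) + (if i = j \<and> length P \<le> i then 1 else 0))"
  shows "Determinant.det (A P Q) = (\<Sum>s\<leftarrow>subseqs Q. Determinant.det (list_mat f (P @ s)))"
proof (induction Q arbitrary: P)
  case Nil
  have "A P [] = list_mat f P"
    by (rule eq_matI) (auto simp: A_def list_mat_def)
  then show ?case by simp
next
  case (Cons q Q)
  let ?n = "length (P @ q # Q)" and ?i = "length P"
  have i: "?i < ?n" by simp
  have car: "A P (q # Q) \<in> carrier_mat ?n ?n" "A (P @ [q]) Q \<in> carrier_mat ?n ?n"
    by (auto simp: A_def)
  have del: "mat_delete (A P (q # Q)) ?i j = mat_delete (A (P @ [q]) Q) ?i j" if "j < ?n" for j
    using that by (intro eq_matI) (auto simp: A_def mat_delete_def nth_append)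
  have del': "mat_delete (A P (q # Q)) ?i ?i = A P Q"
    by (intro eq_matI) (auto simp: A_def mat_delete_def nth_append nth_Cons' not_less less_Suc_eq_le Suc_diff_le split: if_splits)
  have "Determinant.det (A P (q # Q)) = (\<Sum>j<?n. A P (q # Q) $$ (?i, j) * cofactor (A P (q # Q)) ?i j)"
    by (rule laplace_expansion_row[OF car(1) i])
  \<comment> \<open>The two rows differ only by the 1 on the diagonal, and its cofactor is the
    determinant with q deleted.\<close>
  also have "\<dots> = (\<Sum>j<?n. A (P @ [q]) Q $$ (?i, j) * cofactor (A (P @ [q]) Q) ?i j
      + (if j = ?i then cofactor (A P (q # Q)) ?i ?i else 0))"
    by (intro sum.cong refl) (auto simp: cofactor_def del, auto simp: A_def algebra_simps)
  also have "\<dots> = Determinant.det (A (P @ [q]) Q) + cofactor (A P (q # Q)) ?i ?i"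
    unfolding sum.distrib laplace_expansion_row[OF car(2) i, symmetric] by simp
  also have "cofactor (A P (q # Q)) ?i ?i = Determinant.det (A P Q)"
    by (simp add: cofactor_def del' flip: power_add mult_2)
  finally show ?case
    unfolding Cons.IH by (simp add: Let_def o_def)
qed

text \<open>Rows and columns undergo the same permutation, so its sign cancels. The reversal
  reconciles decreasing lists of parts with increasing matrix indices.\<close>

lemma det_reverse:
  fixes f :: "nat \<Rightarrow> nat \<Rightarrow> 'a::comm_ring_1"
  shows "Determinant.det (Matrix.mat n n (\<lambda>(i, j). f (n - 1 - i) (n - 1 - j)))
    = Determinant.det (Matrix.mat n n (\<lambda>(i, j). f i j))"
proof -
  define p where "p = (\<lambda>i. if i < n then n - 1 - i else i)"
  have p: "p permutes {0..<n}"
    by (rule bij_imp_permutes, rule bij_betw_byWitness[of _ p]) (auto simp: p_def)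
  let ?A = "Matrix.mat n n (\<lambda>(i, j). f i j)" and ?B = "Matrix.mat n n (\<lambda>(i, j). f j (n - 1 - i))"
  have "Determinant.det (Matrix.mat n n (\<lambda>(i, j). f (n - 1 - i) (n - 1 - j))) =
      Determinant.det (Matrix.mat n n (\<lambda>(i, j). ?B\<^sup>T $$ (p i, j)))"
    by (rule arg_cong[of _ _ Determinant.det], rule eq_matI) (auto simp: p_def)
  also have "\<dots> = signof p * Determinant.det ?B"
    by (subst det_permute_rows[OF _ p]) (simp_all add: det_transpose[OF mat_carrier])
  also have "?B = Matrix.mat n n (\<lambda>(i, j). ?A\<^sup>T $$ (p i, j))"
    by (rule eq_matI) (auto simp: p_def)
  also have "Determinant.det \<dots> = signof p * Determinant.det ?A"
    by (subst det_permute_rows[OF _ p]) (simp_all add: det_transpose[OF mat_carrier])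
  finally show ?thesis by (simp add: sign_def)
qed

text \<open>The sublists of n, ..., 1 are the strict partitions with parts at most n. In each
  principal minor the row factors - x^a combine to the sign and the power of x.\<close>

lemma det_hook_mat_minors:
  fixes x :: "'a::comm_ring_1"
  shows "Determinant.det (hook_mat x M n) = (\<Sum>s\<leftarrow>subseqs (rev [1..<Suc n]).
    (-1) ^ length s * x ^ sum_list s * Determinant.det (list_mat M s))"
proof -
  let ?f = "\<lambda>a b. - (x ^ a) * M a b" and ?Q = "rev [1..<Suc n]"
  let ?g = "\<lambda>i j. (if i = j then 1 else 0) - x ^ Suc i * M (Suc i) (Suc j)"
  have nth: "rev [Suc 0..<Suc n] ! i = Suc (n - Suc i)" if "i < n" for i
    using that by (simp add: rev_nth del: upt_Suc)
  have "Determinant.det (hook_mat x M n) = Determinant.det (Matrix.mat n n (\<lambda>(i, j). ?g (n - 1 - i) (n - 1 - j)))"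
    unfolding hook_mat_def using det_reverse[of n ?g] by simp
  also have "Matrix.mat n n (\<lambda>(i, j). ?g (n - 1 - i) (n - 1 - j)) =
      Matrix.mat (length ([] @ ?Q)) (length ([] @ ?Q))
    (\<lambda>(i, j). ?f (([] @ ?Q) ! i) (([] @ ?Q) ! j) + (if i = j \<and> length ([] :: nat list) \<le> i then 1 else 0))"
    by (rule eq_matI) (auto simp: nth simp del: upt_Suc)
  also have "Determinant.det \<dots> = (\<Sum>s\<leftarrow>subseqs ?Q. Determinant.det (list_mat ?f s))"
    using det_add_one_minors_aux[where P = "[]" and Q = ?Q and f = ?f] by (simp only: append_Nil)
  also have "(\<lambda>s. Determinant.det (list_mat ?f s)) =
      (\<lambda>s. (-1) ^ length s * x ^ sum_list s * Determinant.det (list_mat M s))"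
  proof
    fix s :: "nat list"
    have "(\<Prod>i = 0..<length s. - (x ^ (s ! i))) = (-1) ^ length s * x ^ sum_list s"
      by (induction s rule: rev_induct) (simp_all add: nth_append power_add)
    then show "Determinant.det (list_mat ?f s) = (-1) ^ length s * x ^ sum_list s * Determinant.det (list_mat M s)"
      using det_scale[of "length s" "\<lambda>i. - (x ^ (s ! i))" "\<lambda>i j. M (s ! i) (s ! j)" "\<lambda>_. 1"]
      by (simp add: list_mat_def)
  qed
  finally show ?thesis .
qed

text \<open>Schur complement of the first diagonal entry: \<open>W\<close> is the matrix after
  elimination of the first column, and \<open>L\<close> undoes the elimination.\<close>

lemma det_list_mat_Cons:
  fixes f :: "nat \<Rightarrow> nat \<Rightarrow> 'a::field"
  assumes nz: "f a a \<noteq> 0"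
  shows "Determinant.det (list_mat f (a # \<mu>)) =
    f a a * Determinant.det (list_mat (\<lambda>b c. f b c - f b a * f a c / f a a) \<mu>)"
proof -
  let ?n = "Suc (length \<mu>)" and ?A = "list_mat f (a # \<mu>)"
  define L where "L = Matrix.mat ?n ?n (\<lambda>(i, j). if i = j then 1 else if j = 0 then ?A $$ (i, 0) / f a a else 0)"
  define W where "W = Matrix.mat ?n ?n (\<lambda>(i, j). if i = 0 then ?A $$ (0, j)
     else ?A $$ (i, j) - ?A $$ (i, 0) * ?A $$ (0, j) / f a a)"
  have car: "L \<in> carrier_mat ?n ?n" "W \<in> carrier_mat ?n ?n" by (simp_all add: L_def W_def)
  have A00: "?A $$ (0, 0) = f a a" by (simp add: list_mat_def)
  have "?A = L * W"
  proof (rule eq_matI)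
    fix i j assume "i < dim_row (L * W)" "j < dim_col (L * W)"
    then have ij: "i < ?n" "j < ?n" by (auto simp: L_def W_def)
    have "(L * W) $$ (i, j) = (\<Sum>l = 0..<?n. L $$ (i, l) * W $$ (l, j))"
      using ij by (auto simp: scalar_prod_def L_def W_def intro!: sum.cong)
    also have "\<dots> = L $$ (i, 0) * W $$ (0, j) + (\<Sum>l = Suc 0..<?n. L $$ (i, l) * W $$ (l, j))"
      by (rule sum.atLeast_Suc_lessThan) simp
    also have "(\<Sum>l = Suc 0..<?n. L $$ (i, l) * W $$ (l, j)) = (\<Sum>l = Suc 0..<?n. if l = i then W $$ (i, j) else 0)"
      using ij by (intro sum.cong) (auto simp: L_def)
    finally show "?A $$ (i, j) = (L * W) $$ (i, j)"
      using ij nz A00 by (auto simp: L_def W_def)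
  qed (auto simp: L_def W_def list_mat_def)
  moreover have "Determinant.det L = 1"
    unfolding L_def by (subst det_lower_triangular[of ?n]) (auto intro!: prod_list_eq_1 simp: diag_mat_def)
  moreover have "Determinant.det W = f a a * Determinant.det (mat_delete W 0 0)"
  proof -
    have "Determinant.det W = (\<Sum>i<?n. W $$ (i, 0) * cofactor W i 0)"
      by (rule laplace_expansion_column[OF car(2)]) simp
    also have "\<dots> = (\<Sum>i<?n. if i = 0 then f a a * cofactor W 0 0 else 0)"
      using nz A00 by (intro sum.cong) (auto simp: W_def)
    finally show ?thesis by (simp add: cofactor_def)
  qed
  moreover have "mat_delete W 0 0 = list_mat (\<lambda>b c. f b c - f b a * f a c / f a a) \<mu>"
    by (rule eq_matI) (auto simp: W_def mat_delete_def list_mat_def)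
  ultimately show ?thesis
    by (simp add: det_mult[OF car])
qed

lemma prod_list_nth: "(\<Prod>i = 0..<length xs. f (xs ! i)) = prod_list (map f xs)"
  by (induction xs rule: rev_induct) (simp_all add: nth_append)

text \<open>The contribution of a pair of indices to a Cauchy determinant, (X_a - X_b)(Y_b - Y_a) /
  ((X_b - Y_a)(X_a - Y_b)), written out in a, b and z.\<close>

definition pair_weight :: "complex \<Rightarrow> nat \<Rightarrow> nat \<Rightarrow> complex" where
  "pair_weight z a b = (of_nat a - of_nat b) ^ 2 * ((of_nat a + of_nat b) ^ 2 - z ^ 2)
     / ((of_nat a + of_nat b) ^ 2 * ((of_nat a - of_nat b) ^ 2 - z ^ 2))"

lemma binomial_fps_nth_nonzero:
  assumes "a \<notin> \<int>"
  shows "fps_nth (binomial_fps a) n \<noteq> 0"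
proof (induction n)
  case (Suc n)
  have "of_nat n + 1 \<noteq> (0::complex)"
    by (metis of_nat_Suc of_nat_neq_0 add.commute)
  then show ?case
    using Suc nonint_nonzero(4)[OF assms, of n] by (simp add: binomial_fps_Suc)
qed simp

lemma hook_entry_diag_nonzero:
  assumes z: "z \<notin> \<int>" and "0 < a"
  shows "hook_entry z a a \<noteq> 0"
proof -
  have "- z \<notin> \<int>" "z - 1 \<notin> \<int>"
    using z by (auto simp: minus_in_Ints_iff dest: Ints_add[OF _ Ints_1])
  moreover have "2 * of_nat a - z \<noteq> 0" using nonint_nonzero(4)[OF z, of "2 * a"] by simp
  moreover have "z \<noteq> 0" using z by auto
  ultimately show ?thesis
    using \<open>0 < a\<close> by (simp add: hook_entry_def binomial_fps_nth_nonzero)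
qed

text \<open>The Schur complement of a Cauchy matrix is the Cauchy matrix of the remaining indices,
  with rows and columns rescaled by \<open>r\<close> and \<open>s\<close>. This peels off one part
  at a time, in step with the recursion for the hook product.\<close>

lemma det_hook_entry_Cons:
  assumes z: "z \<notin> \<int>" and pos: "0 < a" "\<And>b. b \<in> set \<mu> \<Longrightarrow> 0 < b"
  shows "Determinant.det (list_mat (hook_entry z) (a # \<mu>)) =
    hook_entry z a a * prod_list (map (pair_weight z a) \<mu>) * Determinant.det (list_mat (hook_entry z) \<mu>)"
proof -
  define X where "X = (\<lambda>b::nat. of_nat b ^ 2 + z * of_nat b)"
  define Y where "Y = (\<lambda>b::nat. of_nat b ^ 2 - z * of_nat b)"
  define w where "w = (\<lambda>b c::nat. (of_nat b + of_nat c) * (of_nat b - of_nat c + z))"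
  have wXY: "w b c = X b - Y c" for b c
    by (simp add: w_def X_def Y_def power2_eq_square algebra_simps)
  define C where "C = (\<lambda>b. fps_nth (binomial_fps (- z)) b)"
  define D where "D = (\<lambda>b. of_nat b * fps_nth (binomial_fps (z - 1)) b * (2 * of_nat b - z))"
  have entry: "hook_entry z b c = C b * D c / w b c" for b c
    by (simp add: hook_entry_def C_def D_def w_def mult_ac)
  have w0: "w b c \<noteq> 0" if "0 < b" for b c
  proof -
    have "of_nat b + of_nat c \<noteq> (0::complex)" using that by (metis add_is_0 of_nat_add of_nat_eq_0_iff not_less0)
    then show ?thesis using nonint_nonzero(5)[OF z, of b c] by (simp add: w_def)
  qed
  define r where "r = (\<lambda>b. (X a - X b) / w b a)"
  define s where "s = (\<lambda>b. (Y b - Y a) / w a b)"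
  have d: "hook_entry z a a \<noteq> 0" by (rule hook_entry_diag_nonzero[OF z pos(1)])
  have schur: "hook_entry z b c - hook_entry z b a * hook_entry z a c / hook_entry z a a = r b * hook_entry z b c * s c"
    if "b \<in> set \<mu>" "c \<in> set \<mu>" for b c
  proof -
    have nz: "w b c \<noteq> 0" "w b a \<noteq> 0" "w a c \<noteq> 0" "w a a \<noteq> 0"
      using w0 pos that by auto
    have CD: "C a \<noteq> 0" "D a \<noteq> 0" using d by (auto simp: entry)
    have "w b a * w a c - w a a * w b c = (X a - X b) * (Y c - Y a)"
      by (simp add: wXY algebra_simps)
    moreover have "C b * D c / u - (C b * D a / v) * (C a * D c / v') / (C a * D a / u')
       = (v * v' - u' * u) / (v * v') * (C b * D c / u)" if "u \<noteq> 0" "v \<noteq> 0" "v' \<noteq> 0" "u' \<noteq> 0" for u v v' u'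
      using that CD by (simp add: field_simps)
    ultimately have "hook_entry z b c - hook_entry z b a * hook_entry z a c / hook_entry z a a
       = (X a - X b) * (Y c - Y a) / (w b a * w a c) * (C b * D c / w b c)"
      using nz unfolding entry by simp
    also have "\<dots> = r b * (C b * D c / w b c) * s c"
      by (simp add: r_def s_def mult_ac)
    finally show ?thesis unfolding entry .
  qed
  have rs: "r b * s b = pair_weight z a b" if "b \<in> set \<mu>" for b
  proof -
    have "(X a - X b) * (Y b - Y a) = - ((of_nat a - of_nat b) ^ 2 * ((of_nat a + of_nat b) ^ 2 - z ^ 2))"
      "w b a * w a b = - ((of_nat a + of_nat b) ^ 2 * ((of_nat a - of_nat b) ^ 2 - z ^ 2))"
      by (simp_all add: X_def Y_def w_def power2_eq_square algebra_simps)
    then show ?thesis by (simp add: r_def s_def pair_weight_def)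
  qed
  let ?n = "length \<mu>"
  have "list_mat (\<lambda>b c. hook_entry z b c - hook_entry z b a * hook_entry z a c / hook_entry z a a) \<mu> =
     Matrix.mat ?n ?n (\<lambda>(i, j). r (\<mu> ! i) * hook_entry z (\<mu> ! i) (\<mu> ! j) * s (\<mu> ! j))"
    by (rule eq_matI) (auto simp: list_mat_def schur)
  also have "Determinant.det \<dots> = (\<Prod>i = 0..<?n. r (\<mu> ! i)) * (\<Prod>i = 0..<?n. s (\<mu> ! i)) *
      Determinant.det (list_mat (hook_entry z) \<mu>)"
    unfolding det_scale list_mat_def ..
  also have "(\<Prod>i = 0..<?n. r (\<mu> ! i)) * (\<Prod>i = 0..<?n. s (\<mu> ! i)) = (\<Prod>i = 0..<?n. pair_weight z a (\<mu> ! i))"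
    unfolding prod.distrib[symmetric] by (intro prod.cong) (auto simp: rs)
  also have "\<dots> = prod_list (map (pair_weight z a) \<mu>)"
    by (rule prod_list_nth)
  finally show ?thesis
    unfolding det_list_mat_Cons[of "hook_entry z" a, OF d] by simp
qed

section \<open>Doubled distinct partitions\<close>

definition strict_partition :: "nat list \<Rightarrow> bool" where
  "strict_partition \<mu> \<longleftrightarrow> sorted_wrt (>) \<mu> \<and> (\<forall>p\<in>set \<mu>. 0 < p)"

lemma strict_partition_Nil [simp]: "strict_partition []"
  by (simp add: strict_partition_def)

lemma strict_partition_Cons:
  "strict_partition (a # \<mu>) \<longleftrightarrow> 0 < a \<and> (\<forall>b\<in>set \<mu>. b < a) \<and> strict_partition \<mu>"
  by (auto simp: strict_partition_def)

lemma strict_partition_iff: "strict_partition \<mu> \<longleftrightarrow> int_partition \<mu> \<and> distinct \<mu>"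
proof (induction \<mu>)
  case (Cons a \<mu>)
  have "(\<forall>b\<in>set \<mu>. b < a) \<longleftrightarrow> (\<forall>b\<in>set \<mu>. b \<le> a) \<and> a \<notin> set \<mu>"
    using order_less_le by blast
  then show ?case using Cons unfolding strict_partition_Cons by (auto simp: int_partition_def)
qed (simp add: int_partition_def)

text \<open>The largest part a becomes the first principal hook, with a + 1 boxes in row 1 and a
  boxes in column 1; inside it lies the double of the other parts. The zeros pad this inner
  partition to a - 1 rows, and \<open>Suc\<close> adds the box of column 1.\<close>

fun double_partition :: "nat list \<Rightarrow> nat list" where
  "double_partition [] = []"
| "double_partition (a # \<mu>) =
    Suc a # map Suc (double_partition \<mu> @ replicate (a - 1 - length (double_partition \<mu>)) 0)"

lemma length_double_partition:
  "strict_partition \<mu> \<Longrightarrow> length (double_partition \<mu>) = (if \<mu> = [] then 0 else hd \<mu>)"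
proof (induction \<mu>)
  case (Cons a \<mu>)
  then show ?case by (cases \<mu>) (auto simp: strict_partition_Cons)
qed simp

lemma length_double_partition_le:
  assumes "strict_partition (a # \<mu>)"
  shows "length (double_partition \<mu>) \<le> a - 1" "length (double_partition (a # \<mu>)) = a"
  using assms length_double_partition[of \<mu>] length_double_partition[of "a # \<mu>"]
  by (cases \<mu>; auto simp: strict_partition_Cons)+

lemma double_partition_le:
  "strict_partition (a # \<mu>) \<Longrightarrow> x \<in> set (double_partition \<mu>) \<Longrightarrow> x \<le> a"
proof (induction \<mu> arbitrary: a x)
  case (Cons b \<mu>)
  then have b: "b < a" "strict_partition (b # \<mu>)" by (simp_all add: strict_partition_Cons)
  have "y \<le> b" if "y \<in> set (double_partition \<mu> @ replicate (b - 1 - length (double_partition \<mu>)) 0)" for y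
    using that Cons.IH[OF b(2)] by auto
  then show ?case using Cons.prems(2) b(1) by fastforce
qed simp

lemma int_partition_double_partition:
  "strict_partition \<mu> \<Longrightarrow> int_partition (double_partition \<mu>)"
proof (induction \<mu>)
  case (Cons a \<mu>)
  have "sorted_wrt (\<lambda>x y. y \<le> x) (replicate n c)" for n and c :: nat
    by (induction n) auto
  moreover have "int_partition (double_partition \<mu>)"
    using Cons by (simp add: strict_partition_Cons)
  ultimately show ?case
    using double_partition_le[OF Cons.prems] by (auto simp: int_partition_def sorted_wrt_append sorted_wrt_map)
qed (simp add: int_partition_def)

lemma part_at_double_partition:
  assumes "strict_partition (a # \<mu>)"
  shows "part_at (double_partition (a # \<mu>)) (Suc 0) = Suc a"
    "0 < i \<Longrightarrow> i < a \<Longrightarrow> part_at (double_partition (a # \<mu>)) (Suc i) = Suc (part_at (double_partition \<mu>) i)"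
    "a \<le> i \<Longrightarrow> part_at (double_partition (a # \<mu>)) (Suc i) = 0"
    "a \<le> i \<Longrightarrow> part_at (double_partition \<mu>) i = 0"
proof -
  note len = length_double_partition_le[OF assms]
  have a: "0 < a" using assms by (simp add: strict_partition_Cons)
  show "part_at (double_partition (a # \<mu>)) (Suc 0) = Suc a"
    by (simp add: part_at_def)
  show "part_at (double_partition (a # \<mu>)) (Suc i) = 0" if "a \<le> i"
    using that unfolding part_at_def len(2) by simp
  show "part_at (double_partition \<mu>) i = 0" if "a \<le> i"
    using that len(1) a by (simp add: part_at_def)
  show "part_at (double_partition (a # \<mu>)) (Suc i) = Suc (part_at (double_partition \<mu>) i)" if "0 < i" "i < a"
  proof -
    obtain k where k: "i = Suc k" using \<open>0 < i\<close> gr0_implies_Suc by blast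
    have "part_at (double_partition (a # \<mu>)) (Suc i) = double_partition (a # \<mu>) ! Suc k"
      using that unfolding part_at_def len(2) k by simp
    also have "\<dots> = Suc ((double_partition \<mu> @ replicate (a - 1 - length (double_partition \<mu>)) 0) ! k)"
      using that k len(1) by (simp add: nth_append)
    also have "\<dots> = Suc (part_at (double_partition \<mu>) i)"
      using that k len(1) by (auto simp: part_at_def nth_append)
    finally show ?thesis .
  qed
qed

declare double_partition.simps(2) [simp del]

lemma boxes_Nil: "boxes [] = {}"
  by (auto simp: boxes_def)

lemma boxes_iff_part_at: "(i, j) \<in> boxes \<nu> \<longleftrightarrow> 0 < i \<and> 0 < j \<and> j \<le> part_at \<nu> i"
  by (auto simp: boxes_def part_at_def split: if_splits)

lemma part_at_double_partition_le:
  assumes "strict_partition (a # \<mu>)"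
  shows "part_at (double_partition \<mu>) i \<le> a"
  using double_partition_le[OF assms] by (auto simp: part_at_def)

lemma boxes_double_partition_Cons:
  assumes "strict_partition (a # \<mu>)"
  shows "boxes (double_partition (a # \<mu>)) =
    Pair 1 ` {1..Suc a} \<union> (\<lambda>i. (Suc i, 1)) ` {1..<a} \<union> map_prod Suc Suc ` boxes (double_partition \<mu>)"
    (is "?L = ?R")
proof (rule Set.set_eqI)
  fix p :: "nat \<times> nat"
  obtain i j where p: "p = (i, j)" by (cases p)
  have shift: "(Suc i, Suc j) \<in> map_prod Suc Suc ` B \<longleftrightarrow> (i, j) \<in> B" "(0, j) \<notin> map_prod Suc Suc ` B"
    "(j, 0) \<notin> map_prod Suc Suc ` B" for i j B
    by auto
  have "(i, j) \<in> ?L \<longleftrightarrow> (i, j) \<in> ?R"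
  proof (cases i)
    case (Suc i')
    consider "i' = 0" | "0 < i'" "i' < a" | "0 < i'" "a \<le> i'" by linarith
    then show ?thesis
      using part_at_double_partition[OF assms] unfolding Suc boxes_iff_part_at
      by cases (cases j; auto simp: shift boxes_iff_part_at)+
  qed (auto simp: boxes_def)
  then show "p \<in> ?L \<longleftrightarrow> p \<in> ?R" unfolding p .
qed

lemma doubled_boxes_Cons:
  assumes "0 < a"
  shows "doubled_boxes (a # \<mu>) =
    Pair 1 ` {1..Suc a} \<union> (\<lambda>i. (Suc i, 1)) ` {1..<a} \<union> map_prod Suc Suc ` doubled_boxes \<mu>"
proof -
  have b: "boxes (a # \<mu>) = Pair 1 ` {1..a} \<union> map_prod Suc id ` boxes \<mu>"
  proof (rule Set.set_eqI)
    fix p :: "nat \<times> nat"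
    obtain i j where p: "p = (i, j)" by (cases p)
    have "(i, j) \<in> boxes (a # \<mu>) \<longleftrightarrow> (i, j) \<in> Pair 1 ` {1..a} \<union> map_prod Suc id ` boxes \<mu>"
      by (cases i; cases "i = 1") (auto simp: boxes_def part_at_def image_iff nth_Cons' map_prod_def split: if_splits)
    then show "p \<in> boxes (a # \<mu>) \<longleftrightarrow> p \<in> Pair 1 ` {1..a} \<union> map_prod Suc id ` boxes \<mu>"
      unfolding p .
  qed
  have pos: "0 < fst p \<and> 0 < snd p" if "p \<in> boxes \<mu>" for p
    using that by (auto simp: boxes_def)
  have 1: "(\<lambda>(i, j). (i, i + j)) ` boxes (a # \<mu>) = Pair 1 ` {2..Suc a} \<union> map_prod Suc Suc ` (\<lambda>(i, j). (i, i + j)) ` boxes \<mu>"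
  proof -
    have "{2..Suc a} = Suc ` {1..a}" by (simp add: image_Suc_atLeastAtMost numeral_2_eq_2)
    then have "Pair (1::nat) ` {2..Suc a} = (\<lambda>x. (1, Suc x)) ` {1..a}" by (simp only: image_image)
    then show ?thesis unfolding b image_Un by (simp add: image_image case_prod_unfold)
  qed
  have 2: "(\<lambda>(i, j). (i - 1 + j, i)) ` boxes (a # \<mu>) = (\<lambda>i. (i, 1)) ` {1..a} \<union> map_prod Suc Suc ` (\<lambda>(i, j). (i - 1 + j, i)) ` boxes \<mu>"
  proof -
    have "(\<lambda>(i, j). (i - 1 + j, i)) ` map_prod Suc id ` boxes \<mu> = map_prod Suc Suc ` (\<lambda>(i, j). (i - 1 + j, i)) ` boxes \<mu>"
      unfolding image_image using pos by (auto intro!: image_cong)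
    then show ?thesis unfolding b image_Un by (simp add: image_image)
  qed
  \<comment> \<open>The corner box comes from the column added for the first part, but in the hook
    it is counted with the first row.\<close>
  have "Pair 1 ` {1..Suc a} = insert (1, 1) (Pair (1::nat) ` {2..Suc a})"
    by (auto simp: image_iff)
  moreover have "(\<lambda>i. (i, 1)) ` {1..a} = insert (1, 1) ((\<lambda>i. (Suc i, 1::nat)) ` {1..<a})"
  proof -
    have "{1..a} = insert 1 (Suc ` {1..<a})"
      unfolding image_Suc_atLeastLessThan using assms by auto
    then show ?thesis by (simp only: image_insert image_image)
  qed
  moreover have "(P \<union> F) \<union> (insert p C \<union> G) = insert p P \<union> C \<union> (F \<union> G)"
    for p :: "nat \<times> nat" and P F C G
    by blast
  ultimately show ?thesis
    unfolding doubled_boxes_def 1 2 image_Un by (simp only:)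
qed

lemma boxes_double_partition:
  "strict_partition \<mu> \<Longrightarrow> boxes (double_partition \<mu>) = doubled_boxes \<mu>"
proof (induction \<mu>)
  case (Cons a \<mu>)
  then show ?case
    using boxes_double_partition_Cons[OF Cons.prems] doubled_boxes_Cons[of a \<mu>]
    by (simp add: strict_partition_Cons)
qed (simp add: doubled_boxes_def boxes_Nil)

lemma first_column_boxes:
  "int_partition \<nu> \<Longrightarrow> {i. (i, 1) \<in> boxes \<nu>} = {1..length \<nu>}"
  by (auto simp: boxes_def part_at_def int_partition_def Suc_le_eq)

lemma int_partition_eq_if_boxes_eq:
  assumes "int_partition \<nu>" "int_partition \<nu>'" "boxes \<nu> = boxes \<nu>'"
  shows "\<nu> = \<nu>'"
proof -
  have row: "{j. (i, j) \<in> boxes \<nu>} = {1..part_at \<nu> i}" if "0 < i" for \<nu> i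
    using that by (auto simp: boxes_iff_part_at)
  then have part: "part_at \<nu> i = part_at \<nu>' i" if "0 < i" for i
    using that assms(3) by (metis card_atLeastAtMost diff_Suc_1)
  have len: "length \<nu> = length \<nu>'"
    using first_column_boxes assms by (metis card_atLeastAtMost diff_Suc_1)
  show ?thesis
  proof (rule nth_equalityI[OF len])
    fix i assume "i < length \<nu>"
    then show "\<nu> ! i = \<nu>' ! i"
      using part[of "Suc i"] len by (simp add: part_at_def)
  qed
qed

lemma inj_on_double_partition: "inj_on double_partition {\<mu>. strict_partition \<mu>}"
proof -
  have "\<mu> = \<mu>'" if "strict_partition \<mu>" "strict_partition \<mu>'" "double_partition \<mu> = double_partition \<mu>'" for \<mu> \<mu>'
    using that
  proof (induction \<mu> arbitrary: \<mu>')
    case Nil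
    then show ?case by (cases \<mu>') (auto simp: double_partition.simps(2))
  next
    case (Cons a \<mu>)
    then obtain b \<mu>2 where \<mu>': "\<mu>' = b # \<mu>2"
      by (cases \<mu>') (auto simp: double_partition.simps(2))
    \<comment> \<open>All parts are positive, so discarding zeros removes exactly the
      padding.\<close>
    have pos: "filter ((<) 0) (double_partition \<mu>) = double_partition \<mu>" if "strict_partition \<mu>" for \<mu>
      using int_partition_double_partition[OF that] by (simp add: int_partition_def filter_id_conv)
    have ab: "a = b" and eq: "double_partition \<mu> @ replicate (a - 1 - length (double_partition \<mu>)) 0
        = double_partition \<mu>2 @ replicate (a - 1 - length (double_partition \<mu>2)) 0"
      using Cons.prems(3) unfolding \<mu>'
      by (auto simp: double_partition.simps(2) map_append[symmetric] inj_map_eq_map simp del: map_append)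
    have "double_partition \<mu> = double_partition \<mu>2"
      using arg_cong[OF eq, of "filter ((<) 0)"] pos[of \<mu>] pos[of \<mu>2] Cons.prems \<mu>'
      by (simp add: strict_partition_Cons)
    then show ?case using Cons.IH[of \<mu>2] Cons.prems \<mu>' ab by (simp add: strict_partition_Cons)
  qed
  then show ?thesis by (auto simp: inj_on_def)
qed

lemma DD_eq: "DD = double_partition ` {\<mu>. strict_partition \<mu>}"
proof (rule Set.set_eqI, rule iffI)
  fix \<nu> assume "\<nu> \<in> DD"
  then obtain \<mu> where \<mu>: "int_partition \<nu>" "strict_partition \<mu>" "boxes \<nu> = doubled_boxes \<mu>"
    by (auto simp: DD_def strict_partition_iff)
  then have "\<nu> = double_partition \<mu>"
    by (intro int_partition_eq_if_boxes_eq int_partition_double_partition) (simp_all add: boxes_double_partition)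
  then show "\<nu> \<in> double_partition ` {\<mu>. strict_partition \<mu>}" using \<mu> by auto
next
  fix \<nu> assume "\<nu> \<in> double_partition ` {\<mu>. strict_partition \<mu>}"
  then obtain \<mu> where "\<nu> = double_partition \<mu>" "strict_partition \<mu>" by auto
  then show "\<nu> \<in> DD"
    using int_partition_double_partition boxes_double_partition[of \<mu>] by (auto simp: DD_def strict_partition_iff)
qed

lemma weight_double_partition: "strict_partition \<mu> \<Longrightarrow> weight (double_partition \<mu>) = 2 * sum_list \<mu>"
proof (induction \<mu>)
  case (Cons a \<mu>)
  have Suc: "sum_list (map Suc xs) = sum_list xs + length xs" for xs by (induction xs) auto
  show ?case
    using Cons length_double_partition_le[OF Cons.prems]
    by (simp add: weight_def double_partition.simps(2) Suc strict_partition_Cons sum_list_replicate)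
qed (simp add: weight_def)

text \<open>Every part of \<mu> gives one principal hook and thus one box on the diagonal.\<close>

lemma durfee_double_partition: "strict_partition \<mu> \<Longrightarrow> durfee (double_partition \<mu>) = length \<mu>"
proof (induction \<mu>)
  case Nil
  then show ?case by (simp add: durfee_def part_at_def)
next
  case (Cons a \<mu>)
  let ?D = "\<lambda>\<nu>. {i. 1 \<le> i \<and> i \<le> part_at \<nu> i}"
  have "?D (double_partition (a # \<mu>)) = insert 1 (Suc ` ?D (double_partition \<mu>))"
  proof (rule Set.set_eqI)
    fix i
    consider "i = 0" | "i = 1" | i' where "i = Suc i'" "0 < i'" "i' < a" | i' where "i = Suc i'" "0 < i'" "a \<le> i'"
    proof -
      assume *: "i = 0 \<Longrightarrow> thesis" "i = 1 \<Longrightarrow> thesis" "\<And>i'. i = Suc i' \<Longrightarrow> 0 < i' \<Longrightarrow> i' < a \<Longrightarrow> thesis"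
        "\<And>i'. i = Suc i' \<Longrightarrow> 0 < i' \<Longrightarrow> a \<le> i' \<Longrightarrow> thesis"
      have "i = 0 \<or> i = 1 \<or> (i = Suc (i - 1) \<and> 0 < i - 1 \<and> (i - 1 < a \<or> a \<le> i - 1))" by linarith
      then show thesis using * by blast
    qed
    then show "i \<in> ?D (double_partition (a # \<mu>)) \<longleftrightarrow> i \<in> insert 1 (Suc ` ?D (double_partition \<mu>))"
      using part_at_double_partition[OF Cons.prems] by cases (auto simp: image_iff)
  qed
  moreover have "finite (?D (double_partition \<mu>))"
    by (rule finite_subset[of _ "{..length (double_partition \<mu>)}"]) (auto simp: part_at_def split: if_splits)
  moreover have "1 \<notin> Suc ` ?D (double_partition \<mu>)" by auto
  ultimately show ?case
    using Cons by (simp add: durfee_def strict_partition_Cons card_image)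
qed

section \<open>Hook lengths through the Maya diagram\<close>

lemma conj_part_double_partition:
  assumes "strict_partition (a # \<mu>)"
  shows "conj_part (double_partition (a # \<mu>)) (Suc 0) = a"
    "0 < j \<Longrightarrow> j \<le> a \<Longrightarrow> conj_part (double_partition (a # \<mu>)) (Suc j) = Suc (conj_part (double_partition \<mu>) j)"
    "a < j \<Longrightarrow> conj_part (double_partition (a # \<mu>)) (Suc j) = 0"
proof -
  have a: "0 < a" using assms by (simp add: strict_partition_Cons)
  have shift: "(i, Suc j) \<in> map_prod Suc Suc ` B \<longleftrightarrow> i \<in> Suc ` {i. (i, j) \<in> B}" for i j B
    by force
  have pos: "0 < i \<and> 0 < j \<and> j \<le> a" if "(i, j) \<in> boxes (double_partition \<mu>)" for i j
    using that part_at_double_partition_le[OF assms, of i] by (auto simp: boxes_iff_part_at)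
  have "{i. (i, Suc 0) \<in> boxes (double_partition (a # \<mu>))} = {1..a}"
    using first_column_boxes[OF int_partition_double_partition[OF assms]] length_double_partition_le(2)[OF assms] by simp
  then show "conj_part (double_partition (a # \<mu>)) (Suc 0) = a"
    by (simp add: conj_part_def)
  have col: "{i. (i, Suc j) \<in> boxes (double_partition (a # \<mu>))} =
      (if j \<le> a then {1} else {}) \<union> Suc ` {i. (i, j) \<in> boxes (double_partition \<mu>)}" if "0 < j" for j
    unfolding boxes_double_partition_Cons[OF assms] using that by (auto simp: shift)
  have fin: "finite {i. (i, j) \<in> boxes (double_partition \<mu>)}" for j
    by (rule finite_subset[of _ "fst ` boxes (double_partition \<mu>)"]) (force simp: finite_boxes)+
  show "conj_part (double_partition (a # \<mu>)) (Suc j) = Suc (conj_part (double_partition \<mu>) j)" if "0 < j" "j \<le> a"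
  proof -
    have "1 \<notin> Suc ` {i. (i, j) \<in> boxes (double_partition \<mu>)}" using pos by auto
    then show ?thesis unfolding conj_part_def col[OF that(1)] using that(2) fin by (simp add: card_image)
  qed
  show "conj_part (double_partition (a # \<mu>)) (Suc j) = 0" if "a < j"
  proof -
    have "{i. (i, j) \<in> boxes (double_partition \<mu>)} = {}" using pos that by fastforce
    then show ?thesis unfolding conj_part_def using col[of j] that by simp
  qed
qed

text \<open>The first form isolates the first row or column, the second the index a. Together they
  move the largest part a from position 1 to its place in an enumeration by absolute value.\<close>

lemma prod_split_at:
  fixes F :: "nat \<Rightarrow> 'a::comm_monoid_mult"
  assumes "0 < a" "a \<le> n"
  shows "(\<Prod>i = 1..n. F i) = F 1 * (\<Prod>i = 1..<a. F (Suc i)) * (\<Prod>i = Suc a..n. F i)"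
    "(\<Prod>i = 1..n. F i) = F a * (\<Prod>i = 1..<a. F i) * (\<Prod>i = Suc a..n. F i)"
proof -
  have split: "(\<Prod>i = 1..n. F i) = (\<Prod>i = 1..<Suc a. F i) * (\<Prod>i = Suc a..n. F i)"
    using prod.atLeastLessThan_concat[of 1 "Suc a" "Suc n" F] assms by (simp add: atLeastLessThanSuc_atLeastAtMost)
  have "(\<Prod>i = 1..<Suc a. F i) = F 1 * (\<Prod>i = Suc 1..<Suc a. F i)"
    using assms by (intro prod.atLeast_Suc_lessThan) simp
  also have "(\<Prod>i = Suc 1..<Suc a. F i) = (\<Prod>i = 1..<a. F (Suc i))"
    by (rule prod.shift_bounds_Suc_ivl)
  finally show "(\<Prod>i = 1..n. F i) = F 1 * (\<Prod>i = 1..<a. F (Suc i)) * (\<Prod>i = Suc a..n. F i)"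
    unfolding split by simp
  show "(\<Prod>i = 1..n. F i) = F a * (\<Prod>i = 1..<a. F i) * (\<Prod>i = Suc a..n. F i)"
    unfolding split using assms by (simp add: mult_ac)
qed

text \<open>If lambda is the double of \<mu>, exactly one of k and - k is of the form lambda_i - i;
  this is the one.\<close>

definition signed_part :: "nat list \<Rightarrow> nat \<Rightarrow> int" where
  "signed_part \<mu> k = (if k \<in> set \<mu> then int k else - int k)"

text \<open>The Maya diagram of a doubled distinct partition is symmetric about the origin.\<close>

lemma prod_rows_double_partition:
  fixes f :: "int \<Rightarrow> 'a::comm_monoid_mult"
  assumes "strict_partition \<mu>" "\<forall>b\<in>set \<mu>. b \<le> n"
  shows "(\<Prod>i = 1..n. f (int (part_at (double_partition \<mu>) i) - int i)) = (\<Prod>k = 1..n. f (signed_part \<mu> k))"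
  using assms
proof (induction \<mu> arbitrary: n)
  case Nil
  then show ?case by (simp add: part_at_def signed_part_def)
next
  case (Cons a \<mu>)
  have a: "0 < a" "a \<le> n" "strict_partition \<mu>" and lt: "\<forall>b\<in>set \<mu>. b < a"
    using Cons.prems by (auto simp: strict_partition_Cons)
  let ?F = "\<lambda>i. f (int (part_at (double_partition (a # \<mu>)) i) - int i)"
  have "(\<Prod>i = 1..n. ?F i) = ?F 1 * (\<Prod>i = 1..<a. ?F (Suc i)) * (\<Prod>i = Suc a..n. ?F i)"
    by (rule prod_split_at(1)[OF a(1,2)])
  also have "(\<Prod>i = 1..<a. ?F (Suc i)) = (\<Prod>i = 1..<a. f (int (part_at (double_partition \<mu>) i) - int i))"
    by (intro prod.cong) (auto simp: part_at_double_partition(2)[OF Cons.prems(1)])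
  also have "\<dots> = (\<Prod>i = 1..a - 1. f (int (part_at (double_partition \<mu>) i) - int i))"
    using a by (intro prod.cong) auto
  also have "\<dots> = (\<Prod>k = 1..a - 1. f (signed_part \<mu> k))"
    using lt by (intro Cons.IH a) auto
  also have "\<dots> = (\<Prod>k = 1..<a. f (signed_part (a # \<mu>) k))"
    using a by (intro prod.cong) (auto simp: signed_part_def)
  also have "?F 1 = f (signed_part (a # \<mu>) a)"
    using part_at_double_partition(1)[OF Cons.prems(1)] by (simp add: signed_part_def)
  also have "(\<Prod>i = Suc a..n. ?F i) = (\<Prod>i = Suc a..n. f (signed_part (a # \<mu>) i))"
  proof (intro prod.cong refl)
    fix i assume i: "i \<in> {Suc a..n}"
    then have "part_at (double_partition (a # \<mu>)) i = 0"
      using part_at_double_partition(3)[OF Cons.prems(1), of "i - 1"] by auto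
    moreover have "i \<notin> set (a # \<mu>)" using i lt by auto
    ultimately show "?F i = f (signed_part (a # \<mu>) i)" by (simp add: signed_part_def)
  qed
  finally show ?case
    using prod_split_at(2)[OF a(1,2), of "\<lambda>k. f (signed_part (a # \<mu>) k)"] by simp
qed

text \<open>Removing the first hook leaves the values of the columns inside it unchanged, and column
  1 has the value a, as row 1 has. The additional value 0 is that of the first column of the empty
  partition, where the induction starts.\<close>

lemma prod_columns_double_partition:
  fixes f :: "int \<Rightarrow> 'a::comm_monoid_mult"
  assumes "strict_partition \<mu>" "\<forall>b\<in>set \<mu>. b \<le> n"
  shows "(\<Prod>j = 1..Suc n. f (int (conj_part (double_partition \<mu>) j) - int j + 1)) =
    f 0 * (\<Prod>k = 1..n. f (signed_part \<mu> k))"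
  using assms
proof (induction \<mu> arbitrary: n)
  case Nil
  have "(\<Prod>j = 1..Suc n. f (1 - int j)) = f 0 * (\<Prod>k = 1..n. f (- int k))"
    by (subst prod.atLeast_Suc_atMost) (auto simp: prod.atLeast_Suc_atMost_Suc_shift simp del: prod.cl_ivl_Suc)
  then show ?case by (simp add: conj_part_def boxes_Nil signed_part_def del: prod.cl_ivl_Suc)
next
  case (Cons a \<mu>)
  have a: "0 < a" "a \<le> n" "strict_partition \<mu>" and lt: "\<forall>b\<in>set \<mu>. b < a"
    using Cons.prems by (auto simp: strict_partition_Cons)
  let ?F = "\<lambda>i. f (int (conj_part (double_partition (a # \<mu>)) i) - int i + 1)"
  have "(\<Prod>i = 1..Suc n. ?F i) = ?F 1 * (\<Prod>i = 1..<Suc a. ?F (Suc i)) * (\<Prod>i = Suc (Suc a)..Suc n. ?F i)"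
    using a by (intro prod_split_at(1)) auto
  also have "(\<Prod>i = 1..<Suc a. ?F (Suc i)) = (\<Prod>i = 1..<Suc a. f (int (conj_part (double_partition \<mu>) i) - int i + 1))"
    by (intro prod.cong) (auto simp: conj_part_double_partition(2)[OF Cons.prems(1)])
  also have "\<dots> = (\<Prod>i = 1..Suc (a - 1). f (int (conj_part (double_partition \<mu>) i) - int i + 1))"
    using a by (intro prod.cong) auto
  also have "\<dots> = f 0 * (\<Prod>k = 1..a - 1. f (signed_part \<mu> k))"
    using lt by (intro Cons.IH a) auto
  also have "(\<Prod>k = 1..a - 1. f (signed_part \<mu> k)) = (\<Prod>k = 1..<a. f (signed_part (a # \<mu>) k))"
    using a by (intro prod.cong) (auto simp: signed_part_def)
  also have "?F 1 = f (signed_part (a # \<mu>) a)"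
    using conj_part_double_partition(1)[OF Cons.prems(1)] by (simp add: signed_part_def)
  also have "(\<Prod>i = Suc (Suc a)..Suc n. ?F i) = (\<Prod>i = Suc a..n. ?F (Suc i))"
    by (rule prod.shift_bounds_cl_Suc_ivl)
  also have "\<dots> = (\<Prod>i = Suc a..n. f (signed_part (a # \<mu>) i))"
  proof (intro prod.cong refl)
    fix i assume i: "i \<in> {Suc a..n}"
    then have "conj_part (double_partition (a # \<mu>)) (Suc i) = 0"
      using conj_part_double_partition(3)[OF Cons.prems(1), of i] by auto
    moreover have "i \<notin> set (a # \<mu>)" using i lt by auto
    ultimately show "?F (Suc i) = f (signed_part (a # \<mu>) i)" by (simp add: signed_part_def)
  qed
  finally show ?case
    using prod_split_at(2)[OF a(1,2), of "\<lambda>k. f (signed_part (a # \<mu>) k)"] by (simp add: mult_ac)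
qed

definition hook_product :: "complex \<Rightarrow> nat list \<Rightarrow> complex" where
  "hook_product z \<nu> = (\<Prod>b\<in>boxes \<nu>. 1 - z / (of_int (hook_length \<nu> b) * of_int (hook_sign b)))"

text \<open>The hook lengths in the first row are a + v, with v running through 0, a and the signed
  parts of \<mu> for k < a; those in the first column above the corner are a + v for the same signed
  parts. As the sign is negative above the diagonal, the factors 1 - z/u and 1 + z/u pair up. The
  unpaired boxes have hook lengths a and 2 a. Boxes inside the hook keep their hook length and their
  sign.\<close>

lemma hook_product_Cons:
  assumes str: "strict_partition (a # \<mu>)"
  shows "hook_product z (double_partition (a # \<mu>)) =
    (1 - z / of_nat a) * (1 - z / (2 * of_nat a)) *
    (\<Prod>k = 1..<a. (1 - z / of_int (int a + signed_part \<mu> k)) * (1 + z / of_int (int a + signed_part \<mu> k))) *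
    hook_product z (double_partition \<mu>)"
proof -
  let ?\<nu> = "double_partition (a # \<mu>)" and ?\<nu>' = "double_partition \<mu>"
  have a: "0 < a" "strict_partition \<mu>" and lt: "\<forall>b\<in>set \<mu>. b < a"
    using str by (auto simp: strict_partition_Cons)
  define t where "t = (\<lambda>b. 1 - z / (of_int (hook_length ?\<nu> b) * of_int (hook_sign b)))"
  define f where "f = (\<lambda>v. 1 - z / of_int (int a + v))"
  define g where "g = (\<lambda>v. 1 + z / of_int (int a + v))"
  have "hook_product z ?\<nu> = prod t (Pair 1 ` {1..Suc a}) * prod t ((\<lambda>i. (Suc i, 1)) ` {1..<a}) *
      prod t (map_prod Suc Suc ` boxes ?\<nu>')"
  proof -
    have "(Pair 1 ` {1..Suc a} \<union> (\<lambda>i. (Suc i, 1)) ` {1..<a}) \<inter> map_prod Suc Suc ` boxes ?\<nu>' = {}"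
      by (auto simp: boxes_def)
    moreover have "Pair 1 ` {1..Suc a} \<inter> (\<lambda>i. (Suc i, 1)) ` {1..<a} = {}" by auto
    ultimately show ?thesis
      unfolding hook_product_def boxes_double_partition_Cons[OF str] t_def[symmetric]
      by (simp add: prod.union_disjoint finite_boxes)
  qed
  also have "prod t (map_prod Suc Suc ` boxes ?\<nu>') = hook_product z ?\<nu>'"
  proof -
    have "prod t (map_prod Suc Suc ` boxes ?\<nu>') = (\<Prod>b\<in>boxes ?\<nu>'. t (map_prod Suc Suc b))"
      by (subst prod.reindex) (auto simp: inj_on_def)
    also have "\<dots> = hook_product z ?\<nu>'"
      unfolding hook_product_def
      proof (rule prod.cong, goal_cases)
        case (2 b)
        obtain i j where b: "b = (i, j)" by (cases b)
        have ij: "0 < i" "0 < j" "j \<le> part_at ?\<nu>' i" using 2 by (auto simp: b boxes_iff_part_at)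
        then have "i < a" using part_at_double_partition(4)[OF str, of i] by (cases "i < a") auto
        moreover have "j \<le> a" using part_at_double_partition_le[OF str, of i] ij by simp
        ultimately have "hook_length ?\<nu> (Suc i, Suc j) = hook_length ?\<nu>' (i, j)"
          using part_at_double_partition(2)[OF str, of i] conj_part_double_partition(2)[OF str, of j] ij
          by (simp add: hook_length_def)
        then show ?case by (simp add: t_def b hook_sign_def)
      qed simp
    finally show ?thesis .
  qed
  also have "prod t (Pair 1 ` {1..Suc a}) = (\<Prod>j = 1..Suc a. f (int (conj_part ?\<nu> j) - int j + 1))"
    using part_at_double_partition(1)[OF str]
    by (subst prod.reindex) (auto simp: inj_on_def t_def f_def hook_length_def hook_sign_def algebra_simps intro!: prod.cong
        simp del: prod.cl_ivl_Suc)
  also have "\<dots> = f 0 * (\<Prod>k = 1..a. f (signed_part (a # \<mu>) k))"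
    using lt by (intro prod_columns_double_partition[OF str]) auto
  also have "(\<Prod>k = 1..a. f (signed_part (a # \<mu>) k)) = f (int a) * (\<Prod>k = 1..<a. f (signed_part \<mu> k))"
    using prod_split_at(2)[of a a "\<lambda>k. f (signed_part (a # \<mu>) k)"] a(1) by (simp add: signed_part_def)
  also have "prod t ((\<lambda>i. (Suc i, 1)) ` {1..<a}) = (\<Prod>i = 1..<a. g (int (part_at ?\<nu>' i) - int i))"
  proof -
    have "t (Suc i, 1) = g (int (part_at ?\<nu>' i) - int i)" if "i \<in> {1..<a}" for i
    proof -
      have "hook_length ?\<nu> (Suc i, 1) = int a + (int (part_at ?\<nu>' i) - int i)"
        using part_at_double_partition(2)[OF str, of i] conj_part_double_partition(1)[OF str] that
        by (simp add: hook_length_def)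
      moreover have "hook_sign (Suc i, 1) = -1" using that by (simp add: hook_sign_def)
      moreover have "1 - z / (of_int h * of_int (-1)) = 1 + z / of_int h" for h :: int
        by simp
      ultimately show ?thesis unfolding t_def g_def by (simp only:)
    qed
    then show ?thesis by (subst prod.reindex) (auto simp: inj_on_def intro!: prod.cong)
  qed
  also have "\<dots> = (\<Prod>i = 1..a - 1. g (int (part_at ?\<nu>' i) - int i))"
    using a by (intro prod.cong) auto
  also have "\<dots> = (\<Prod>k = 1..a - 1. g (signed_part \<mu> k))"
    using lt by (intro prod_rows_double_partition a) auto
  also have "\<dots> = (\<Prod>k = 1..<a. g (signed_part \<mu> k))"
    using a by (intro prod.cong) auto
  finally show ?thesis
    unfolding f_def g_def prod.distrib by (simp add: mult_ac)
qed

text \<open>The right side is the hook product for the single part a. The left side telescopes: from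
  s to s + 1 the product of the two binomial coefficients with the factor s grows by (s + z)(s + 1 -
  z) / (s (s + 1)).\<close>

lemma hook_entry_diag:
  assumes z: "z \<notin> \<int>" and "0 < a"
  shows "hook_entry z a a = (1 - z / of_nat a) * (1 - z / (2 * of_nat a)) * (\<Prod>k = 1..<a. 1 - z\<^sup>2 / of_nat k ^ 2)"
proof -
  have z0: "z \<noteq> 0" using z by auto
  let ?c = "\<lambda>a. fps_nth (binomial_fps (- z)) a * (of_nat a * fps_nth (binomial_fps (z - 1)) a)"
  have "?c (Suc a) = z * (1 - z / of_nat (Suc a)) * (\<Prod>k = 1..<Suc a. 1 - z\<^sup>2 / of_nat k ^ 2)" for a
  proof (induction a)
    case 0
    show ?case using binomial_fps_Suc[of "- z" 0] binomial_fps_Suc[of "z - 1" 0] by simp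
  next
    case (Suc a)
    define s where "s = (of_nat (Suc a) :: complex)"
    have s: "s \<noteq> 0" "s + 1 \<noteq> 0" unfolding s_def by (metis of_nat_Suc of_nat_neq_0 add.commute)+
    have "?c (Suc (Suc a)) = ?c (Suc a) * ((s + z) * (s + 1 - z) / (s * (s + 1)))"
    proof -
      have "of_nat (Suc (Suc a)) = s + 1" "s - (z - 1) = s + 1 - z" "s - - z = s + z" by (simp_all add: s_def)
      moreover have "p * (s + z) / (s + 1) * ((s + 1) * (q * (s + 1 - z) / (s + 1))) =
          p * (s * q) * ((s + z) * (s + 1 - z) / (s * (s + 1)))" for p q
        using s by simp
      ultimately show ?thesis
        by (simp only: binomial_fps_Suc[of _ "Suc a"] s_def[symmetric])
    qed
    also have "\<dots> = z * (1 - z / (s + 1)) * ((\<Prod>k = 1..<Suc a. 1 - z\<^sup>2 / of_nat k ^ 2) * (1 - z\<^sup>2 / s ^ 2))"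
    proof -
      have "(1 - z / s) * ((s + z) * (s + 1 - z) / (s * (s + 1))) = (1 - z / (s + 1)) * (1 - z\<^sup>2 / s ^ 2)"
        using s by (simp add: divide_simps power2_eq_square) (simp add: algebra_simps)
      then have "z * (1 - z / s) * R * ((s + z) * (s + 1 - z) / (s * (s + 1))) =
          z * (1 - z / (s + 1)) * (R * (1 - z\<^sup>2 / s ^ 2))" for R
      proof -
        assume W: "(1 - z / s) * ((s + z) * (s + 1 - z) / (s * (s + 1))) = (1 - z / (s + 1)) * (1 - z\<^sup>2 / s ^ 2)"
        have "z * (1 - z / s) * R * ((s + z) * (s + 1 - z) / (s * (s + 1))) =
            z * R * ((1 - z / s) * ((s + z) * (s + 1 - z) / (s * (s + 1))))"
          by (simp only: mult_ac)
        also have "\<dots> = z * (1 - z / (s + 1)) * (R * (1 - z\<^sup>2 / s ^ 2))"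
          unfolding W by (simp only: mult_ac)
        finally show ?thesis .
      qed
      then show ?thesis unfolding Suc.IH unfolding s_def[symmetric] .
    qed
    finally show ?case by (simp add: s_def add.commute)
  qed
  from this[of "a - 1"] have c: "?c a = z * (1 - z / of_nat a) * (\<Prod>k = 1..<a. 1 - z\<^sup>2 / of_nat k ^ 2)"
    using \<open>0 < a\<close> by simp
  have "hook_entry z a a = ?c a * ((2 * of_nat a - z) / (2 * of_nat a * z))"
    by (simp add: hook_entry_def)
  also have "(2 * of_nat a - z) / (2 * of_nat a * z) = (1 - z / (2 * of_nat a)) / z"
    using \<open>0 < a\<close> z0 by (simp add: divide_simps)
  finally show ?thesis unfolding c using z0 by simp
qed

text \<open>Both sides are recursive in the largest part a. A smaller part k puts a + k in the place
  of a - k, and the quotient of 1 - z^2/(a+k)^2 by 1 - z^2/(a-k)^2 is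
  \<open>pair_weight z a k\<close>.\<close>

lemma hook_product_eq_det:
  assumes z: "z \<notin> \<int>" and str: "strict_partition \<mu>"
  shows "hook_product z (double_partition \<mu>) = Determinant.det (list_mat (hook_entry z) \<mu>)"
  using str
proof (induction \<mu>)
  case Nil
  then show ?case by (simp add: hook_product_def boxes_Nil list_mat_def)
next
  case (Cons a \<mu>)
  have a: "0 < a" "strict_partition \<mu>" and lt: "\<forall>b\<in>set \<mu>. 0 < b \<and> b < a"
    using Cons.prems by (auto simp: strict_partition_def)
  have dist: "distinct \<mu>" using a(2) by (simp add: strict_partition_iff)
  have nz: "1 - z\<^sup>2 / (of_nat k) ^ 2 \<noteq> 0" if "0 < k" for k
  proof
    assume "1 - z\<^sup>2 / (of_nat k) ^ 2 = 0"
    then have "(of_nat k - z) * (of_nat k + z) = 0"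
      using that by (simp add: divide_simps power2_eq_square algebra_simps split: if_splits)
    then show False using nonint_nonzero(1,4)[OF z, of k] by simp
  qed
  let ?g = "\<lambda>k. (1 - z / of_int (int a + signed_part \<mu> k)) * (1 + z / of_int (int a + signed_part \<mu> k))"
  have g: "?g k = (1 - z\<^sup>2 / of_nat (a - k) ^ 2) * (if k \<in> set \<mu> then pair_weight z a k else 1)" if k: "k \<in> {1..<a}" for k
  proof -
    have sq: "(1 - z / u) * (1 + z / u) = 1 - z\<^sup>2 / u ^ 2" for u :: complex
      by (simp add: power2_eq_square algebra_simps)
    show ?thesis
    proof (cases "k \<in> set \<mu>")
      case True
      have ak: "of_nat a + of_nat k \<noteq> (0::complex)" "of_nat a - of_nat k \<noteq> (0::complex)"
        using k by (metis add_is_0 atLeastLessThan_iff not_one_le_zero of_nat_add of_nat_eq_0_iff, auto)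
      have "of_nat (a - k) = (of_nat a - of_nat k :: complex)" using k by (simp add: of_nat_diff)
      then have nz': "1 - z\<^sup>2 / (of_nat a - of_nat k) ^ 2 \<noteq> 0" using nz[of "a - k"] k by auto
      have "pair_weight z a k = (1 - z\<^sup>2 / (of_nat a + of_nat k) ^ 2) / (1 - z\<^sup>2 / (of_nat a - of_nat k) ^ 2)"
      proof -
        have frac: "1 - z\<^sup>2 / u ^ 2 = (u ^ 2 - z ^ 2) / u ^ 2" if "u \<noteq> 0" for u :: complex
          using that by (simp add: divide_simps)
        show ?thesis unfolding frac[OF ak(1)] frac[OF ak(2)] pair_weight_def by (simp add: mult_ac)
      qed
      then have "pair_weight z a k * (1 - z\<^sup>2 / of_nat (a - k) ^ 2) = 1 - z\<^sup>2 / (of_nat a + of_nat k) ^ 2"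
        using nz' k by (simp add: of_nat_diff)
      then show ?thesis using True unfolding sq by (simp add: signed_part_def mult.commute)
    next
      case False
      then show ?thesis using k unfolding sq by (simp add: signed_part_def of_nat_diff)
    qed
  qed
  have "(\<Prod>k = 1..<a. ?g k) = (\<Prod>k = 1..<a. 1 - z\<^sup>2 / of_nat (a - k) ^ 2) *
      (\<Prod>k = 1..<a. if k \<in> set \<mu> then pair_weight z a k else 1)"
    unfolding prod.distrib[symmetric] by (intro prod.cong refl g)
  also have "(\<Prod>k = 1..<a. 1 - z\<^sup>2 / of_nat (a - k) ^ 2) = (\<Prod>k = 1..<a. 1 - z\<^sup>2 / of_nat k ^ 2)"
    by (rule prod.reindex_bij_witness[of _ "\<lambda>k. a - k" "\<lambda>k. a - k"]) auto
  also have "(\<Prod>k = 1..<a. if k \<in> set \<mu> then pair_weight z a k else 1) = (\<Prod>k\<in>set \<mu>. pair_weight z a k)"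
    using lt by (subst prod.inter_filter[symmetric]) (auto intro!: prod.cong)
  also have "\<dots> = prod_list (map (pair_weight z a) \<mu>)"
    by (rule prod.distinct_set_conv_list[OF dist])
  finally have G: "(\<Prod>k = 1..<a. ?g k) = (\<Prod>k = 1..<a. 1 - z\<^sup>2 / of_nat k ^ 2) * prod_list (map (pair_weight z a) \<mu>)" .
  show ?case
    unfolding hook_product_Cons[OF Cons.prems] G Cons.IH[OF a(2)]
    by (subst det_hook_entry_Cons[OF z a(1)]) (use lt in \<open>auto simp: hook_entry_diag[OF z a(1)] mult_ac\<close>)
qed

section \<open>Strict partitions as sublists, and the coefficients of the determinant\<close>

definition strict_partitions :: "nat \<Rightarrow> nat list set" where
  "strict_partitions n = {\<mu>. strict_partition \<mu> \<and> sum_list \<mu> = n}"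

lemma DD_weight_eq:
  "{\<nu>. \<nu> \<in> DD \<and> weight \<nu> = 2 * n} = double_partition ` strict_partitions n"
  by (auto simp: DD_eq strict_partitions_def weight_double_partition)

lemma set_subseq_subset: "subseq xs ys \<Longrightarrow> set xs \<subseteq> set ys"
  by (induction rule: list_emb.induct) auto

lemma sorted_wrt_subseq: "subseq xs ys \<Longrightarrow> sorted_wrt P ys \<Longrightarrow> sorted_wrt P xs"
proof (induction rule: list_emb.induct)
  case (list_emb_Cons2 x y xs ys)
  then show ?case using set_subseq_subset[of xs ys] by auto
qed auto

lemma subseqs_strict_partitions:
  assumes "m \<le> n"
  shows "{s \<in> set (subseqs (rev [1..<Suc n])). sum_list s = m} = strict_partitions m"
proof (rule Set.set_eqI, rule iffI)
  fix s assume "s \<in> {s \<in> set (subseqs (rev [1..<Suc n])). sum_list s = m}"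
  then have s: "subseq s (rev [1..<Suc n])" "sum_list s = m" by auto
  have "sorted_wrt (>) (rev [1..<Suc n])"
    by (simp add: sorted_wrt_rev del: upt_Suc)
  then have "sorted_wrt (>) s"
    by (rule sorted_wrt_subseq[OF s(1)])
  moreover have "\<forall>p\<in>set s. 0 < p"
    using set_subseq_subset[OF s(1)] by (auto simp del: upt_Suc)
  ultimately show "s \<in> strict_partitions m" using s by (simp add: strict_partitions_def strict_partition_def)
next
  fix s assume "s \<in> strict_partitions m"
  then have s: "sorted_wrt (>) s" "\<forall>p\<in>set s. 0 < p" "sum_list s = m"
    by (auto simp: strict_partitions_def strict_partition_def)
  have "set s \<subseteq> set (rev [1..<Suc n])"
    using s(2,3) assms member_le_sum_list[of _ s] by (force simp: less_Suc_eq_le simp del: upt_Suc)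
  then obtain s' where s': "s' \<in> set (subseqs (rev [1..<Suc n]))" "set s = set s'"
    using subset_subseqs by (metis imageE)
  have "sorted_wrt (>) (rev [1..<Suc n])"
    by (simp add: sorted_wrt_rev del: upt_Suc)
  then have "sorted_wrt (>) s'"
    using s'(1) sorted_wrt_subseq unfolding in_set_subseqs by blast
  then have "sorted_wrt (<) (rev s')" "sorted_wrt (<) (rev s)"
    using s(1) by (simp_all add: sorted_wrt_rev)
  then have "rev s = rev s'" using s'(2) by (intro strict_sorted_equal) auto
  then show "s \<in> {s \<in> set (subseqs (rev [1..<Suc n])). sum_list s = m}" using s' s by simp
qed

text \<open>A strict partition of m has no part above m, so for m <= n the truncation to size n
  already has the complete coefficient of x^m.\<close>

lemma det_hook_mat_nth:
  fixes M :: "nat \<Rightarrow> nat \<Rightarrow> complex"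
  assumes "m \<le> n"
  shows "fps_nth (Determinant.det (hook_mat fps_X (\<lambda>k b. fps_const (M k b)) n)) m =
    (\<Sum>\<mu>\<in>strict_partitions m. (-1) ^ length \<mu> * Determinant.det (list_mat M \<mu>))"
proof -
  let ?S = "set (subseqs (rev [1..<Suc n]))"
  have dist: "distinct (subseqs (rev [1..<Suc n]))"
    using distinct_set_subseqs[of "rev [1..<Suc n]"] by (auto simp: distinct_map simp del: upt_Suc)
  have const: "Determinant.det (list_mat (\<lambda>k b. fps_const (M k b)) s) = fps_const (Determinant.det (list_mat M s))" for s
  proof -
    have prod: "(\<Prod>i\<in>A. fps_const (f i)) = fps_const (\<Prod>i\<in>A. f i)" for f :: "nat \<Rightarrow> complex" and A
      by (induction A rule: infinite_finite_induct) auto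
    have sum: "(\<Sum>i\<in>A. fps_const (f i)) = fps_const (\<Sum>i\<in>A. f i)" for f :: "(nat \<Rightarrow> nat) \<Rightarrow> complex" and A
      by (induction A rule: infinite_finite_induct) auto
    have sgn: "signof p * fps_const c = fps_const (signof p * c)" for p and c :: complex
      by (simp add: sign_def)
    have "(\<Prod>i = 0..<length s. list_mat (\<lambda>k b. fps_const (M k b)) s $$ (i, p i)) =
        fps_const (\<Prod>i = 0..<length s. list_mat M s $$ (i, p i))" if "p permutes {0..<length s}" for p
      unfolding prod[symmetric] using permutes_lessThan_less[OF that] by (intro prod.cong) (auto simp: list_mat_def)
    then show ?thesis
      unfolding det_def'[OF list_mat_carrier] by (simp add: sgn sum)
  qed
  have "fps_nth (Determinant.det (hook_mat fps_X (\<lambda>k b. fps_const (M k b)) n)) m =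
      (\<Sum>s\<in>?S. fps_nth ((-1) ^ length s * fps_X ^ sum_list s * fps_const (Determinant.det (list_mat M s))) m)"
    unfolding det_hook_mat_minors const sum_list_distinct_conv_sum_set[OF dist] fps_sum_nth ..
  also have "\<dots> = (\<Sum>s\<in>?S. if sum_list s = m then (-1) ^ length s * Determinant.det (list_mat M s) else 0)"
  proof (rule sum.cong)
    fix s :: "nat list"
    have "(-1 :: complex fps) ^ length s = fps_const ((-1) ^ length s)"
      by (cases "even (length s)") auto
    then show "fps_nth ((-1) ^ length s * fps_X ^ sum_list s * fps_const (Determinant.det (list_mat M s))) m =
        (if sum_list s = m then (-1) ^ length s * Determinant.det (list_mat M s) else 0)"
      by (simp only: fps_mult_left_const_nth fps_mult_right_const_nth fps_X_power_nth) simp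
  qed simp
  also have "\<dots> = (\<Sum>\<mu>\<in>{s \<in> ?S. sum_list s = m}. (-1) ^ length \<mu> * Determinant.det (list_mat M \<mu>))"
    by (rule sum.inter_filter[symmetric]) simp
  finally show ?thesis unfolding subseqs_strict_partitions[OF assms] .
qed

section \<open>The Euler product\<close>

text \<open>The logarithm of the product of all 1 - x^k, where m + 1 is the exponent in the
  logarithm series of a single factor. The condition 0 < n is there because every number divides 0.
  Formal powers of the product become \<open>fps_exp a oo euler_log\<close>.\<close>

definition euler_log :: "complex fps" where
  "euler_log = Abs_fps (\<lambda>n. - (\<Sum>m | 0 < n \<and> Suc m dvd n. 1 / of_nat (Suc m)))"

lemma euler_log_nth_0 [simp]: "fps_nth euler_log 0 = 0"
  by (simp add: euler_log_def)

lemma fps_exp_compose_ln: "fps_exp 1 oo fps_ln 1 = 1 + (fps_X :: complex fps)"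
proof -
  have "(fps_exp 1 - 1) oo fps_ln 1 = (fps_X :: complex fps)"
    using fps_inv_fps_exp_compose(2)[of "1 :: complex"] by (simp add: fps_ln_fps_exp_inv)
  then show ?thesis by (simp add: fps_compose_sub_distrib diff_eq_eq add.commute)
qed

definition log_one_minus :: "nat \<Rightarrow> complex fps" where
  "log_one_minus k = fps_ln 1 oo (- (fps_X ^ k))"

lemma fps_exp_log_one_minus: "0 < k \<Longrightarrow> fps_exp 1 oo log_one_minus k = 1 - fps_X ^ k"
  unfolding log_one_minus_def
  by (subst fps_compose_assoc) (simp_all add: fps_exp_compose_ln fps_compose_add_distrib)

lemma log_one_minus_nth:
  assumes "0 < k" "0 < n"
  shows "fps_nth (log_one_minus k) n = (if k dvd n then - (of_nat k / of_nat n) else 0)"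
proof -
  have pow: "fps_nth ((- (fps_X ^ k)) ^ i) n = (if n = k * i then (-1) ^ i else 0 :: complex)" for i
  proof -
    have "(- (fps_X ^ k)) ^ i = fps_const ((-1) ^ i) * (fps_X :: complex fps) ^ (k * i)"
      by (cases "even i") (simp_all add: power_mult)
    then show ?thesis by (simp only: fps_mult_left_const_nth fps_X_power_nth) simp
  qed
  show ?thesis
  proof (cases "k dvd n")
    case True
    then obtain i where i: "n = k * i" by auto
    then have i0: "0 < i" using assms by auto
    have "fps_nth (log_one_minus k) n = (\<Sum>j = 0..n. if j = i then fps_nth (fps_ln 1) i * (-1) ^ i else 0)"
      unfolding log_one_minus_def fps_compose_nth pow using assms i by (intro sum.cong) auto
    also have "\<dots> = fps_nth (fps_ln 1) i * (-1) ^ i"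
      using i assms by simp
    also have "\<dots> = - (1 / of_nat i)"
      using i0 by (cases i) (simp_all add: fps_ln_nth field_simps flip: power_add mult_2)
    also have "\<dots> = - (of_nat k / of_nat n)" using assms i by simp
    finally show ?thesis using True by simp
  next
    case False
    then have "fps_nth (log_one_minus k) n = 0"
      unfolding log_one_minus_def fps_compose_nth pow by (intro sum.neutral) auto
    then show ?thesis using False by simp
  qed
qed

lemma log_one_minus_nth_0 [simp]: "0 < k \<Longrightarrow> fps_nth (log_one_minus k) 0 = 0"
  by (simp add: log_one_minus_def)

lemma euler_log_nth:
  assumes "n \<le> N"
  shows "fps_nth euler_log n = (\<Sum>k = 1..N. fps_nth (log_one_minus k) n)"
proof (cases "n = 0")
  case False
  have "(\<Sum>k = 1..N. fps_nth (log_one_minus k) n) = (\<Sum>k = 1..N. if k dvd n then - (of_nat k / of_nat n) else 0)"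
    using False by (intro sum.cong) (auto simp: log_one_minus_nth)
  also have "\<dots> = (\<Sum>k | k \<in> {1..N} \<and> k dvd n. - (of_nat k / of_nat n))"
    by (rule sum.inter_filter[symmetric]) simp
  also have "\<dots> = (\<Sum>m | 0 < n \<and> Suc m dvd n. - (1 / of_nat (Suc m)))"
  \<comment> \<open>Complementary divisors: k (m + 1) = n, so k / n = 1 / (m + 1).\<close>
  proof (rule sum.reindex_bij_witness[of _ "\<lambda>m. n div Suc m" "\<lambda>k. n div k - 1"], goal_cases)
    case (1 k)
    then obtain j where "n = k * j" "0 < j" "0 < k" using False by auto
    then show ?case by simp
  next
    case (2 k)
    then show ?case using False by (auto elim!: dvdE)
  next
    case (3 m)
    then obtain j where "n = Suc m * j" "0 < j" by (auto elim!: dvdE)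
    moreover have "Suc m * j div Suc m = j" "Suc m * j div j = Suc m" if "0 < j"
      using that by (simp_all del: mult_Suc)
    ultimately show ?case by simp
  next
    case (4 m)
    then obtain j where j: "n = Suc m * j" "0 < j" by (auto elim!: dvdE)
    moreover have "Suc m * j div Suc m = j" by (simp del: mult_Suc)
    moreover have "j \<le> n" using j by simp
    ultimately show ?case using assms by auto
  next
    case (5 k)
    then obtain j where j: "n = k * j" "0 < j" "0 < k" using False by auto
    then have "Suc (n div k - 1) = j" by simp
    moreover have "of_nat k / of_nat n = (1 / of_nat j :: complex)" using j by simp
    ultimately show ?case by simp
  qed
  finally show ?thesis by (simp add: euler_log_def sum_negf)
qed simp

text \<open>The logarithmic derivatives of P = exp A exp B and R = exp (- (A + B)) are opposite, so
  P R is constant, hence 1; and R is inverse to exp (A + B) too.\<close>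

lemma fps_exp_compose_add:
  fixes A B :: "complex fps"
  assumes A: "fps_nth A 0 = 0" and B: "fps_nth B 0 = 0"
  shows "fps_exp 1 oo (A + B) = (fps_exp 1 oo A) * (fps_exp 1 oo B)"
proof -
  have AB: "fps_nth (A + B) 0 = 0" using A B by simp
  define P where "P = (fps_exp 1 oo A) * (fps_exp 1 oo B)"
  define R where "R = fps_exp (-1) oo (A + B)"
  have "(fps_exp 1 oo (A + B)) * R = (fps_exp 1 * fps_exp (-1)) oo (A + B)"
    unfolding R_def using AB by (simp add: fps_compose_mult_distrib)
  then have QR: "(fps_exp 1 oo (A + B)) * R = 1"
    by (simp flip: fps_exp_add_mult)
  have dP: "fps_deriv P = (fps_deriv A + fps_deriv B) * P"
    unfolding P_def using A B by (simp add: fps_compose_deriv algebra_simps)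
  have dR: "fps_deriv R = - (fps_deriv A + fps_deriv B) * R"
  proof -
    have "fps_deriv (fps_exp (-1) :: complex fps) = - fps_exp (-1)"
      by (simp add: fps_eq_iff)
    then show ?thesis
      unfolding R_def using AB by (simp add: fps_compose_deriv fps_compose_uminus algebra_simps)
  qed
  have "fps_deriv (P * R) = 0"
    by (simp add: dP dR algebra_simps)
  then have "P * R = fps_const (fps_nth (P * R) 0)"
    by (simp only: fps_deriv_eq_0_iff)
  then have "P * R = 1" by (simp add: P_def R_def)
  then have "P * (R * (fps_exp 1 oo (A + B))) = fps_exp 1 oo (A + B)"
    by (simp flip: mult.assoc)
  moreover have "R * (fps_exp 1 oo (A + B)) = 1" using QR by (simp add: mult.commute)
  ultimately have "P = fps_exp 1 oo (A + B)" by (simp only: mult_1_right)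
  then show ?thesis by (simp add: P_def)
qed

lemma fps_X_power_dvdI:
  assumes "\<And>n. n < N \<Longrightarrow> fps_nth f n = 0"
  shows "fps_X ^ N dvd (f :: complex fps)"
proof -
  have "f = fps_X ^ N * Abs_fps (\<lambda>i. fps_nth f (i + N))"
    using assms by (intro fps_ext) (simp add: fps_X_power_mult_nth)
  then show ?thesis by (metis dvd_triv_left)
qed

lemma fps_exp_euler_log:
  "fps_X ^ Suc N dvd (fps_exp 1 oo euler_log) - (\<Prod>k = 1..N. 1 - fps_X ^ k)"
proof -
  define LN where "LN = (\<Sum>k = 1..N. log_one_minus k)"
  have "fps_X ^ Suc N dvd euler_log - LN"
  proof -
    have "fps_nth (euler_log - LN) n = 0" if "n < Suc N" for n
      using that euler_log_nth[of n N] by (simp add: LN_def fps_sum_nth)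
    then show ?thesis by (rule fps_X_power_dvdI)
  qed
  then have pow: "fps_X ^ Suc N dvd euler_log ^ i - LN ^ i" for i
    by (rule power_diff_dvd)
  have "fps_nth (euler_log ^ i) n = fps_nth (LN ^ i) n" if "n \<le> N" for i n
  proof -
    obtain h where "euler_log ^ i - LN ^ i = fps_X ^ Suc N * h" using pow by auto
    then have "fps_nth (euler_log ^ i - LN ^ i) n = 0" using that by (simp add: fps_X_power_mult_nth del: power_Suc)
    then show ?thesis by simp
  qed
  then have "fps_nth (fps_exp 1 oo euler_log) n = fps_nth (fps_exp 1 oo LN) n" if "n < Suc N" for n
    using that unfolding fps_compose_nth by simp
  then have "fps_X ^ Suc N dvd (fps_exp 1 oo euler_log) - (fps_exp 1 oo LN)"
    by (intro fps_X_power_dvdI) simp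
  moreover have "fps_exp 1 oo LN = (\<Prod>k = 1..N. 1 - fps_X ^ k)"
  proof -
    have "fps_exp 1 oo (\<Sum>k = 1..M. log_one_minus k) = (\<Prod>k = 1..M. 1 - fps_X ^ k)" for M
    proof (induction M)
      case (Suc M)
      have "fps_nth (\<Sum>k = 1..M. log_one_minus k) 0 = 0"
        by (simp add: fps_sum_nth)
      then show ?case using Suc by (simp add: fps_exp_compose_add fps_exp_log_one_minus mult.commute)
    qed simp
    then show ?thesis by (simp add: LN_def)
  qed
  ultimately show ?thesis by simp
qed

text \<open>The double series of x^((k+1)(m+1)) / (m + 1) converges absolutely, dominated by a
  product of geometric series. Summation over m gives the logarithm of each factor; grouping by n =
  (k+1)(m+1) gives the power series.\<close>

lemma euler_log_sums:
  fixes x :: complex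
  assumes x: "norm x < 1"
  obtains S where "(\<lambda>n. fps_nth euler_log n * x ^ n) sums (- S)"
    and "(\<lambda>k. \<Sum>m. (x ^ Suc k) ^ Suc m / of_nat (Suc m)) sums S"
proof -
  define g where "g = (\<lambda>(k, m). (x ^ Suc k) ^ Suc m / of_nat (Suc m) :: complex)"
  let ?r = "norm x"
  have bound: "norm (g (k, m)) \<le> ?r ^ k * ?r ^ m" for k m
  proof -
    have "norm (g (k, m)) = ?r ^ (Suc k * Suc m) / of_nat (Suc m)"
      by (simp add: g_def norm_divide norm_power norm_mult power_mult del: of_nat_Suc power_Suc mult_Suc mult_Suc_right)
    also have "\<dots> \<le> ?r ^ (Suc k * Suc m) / 1"
      by (intro divide_left_mono) auto
    also have "\<dots> \<le> ?r ^ (k + m) / 1"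
      using x by (intro divide_right_mono power_decreasing) auto
    finally show ?thesis by (simp add: power_add)
  qed
  have geo: "summable (\<lambda>m. c * ?r ^ m)" for c
    using x by (intro summable_mult summable_geometric) simp
  have inner: "summable (\<lambda>m. norm (g (k, m)))" for k
    by (rule summable_comparison_test[OF _ geo[of "?r ^ k"]]) (use bound in auto)
  have "(\<lambda>p. norm (g p)) summable_on UNIV \<times> UNIV"
    unfolding Infinite_Sum.abs_summable_on_Sigma_iff
  proof (intro conjI ballI)
    show "(\<lambda>m. norm (g (k, m))) summable_on UNIV" for k
      using inner[of k] by (intro norm_summable_imp_summable_on) simp
    have le: "infsum (\<lambda>m. norm (g (k, m))) UNIV \<le> ?r ^ k * (1 / (1 - ?r))" for k
    proof -
      have "infsum (\<lambda>m. norm (g (k, m))) UNIV = (\<Sum>m. norm (g (k, m)))"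
        using inner[of k] by (intro infsumI sums_nonneg_imp_has_sum) (auto simp: summable_sums)
      also have "\<dots> \<le> (\<Sum>m. ?r ^ k * ?r ^ m)"
        using bound inner geo by (intro suminf_le) auto
      also have "\<dots> = ?r ^ k * (1 / (1 - ?r))"
        using x by (subst suminf_mult) (auto simp: suminf_geometric)
      finally show ?thesis .
    qed
    have "summable (\<lambda>k. norm (norm (infsum (\<lambda>m. norm (g (k, m))) UNIV)))"
      by (rule summable_comparison_test[OF _ geo[of "1 / (1 - ?r)"]]) (use le in \<open>auto simp: infsum_nonneg mult.commute\<close>)
    then show "(\<lambda>k. norm (infsum (\<lambda>m. norm (g (k, m))) UNIV)) summable_on UNIV"
      by (intro norm_summable_imp_summable_on) simp
  qed
  then obtain S where S: "(g has_sum S) (UNIV \<times> UNIV)"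
    using Infinite_Sum.abs_summable_summable summable_on_def by blast
  have "((\<lambda>k. \<Sum>m. (x ^ Suc k) ^ Suc m / of_nat (Suc m)) has_sum S) UNIV"
  proof (rule has_sum_SigmaD[OF S])
    show "((\<lambda>m. g (k, m)) has_sum (\<Sum>m. (x ^ Suc k) ^ Suc m / of_nat (Suc m))) UNIV" for k
    proof (rule norm_summable_imp_has_sum[OF inner])
      show "(\<lambda>m. g (k, m)) sums (\<Sum>m. (x ^ Suc k) ^ Suc m / of_nat (Suc m))"
        using summable_sums[OF summable_norm_cancel[OF inner[of k]]] by (simp add: g_def)
    qed
  qed
  then have 1: "(\<lambda>k. \<Sum>m. (x ^ Suc k) ^ Suc m / of_nat (Suc m)) sums S"
    by (rule has_sum_imp_sums)
  let ?T = "Sigma UNIV (\<lambda>n. {m. 0 < n \<and> Suc m dvd n})"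
  have "(g has_sum S) (UNIV \<times> UNIV) \<longleftrightarrow> ((\<lambda>(n, m). x ^ n / of_nat (Suc m)) has_sum S) ?T"
    by (rule has_sum_reindex_bij_witness[of _ "\<lambda>(n, m). (n div Suc m - 1, m)" "\<lambda>(k, m). (Suc k * Suc m, m)"])
      (auto simp: g_def power_mult elim!: dvdE simp del: of_nat_Suc power_Suc mult_Suc mult_Suc_right)
  then have "((\<lambda>(n, m). x ^ n / of_nat (Suc m)) has_sum S) ?T"
    using S by simp
  then have "((\<lambda>n. \<Sum>m | 0 < n \<and> Suc m dvd n. x ^ n / of_nat (Suc m)) has_sum S) UNIV"
  proof (rule has_sum_SigmaD)
    fix n :: nat
    have "finite {m. 0 < n \<and> Suc m dvd n}"
      by (rule finite_subset[of _ "{..<n}"]) (auto dest: dvd_imp_le)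
    then show "((\<lambda>m. case (n, m) of (n, m) \<Rightarrow> x ^ n / of_nat (Suc m)) has_sum
        (\<Sum>m | 0 < n \<and> Suc m dvd n. x ^ n / of_nat (Suc m))) {m. 0 < n \<and> Suc m dvd n}"
      by (simp del: of_nat_Suc)
  qed
  then have "(\<lambda>n. \<Sum>m | 0 < n \<and> Suc m dvd n. x ^ n / of_nat (Suc m)) sums S"
    by (rule has_sum_imp_sums)
  then have "(\<lambda>n. - (\<Sum>m | 0 < n \<and> Suc m dvd n. x ^ n / of_nat (Suc m))) sums (- S)"
    by (rule sums_minus)
  moreover have "- (\<Sum>m | 0 < n \<and> Suc m dvd n. x ^ n / of_nat (Suc m)) = fps_nth euler_log n * x ^ n" for n
    by (simp add: euler_log_def sum_distrib_right del: of_nat_Suc)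
  ultimately have "(\<lambda>n. fps_nth euler_log n * x ^ n) sums (- S)" by simp
  then show ?thesis using that 1 by blast
qed

text \<open>The function exp (a L), with L the sum of the logarithm series, is holomorphic on the
  unit disc, so its Taylor series, which is the formal composite, converges to it there. The partial
  products are exponentials of partial sums; their limit is an exponential and so not 0, as
  convergence of the product requires.\<close>

lemma euler_product:
  fixes x a :: complex
  assumes x: "norm x < 1"
  shows "convergent_prod (\<lambda>k. one_minus_cpow (x ^ Suc k) a)"
    "(\<lambda>n. fps_nth (fps_exp a oo euler_log) n * x ^ n) sums (\<Prod>k. one_minus_cpow (x ^ Suc k) a)"
proof -
  obtain S where S: "(\<lambda>n. fps_nth euler_log n * x ^ n) sums (- S)"
    "(\<lambda>k. \<Sum>m. (x ^ Suc k) ^ Suc m / of_nat (Suc m)) sums S"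
    using euler_log_sums[OF x] .
  have rad: "1 \<le> fps_conv_radius euler_log"
    unfolding fps_conv_radius_def
  proof (rule conv_radius_geI_ex')
    fix r :: real assume "0 < r" "ereal r < 1"
    then have "norm (of_real r :: complex) < 1" by simp
    from euler_log_sums[OF this] show "summable (\<lambda>n. fps_nth euler_log n * of_real r ^ n)"
      by (metis sums_summable)
  qed
  have eval: "eval_fps euler_log x = - S"
    using S(1) by (simp add: eval_fps_def sums_iff)
  define f where "f = (\<lambda>z. exp (a * z)) \<circ> eval_fps euler_log"
  have fps: "f has_fps_expansion (fps_exp a oo euler_log)"
    unfolding f_def
  proof (rule has_fps_expansion_compose)
    show "eval_fps euler_log has_fps_expansion euler_log"
      using rad by (intro eval_fps_has_fps_expansion) (auto intro: less_le_trans[of 0 1])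
  qed (auto intro: has_fps_expansion_exp)
  have "eval_fps euler_log holomorphic_on ball 0 1"
  proof (rule holomorphic_on_eval_fps, rule subsetI)
    fix z :: complex assume "z \<in> ball 0 1"
    then have "ereal (norm z) < 1" by (simp add: one_ereal_def)
    then show "z \<in> eball 0 (fps_conv_radius euler_log)"
      using less_le_trans[OF _ rad] by (simp add: in_eball_iff)
  qed
  then have hol: "f holomorphic_on ball 0 1"
    unfolding f_def o_def by (intro holomorphic_on_exp' holomorphic_on_mult holomorphic_on_const)
  have "f has_fps_expansion fps_expansion f 0"
    by (rule has_fps_expansion_fps_expansion[OF open_ball _ hol]) simp
  then have "fps_exp a oo euler_log = fps_expansion f 0"
    using fps by (rule fps_expansion_unique_complex[rotated])
  then have nth: "fps_nth (fps_exp a oo euler_log) n = (deriv ^^ n) f 0 / fact n" for n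
    by (simp add: fps_expansion_def)
  have "(\<lambda>n. (deriv ^^ n) f 0 / fact n * (x - 0) ^ n) sums f x"
    using x by (intro holomorphic_power_series[OF hol]) simp
  then have sums: "(\<lambda>n. fps_nth (fps_exp a oo euler_log) n * x ^ n) sums exp (a * - S)"
    unfolding nth by (simp add: f_def eval)
  have "(\<lambda>n. \<Prod>k\<le>n. one_minus_cpow (x ^ Suc (k + 0)) a) \<longlonglongrightarrow> exp (a * - S)"
  proof -
    have "(\<lambda>n. exp (- a * (\<Sum>k\<le>n. \<Sum>m. (x ^ Suc k) ^ Suc m / of_nat (Suc m)))) \<longlonglongrightarrow> exp (- a * S)"
      using S(2) unfolding sums_def_le by (intro tendsto_intros)
    then show ?thesis
      by (simp add: one_minus_cpow_def sum_distrib_left exp_sum flip: sum_negf del: of_nat_Suc power_Suc)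
  qed
  then have raw: "raw_has_prod (\<lambda>k. one_minus_cpow (x ^ Suc k) a) 0 (exp (a * - S))"
    by (simp add: raw_has_prod_def)
  then show "convergent_prod (\<lambda>k. one_minus_cpow (x ^ Suc k) a)"
    by (auto simp: convergent_prod_def)
  have "(\<Prod>k. one_minus_cpow (x ^ Suc k) a) = exp (a * - S)"
    using raw by (intro has_prod_unique[symmetric]) (simp add: has_prod_def)
  then show "(\<lambda>n. fps_nth (fps_exp a oo euler_log) n * x ^ n) sums (\<Prod>k. one_minus_cpow (x ^ Suc k) a)"
    using sums by simp
qed

section \<open>Polynomial dependence on d\<close>

definition poly_fun :: "(complex \<Rightarrow> complex) \<Rightarrow> bool" where
  "poly_fun f \<longleftrightarrow> (\<exists>p. f = poly p)"

lemma poly_fun_const [intro]: "poly_fun (\<lambda>_. c)"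
  unfolding poly_fun_def by (rule exI[of _ "[:c:]"]) auto

lemma poly_fun_id [intro]: "poly_fun (\<lambda>d. d)"
  unfolding poly_fun_def by (rule exI[of _ "[:0, 1:]"]) auto

lemma poly_fun_add [intro]: "poly_fun f \<Longrightarrow> poly_fun g \<Longrightarrow> poly_fun (\<lambda>d. f d + g d)"
  unfolding poly_fun_def by (elim exE, rule_tac x = "p + pa" in exI) (simp add: fun_eq_iff)

lemma poly_fun_diff [intro]: "poly_fun f \<Longrightarrow> poly_fun g \<Longrightarrow> poly_fun (\<lambda>d. f d - g d)"
  unfolding poly_fun_def by (elim exE, rule_tac x = "p - pa" in exI) (simp add: fun_eq_iff)

lemma poly_fun_uminus [intro]: "poly_fun f \<Longrightarrow> poly_fun (\<lambda>d. - f d)"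
  using poly_fun_diff[OF poly_fun_const[of 0]] by simp

lemma poly_fun_mult [intro]: "poly_fun f \<Longrightarrow> poly_fun g \<Longrightarrow> poly_fun (\<lambda>d. f d * g d)"
  unfolding poly_fun_def by (elim exE, rule_tac x = "p * pa" in exI) (simp add: fun_eq_iff)

lemma poly_fun_divide [intro]: "poly_fun f \<Longrightarrow> poly_fun (\<lambda>d. f d / c)"
  using poly_fun_mult[OF _ poly_fun_const[of "1 / c"]] by simp

lemma poly_fun_power [intro]: "poly_fun f \<Longrightarrow> poly_fun (\<lambda>d. f d ^ n)"
  by (induction n) auto

lemma poly_fun_sum [intro]: "(\<And>i. i \<in> A \<Longrightarrow> poly_fun (f i)) \<Longrightarrow> poly_fun (\<lambda>d. \<Sum>i\<in>A. f i d)"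
  by (induction A rule: infinite_finite_induct) auto

lemma poly_fun_prod [intro]: "(\<And>i. i \<in> A \<Longrightarrow> poly_fun (f i)) \<Longrightarrow> poly_fun (\<lambda>d. \<Prod>i\<in>A. f i d)"
  by (induction A rule: infinite_finite_induct) auto

lemma poly_fun_eqI:
  assumes "poly_fun f" "poly_fun g" "infinite A" "\<And>d. d \<in> A \<Longrightarrow> f d = g d"
  shows "f = g"
proof -
  obtain p q where pq: "f = poly p" "g = poly q" using assms by (auto simp: poly_fun_def)
  have "A \<subseteq> {d. poly (p - q) d = 0}" using assms(4) pq by auto
  then have "p - q = 0" using poly_roots_finite[of "p - q"] assms(3) finite_subset by blast
  then show ?thesis using pq by simp
qed

lemma poly_fun_binomial_fps: "poly_fun (\<lambda>d. fps_nth (binomial_fps d) i)"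
  unfolding binomial_fps_def fps_nth_Abs_fps gbinomial_prod_rev
  by (intro poly_fun_divide poly_fun_mult poly_fun_const poly_fun_prod poly_fun_diff poly_fun_id poly_fun_uminus)

lemma poly_fun_binomial_fps_neg: "poly_fun (\<lambda>d. fps_nth (binomial_fps (- d)) i)"
  unfolding binomial_fps_def fps_nth_Abs_fps gbinomial_prod_rev
  by (intro poly_fun_divide poly_fun_mult poly_fun_const poly_fun_prod poly_fun_diff poly_fun_id poly_fun_uminus)

text \<open>The coefficient of x^m on the right-hand side of the theorem, where d + 2 is z and the
  Durfee sign has become the parity of the number of parts.\<close>

definition strict_hook_sum :: "nat \<Rightarrow> complex \<Rightarrow> complex" where
  "strict_hook_sum m d = (\<Sum>\<mu>\<in>strict_partitions m. (-1) ^ length \<mu> * hook_product (d + 2) (double_partition \<mu>))"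

text \<open>The same coefficient through the rows defined by H, which avoid the denominators of
  \<open>hook_entry\<close> that may vanish at integral z.\<close>

definition strict_det_sum :: "nat \<Rightarrow> complex \<Rightarrow> complex" where
  "strict_det_sum m d = (\<Sum>\<mu>\<in>strict_partitions m. (-1) ^ length \<mu> *
     Determinant.det (list_mat (\<lambda>k b. fps_nth (hook_row (binomial_fps (- d)) (binomial_fps d) k) b) \<mu>))"

lemma poly_fun_strict_hook_sum: "poly_fun (strict_hook_sum m)"
proof -
  have "poly_fun (\<lambda>d. hook_product (d + 2) \<nu>)" for \<nu>
    unfolding hook_product_def by (intro poly_fun_prod poly_fun_diff poly_fun_divide poly_fun_add poly_fun_const poly_fun_id)
  then show ?thesis
    unfolding strict_hook_sum_def [abs_def] by (intro poly_fun_sum poly_fun_mult poly_fun_const)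
qed

lemma poly_fun_strict_det_sum: "poly_fun (strict_det_sum m)"
proof -
  have entry: "poly_fun (\<lambda>d. fps_nth (hook_row (binomial_fps (- d)) (binomial_fps d) k) b)" for k b
  proof -
    have "poly_fun (\<lambda>d. fps_nth (hook_num (binomial_fps (- d)) k) i)" for i
      by (cases "i = 0"; cases "2 \<le> i"; cases "i \<le> k + 2")
        (simp_all add: hook_num_nth poly_fun_binomial_fps_neg poly_fun_add poly_fun_const)
    then show ?thesis
      unfolding hook_row_def fps_mult_nth by (intro poly_fun_sum poly_fun_mult poly_fun_binomial_fps)
  qed
  have "poly_fun (\<lambda>d. Determinant.det (list_mat (\<lambda>k b. fps_nth (hook_row (binomial_fps (- d)) (binomial_fps d) k) b) \<mu>))" for \<mu>
  proof -
    have "Determinant.det (list_mat (\<lambda>k b. fps_nth (hook_row (binomial_fps (- d)) (binomial_fps d) k) b) \<mu>) =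
      (\<Sum>p\<in>{p. p permutes {0..<length \<mu>}}. signof p * (\<Prod>i = 0..<length \<mu>.
         fps_nth (hook_row (binomial_fps (- d)) (binomial_fps d) (\<mu> ! i)) (\<mu> ! p i)))" for d
      unfolding det_def'[OF list_mat_carrier]
      by (intro sum.cong refl arg_cong2[where f = times] prod.cong) (auto simp: list_mat_def permutes_lessThan_less)
    then show ?thesis by (simp only:) (intro poly_fun_sum poly_fun_mult poly_fun_const poly_fun_prod entry)
  qed
  then show ?thesis
    unfolding strict_det_sum_def [abs_def] by (intro poly_fun_sum poly_fun_mult poly_fun_const)
qed

text \<open>The Cauchy form applies when d + 2 is not an integer. Both sides are polynomials in d,
  so agreement on the infinite set of non-integers suffices.\<close>

lemma strict_sums_eq: "strict_hook_sum m = strict_det_sum m"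
proof (rule poly_fun_eqI[OF poly_fun_strict_hook_sum poly_fun_strict_det_sum, of "- \<int>"])
  have "countable (\<int> :: complex set)"
    unfolding Ints_def by (rule countable_image) simp
  then show "infinite (- (\<int> :: complex set))"
    using uncountable_UNIV_complex by (metis Compl_partition countable_Un countable_finite)
next
  fix d :: complex assume "d \<in> - \<int>"
  then have z: "d + 2 \<notin> \<int>" using Ints_diff[of "d + 2" 2] by auto
  have "hook_product (d + 2) (double_partition \<mu>) =
      Determinant.det (list_mat (\<lambda>k b. fps_nth (hook_row (binomial_fps (- d)) (binomial_fps d) k) b) \<mu>)"
    if "\<mu> \<in> strict_partitions m" for \<mu>
  proof -
    have str: "strict_partition \<mu>" using that by (simp add: strict_partitions_def)
    then have pos: "0 < \<mu> ! i" if "i < length \<mu>" for i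
      using that by (auto simp: strict_partition_def)
    have "list_mat (\<lambda>k b. fps_nth (hook_row (binomial_fps (- d)) (binomial_fps d) k) b) \<mu> = list_mat (hook_entry (d + 2)) \<mu>"
      using hook_row_eq_hook_entry[OF z] pos by (intro eq_matI) (auto simp: list_mat_def)
    then show ?thesis using hook_product_eq_det[OF z str] by simp
  qed
  then show "strict_hook_sum m d = strict_det_sum m d"
    unfolding strict_hook_sum_def strict_det_sum_def by (intro sum.cong) auto
qed

lemma fps_X_power_dvd_nth:
  fixes f g :: "complex fps"
  assumes "fps_X ^ Suc n dvd f - g" "m \<le> n"
  shows "fps_nth f m = fps_nth g m"
proof -
  obtain h where "f - g = fps_X ^ Suc n * h" using assms(1) by auto
  then have "fps_nth (f - g) m = 0" using assms(2) by (simp add: fps_X_power_mult_nth del: power_Suc)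
  then show ?thesis by simp
qed

lemma strict_det_sum_nat:
  assumes E: "\<And>N. fps_X ^ Suc N dvd E - (\<Prod>k = 1..N. 1 - fps_X ^ k)"
  shows "strict_det_sum m (of_nat d) = fps_nth (E ^ (d * Suc d div 2)) m"
proof -
  \<comment> \<open>Large enough both to contain the coefficient m and for the determinant at
    d.\<close>
  define n where "n = m + d + 2"
  have "fps_nth (E ^ (d * Suc d div 2)) m = fps_nth (hook_det d 0 n) m"
    by (rule fps_X_power_dvd_nth[OF hook_det_nat[OF E, of d n], symmetric]) (simp_all add: n_def)
  also have "\<dots> = strict_det_sum m (of_nat d)"
    unfolding hook_det_eq strict_det_sum_def by (rule det_hook_mat_nth) (simp add: n_def)
  finally show ?thesis by simp
qed

text \<open>The second interpolation, from natural d: coefficients of exp (s L) are polynomials in s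
  because L has no constant term, and s = d (d + 1) / 2 is the exponent found for the
  determinant.\<close>

lemma strict_hook_sum_eq:
  assumes E: "\<And>N. fps_X ^ Suc N dvd (fps_exp 1 oo L) - (\<Prod>k = 1..N. 1 - fps_X ^ k)"
    and L0: "fps_nth L 0 = 0"
  shows "strict_hook_sum m d = fps_nth (fps_exp (d * (d + 1) / 2) oo L) m"
proof -
  have "poly_fun (\<lambda>d. fps_nth (fps_exp (d * (d + 1) / 2) oo L) m)"
    unfolding fps_compose_nth fps_exp_def fps_nth_Abs_fps
    by (intro poly_fun_sum poly_fun_mult poly_fun_divide poly_fun_power poly_fun_add poly_fun_const poly_fun_id)
  then have "strict_det_sum m = (\<lambda>d. fps_nth (fps_exp (d * (d + 1) / 2) oo L) m)"
  proof (rule poly_fun_eqI[OF poly_fun_strict_det_sum])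
    show "infinite (range (of_nat :: nat \<Rightarrow> complex))"
      by (rule range_inj_infinite) (simp add: inj_on_def)
  next
    fix d :: complex assume "d \<in> range of_nat"
    then obtain k where k: "d = of_nat k" by auto
    have "2 * (k * Suc k div 2) = k * Suc k" by simp
    then have "2 * (of_nat (k * Suc k div 2) :: complex) = of_nat k * (of_nat k + 1)"
      by (metis of_nat_mult of_nat_numeral of_nat_Suc add.commute)
    then have "d * (d + 1) / 2 = 2 * of_nat (k * Suc k div 2) / 2" by (simp only: k)
    then have "of_nat (k * Suc k div 2) = d * (d + 1) / 2" by simp
    then have "(fps_exp 1 oo L) ^ (k * Suc k div 2) = fps_exp (d * (d + 1) / 2) oo L"
      unfolding fps_compose_power[OF L0] fps_exp_power_mult by (simp only: mult_1_right)
    then show "strict_det_sum m d = fps_nth (fps_exp (d * (d + 1) / 2) oo L) m"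
      unfolding k strict_det_sum_nat[OF E] by simp
  qed
  then show ?thesis unfolding strict_sums_eq by simp
qed

theorem theorem1p1:
  fixes t x :: complex
  assumes "norm x < 1"
  shows "convergent_prod (\<lambda>k. one_minus_cpow (x ^ Suc k) (2 * t\<^sup>2 + t)) \<and>
    (\<lambda>n. \<Sum>\<nu> | \<nu> \<in> DD \<and> weight \<nu> = 2 * n.
        of_int (durfee_sign \<nu>) * x ^ (weight \<nu> div 2) *
        (\<Prod>b\<in>boxes \<nu>. 1 - (2 * t + 2) / (of_int (hook_length \<nu> b) * of_int (hook_sign b))))
      sums (\<Prod>k. one_minus_cpow (x ^ Suc k) (2 * t\<^sup>2 + t))"
proof -
  define a where "a = 2 * t\<^sup>2 + t"
  \<comment> \<open>The exponent d (d + 1) / 2 at d = 2 t.\<close>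
  have a: "2 * t * (2 * t + 1) / 2 = a"
    by (simp add: a_def power2_eq_square algebra_simps)
  have "(\<Sum>\<nu> | \<nu> \<in> DD \<and> weight \<nu> = 2 * n.
        of_int (durfee_sign \<nu>) * x ^ (weight \<nu> div 2) *
        (\<Prod>b\<in>boxes \<nu>. 1 - (2 * t + 2) / (of_int (hook_length \<nu> b) * of_int (hook_sign b)))) =
      fps_nth (fps_exp a oo euler_log) n * x ^ n" for n
  proof -
    have inj: "inj_on double_partition (strict_partitions n)"
      by (rule inj_on_subset[OF inj_on_double_partition]) (auto simp: strict_partitions_def)
    have "(\<Sum>\<nu> | \<nu> \<in> DD \<and> weight \<nu> = 2 * n.
        of_int (durfee_sign \<nu>) * x ^ (weight \<nu> div 2) *
        (\<Prod>b\<in>boxes \<nu>. 1 - (2 * t + 2) / (of_int (hook_length \<nu> b) * of_int (hook_sign b)))) =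
      (\<Sum>\<mu>\<in>strict_partitions n. (-1) ^ length \<mu> * hook_product (2 * t + 2) (double_partition \<mu>) * x ^ n)"
      unfolding DD_weight_eq sum.reindex[OF inj] o_def
      by (intro sum.cong refl)
        (auto simp: strict_partitions_def durfee_sign_def durfee_double_partition weight_double_partition
          hook_product_def mult_ac)
    also have "\<dots> = strict_hook_sum n (2 * t) * x ^ n"
      by (simp add: strict_hook_sum_def sum_distrib_right)
    also have "strict_hook_sum n (2 * t) = fps_nth (fps_exp a oo euler_log) n"
      using strict_hook_sum_eq[OF fps_exp_euler_log euler_log_nth_0, of n "2 * t"] by (simp only: a)
    finally show ?thesis .
  qed
  then show ?thesis
    using euler_product[OF assms, of a] unfolding a_def[symmetric] by simp
qed

end
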